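(* Let $n\ge 1$ be an integer. An ordinal $\alpha$, viewed as the linearly ordered structure $(\alpha,<)$, is injectively $\omega^n$-automatic if and only if $\alpha<\omega^{\omega^n}$ (ordinal exponentiation).
   Context: Words: for an ordinal $\alpha$ and a finite alphabet $\Sigma$, a word of length $\alpha$ over $\Sigma$ is a sequence $(\sigma(\beta))_{\beta<\alpha}$ of letters of $\Sigma$; the set of these is $\Sigma^\alpha$. A tuple of words $(\sigma_1,\ldots,\sigma_k)\in\Sigma_1^\alpha\times\cdots\times\Sigma_k^\alpha$ is identified with the word $\beta\mapsto(\sigma_1(\beta),\ldots,\sigma_k(\beta))$ over the product alphabet, so relations between words of length $\alpha$ are regarded as languages over the product alphabet. Automata: an ordinal Büchi automaton is a sextuple $(\Sigma,Q,q_0,\Delta,\gamma,F)$ with $\Sigma$ a finite alphabet, $Q$ a finite set of states, $q_0\in Q$ the initial state, $\Delta\subseteq Q\times\Sigma\times Q$ (successor transitions), $\gamma\subseteq P(Q)\times Q$ (limit transitions; $P(Q)$ is the powerset of $Q$), and $F\subseteq Q$. A run on a word $\sigma$ of length $\alpha$ is an $(\alpha+1)$-sequence of states $x$ with $x(0)=q_0$; $(x(i),\sigma(i),x(i+1))\in\Delta$ for $i<\alpha$; and $(\mathrm{Inf}(x,i),x(i))\in\gamma$ for every limit ordinal $i\le\alpha$, where $\mathrm{Inf}(x,i)=\{q\in Q\mid\forall\mu<i\ \exists\nu<i\ (\mu<\nu\text{ and }x(\nu)=q)\}$. The run is successful if $x(\alpha)\in F$, and a word is accepted if it has a successful run. An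 $\omega^n$-automaton is an ordinal Büchi automaton reading only words of length $\omega^n$; $L(\mathcal{A})$ denotes the set of words of length $\omega^n$ accepted by $\mathcal{A}$. Injectively $\omega^n$-automatic: a relational structure $\mathcal{M}=(M,(R_i)_{1\le i\le k})$, with $R_i$ of finite arity $n_i$, is injectively $\omega^n$-automatic if there are a finite alphabet $\Sigma$, an $\omega^n$-automaton $\mathcal{A}$ over $\Sigma$, and $\omega^n$-automata $\mathcal{A}_i$ over $\Sigma^{n_i}$ accepting relations $R_i'\subseteq L(\mathcal{A})^{n_i}$ ($1\le i\le k$), together with an isomorphism $h$ from $(L(\mathcal{A}),(R_i')_{1\le i\le k})$ onto $\mathcal{M}$. An ordinal $\alpha$ is called injectively $\omega^n$-automatic if the structure $(\alpha,<)$ is. *)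

theory Defs
  imports Main "HOL-Library.FuncSet"
begin

section \<open>Ordinals\<close>

text \<open>
  Ordinals are given by well-orders \<open>r :: 'a rel\<close>, which are reflexive (as in \<open>natLeq\<close>) and are
  compared by \<open>ordLess\<close> from the library. The ordinals below \<open>r\<close> are the elements of
  \<open>Field r\<close>, and \<open>underS r i\<close> is the set of the ordinals below \<open>i\<close>.
\<close>

text \<open>Ordinal exponentiation \<open>r\<^sup>s\<close>: the functions from \<open>s\<close> to \<open>r\<close> that are nonzero at finitely many
  places, compared at the largest place where they differ.\<close>

definition opow_carrier :: "'a rel \<Rightarrow> 'b rel \<Rightarrow> ('b \<Rightarrow> 'a) set" where
  "opow_carrier r s =
     {f \<in> Field s \<rightarrow>\<^sub>E Field r. finite {b \<in> Field s. f b \<noteq> wo_rel.minim r (Field r)}}"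

definition opow :: "'a rel \<Rightarrow> 'b rel \<Rightarrow> ('b \<Rightarrow> 'a) rel" where
  "opow r s = {(f, g). f \<in> opow_carrier r s \<and> g \<in> opow_carrier r s \<and>
     (f = g \<or> (\<exists>b \<in> Field s. f b \<noteq> g b \<and> (f b, g b) \<in> r \<and>
        (\<forall>c \<in> Field s. b \<in> underS s c \<longrightarrow> f c = g c)))}"

abbreviation omega_pow :: "nat \<Rightarrow> (nat \<Rightarrow> nat) rel" where
  "omega_pow n \<equiv> opow natLeq (natLeq_on n)"

text \<open>\<open>r + 1\<close>, with \<open>None\<close> as the new largest element. For \<open>i \<in> Field r\<close> the ordinal \<open>i\<close> is
  represented by \<open>Some i\<close>, and \<open>None\<close> represents \<open>r\<close> itself.\<close>

definition osuc :: "'a rel \<Rightarrow> 'a option rel" where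
  "osuc r = {(Some i, Some j) |i j. (i, j) \<in> r} \<union> {(Some i, None) |i. i \<in> Field r} \<union> {(None, None)}"

definition limit_position :: "'a rel \<Rightarrow> 'a \<Rightarrow> bool" where
  "limit_position r i \<longleftrightarrow> i \<in> Field r \<and> underS r i \<noteq> {} \<and> (\<forall>j \<in> underS r i. wo_rel.suc r {j} \<noteq> i)"

section \<open>Ordinal Buechi automata\<close>

record ('l, 'q) automaton =
  alphabet :: "'l set"
  states :: "'q set"
  initial :: 'q
  succ_trans :: "('q \<times> 'l \<times> 'q) set"
  lim_trans :: "('q set \<times> 'q) set"
  final :: "'q set"

definition ordinal_automaton :: "('l, 'q) automaton \<Rightarrow> bool" where
  "ordinal_automaton A \<longleftrightarrow>
     finite (alphabet A) \<and> finite (states A) \<and> initial A \<in> states A \<and>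
     succ_trans A \<subseteq> states A \<times> alphabet A \<times> states A \<and>
     lim_trans A \<subseteq> Pow (states A) \<times> states A \<and>
     final A \<subseteq> states A"

text \<open>Words are extensional functions, so that equality of words is equality in HOL.\<close>

definition words :: "'b rel \<Rightarrow> 'l set \<Rightarrow> ('b \<Rightarrow> 'l) set" where
  "words r \<Sigma> = (Field r \<rightarrow>\<^sub>E \<Sigma>)"

definition Inf_states :: "'b rel \<Rightarrow> ('b \<Rightarrow> 'q) \<Rightarrow> 'b \<Rightarrow> 'q set" where
  "Inf_states r x i = {q. \<forall>\<mu> \<in> underS r i. \<exists>\<nu> \<in> underS r i. \<mu> \<in> underS r \<nu> \<and> x \<nu> = q}"

definition is_run ::
  "'b rel \<Rightarrow> ('l, 'q) automaton \<Rightarrow> ('b \<Rightarrow> 'l) \<Rightarrow> ('b option \<Rightarrow> 'q) \<Rightarrow> bool" where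
  "is_run r A \<sigma> x \<longleftrightarrow>
     (\<forall>i \<in> Field (osuc r). x i \<in> states A) \<and>
     x (wo_rel.minim (osuc r) (Field (osuc r))) = initial A \<and>
     (\<forall>i \<in> Field r. (x (Some i), \<sigma> i, x (wo_rel.suc (osuc r) {Some i})) \<in> succ_trans A) \<and>
     (\<forall>i. limit_position (osuc r) i \<longrightarrow> (Inf_states (osuc r) x i, x i) \<in> lim_trans A)"

definition language :: "'b rel \<Rightarrow> ('l, 'q) automaton \<Rightarrow> ('b \<Rightarrow> 'l) set" where
  "language r A = {\<sigma> \<in> words r (alphabet A). \<exists>x. is_run r A \<sigma> x \<and> x None \<in> final A}"

section \<open>Automatic structures\<close>

definition tuples :: "nat \<Rightarrow> 'a set \<Rightarrow> 'a list set" where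
  "tuples k M = {xs. length xs = k \<and> set xs \<subseteq> M}"

text \<open>The word over the product alphabet that is identified with a tuple of words.\<close>

definition tuple_word :: "'b rel \<Rightarrow> ('b \<Rightarrow> 'l) list \<Rightarrow> ('b \<Rightarrow> 'l list)" where
  "tuple_word r ws = (\<lambda>\<beta> \<in> Field r. map (\<lambda>w. w \<beta>) ws)"

definition accepted_relation ::
  "'b rel \<Rightarrow> 'l set \<Rightarrow> nat \<Rightarrow> ('l list, 'q) automaton \<Rightarrow> ('b \<Rightarrow> 'l) list set" where
  "accepted_relation r \<Sigma> k B = {ws \<in> tuples k (words r \<Sigma>). tuple_word r ws \<in> language r B}"

text \<open>A relational structure is its domain with the list of its relations, each with its arity.\<close>

type_synonym 'a relstruct = "'a set \<times> (nat \<times> 'a list set) list"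

definition is_relstruct :: "'a relstruct \<Rightarrow> bool" where
  "is_relstruct S \<longleftrightarrow> (\<forall>(k, R) \<in> set (snd S). R \<subseteq> tuples k (fst S))"

definition relstruct_iso :: "('a \<Rightarrow> 'c) \<Rightarrow> 'a relstruct \<Rightarrow> 'c relstruct \<Rightarrow> bool" where
  "relstruct_iso h S T \<longleftrightarrow>
     bij_betw h (fst S) (fst T) \<and> map fst (snd S) = map fst (snd T) \<and>
     (\<forall>i < length (snd S). \<forall>xs \<in> tuples (fst (snd S ! i)) (fst S).
        xs \<in> snd (snd S ! i) \<longleftrightarrow> map h xs \<in> snd (snd T ! i))"

text \<open>
  Words have length \<open>r\<close>; \<open>Bs\<close> lists the automata for the relations with their arities. Since
  alphabets and state sets are finite, taking letters and states to be natural numbers is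
  no restriction.
\<close>

definition injectively_automatic :: "'b rel \<Rightarrow> 'a relstruct \<Rightarrow> bool" where
  "injectively_automatic r S \<longleftrightarrow>
     (\<exists>(A :: (nat, nat) automaton) (Bs :: (nat \<times> (nat list, nat) automaton) list) h.
        ordinal_automaton A \<and>
        (\<forall>(k, B) \<in> set Bs. ordinal_automaton B \<and> alphabet B = tuples k (alphabet A)) \<and>
        (let W = (language r A, map (\<lambda>(k, B). (k, accepted_relation r (alphabet A) k B)) Bs)
         in is_relstruct W \<and> relstruct_iso h W S))"

definition ordinal_structure :: "'a rel \<Rightarrow> 'a relstruct" where
  "ordinal_structure \<alpha> = (Field \<alpha>, [(2, {[i, j] |i j. i \<in> underS \<alpha> j})])"

end

theory Submission
  imports Defs "HOL-Library.Ramsey" "HOL-Library.Nat_Bijection"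
begin

text \<open>
  Write an exponent below \<open>\<omega>\<^sup>n\<close> as the tuple of its coefficients in Cantor normal form. The ordinal
  \<open>\<omega>^(\<omega>^n)\<close> is then the set of finitely supported functions from these tuples to the natural
  numbers, compared at the largest tuple where they differ, and the positions of a word of length
  \<open>\<omega>\<^sup>n\<close> are the same tuples.

  First, automatic ordinals are small. The set of triples (first state, states visited, last state) of
  the runs of an automaton on a word is its type. Types of words of length \<open>\<omega>\<^sup>n\<close> live in a finite
  monoid, and the type of an \<open>\<omega>\<close>-sequence of words is an infinite product of their types
  (\<open>omega_monoid_run_types\<close>, \<open>run_type_iff\<close>). So it suffices to bound any well-order whose domain
  and order relation are determined by such types, by induction on \<open>n\<close>: if this bound is
  a finite multiple of some \<open>\<omega>^a\<close> with \<open>a < \<omega>\<^sup>n\<close> for words of length \<open>\<omega>\<^sup>n\<close>, then it is one with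
  \<open>a < \<omega>^(n+1)\<close> for \<open>\<omega>\<close>-sequences of such words (\<open>type_bounded_omega_words\<close>). The
  pigeonhole part of the argument rests on Ramsey's theorem. If two sequences have the same type on
  all blocks of a common factorisation, they agree from some point on, because otherwise mixing
  their blocks gives an infinite descending chain (\<open>tail_rigid\<close>). Hence there are finitely many
  sequences up to tails (\<open>finite_tail_classes\<close>), and each sequence of the domain is eventually
  periodic (\<open>eventually_periodic\<close>). The counting part is a decomposition in the style of Delhomme:
  cutting all sequences of a set at one place, with constant types on both sides, embeds the set
  into a product of two orders in which a smaller element is smaller in some coordinate, and the
  exponents of such a product add up (\<open>cut_box\<close>, \<open>pow_bounded_box\<close>). Prefixes cost less than
  \<open>\<omega>\<^sup>n\<close>. If one tail class were not bounded by \<open>\<omega>^(\<omega>^n * m)\<close> for any \<open>m\<close>, then the tails that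
  follow a prefix would attain infinitely many different levels; but, by periodicity, they form one
  of finitely many orders (\<open>order_bounded\<close>).

  Conversely, small ordinals are automatic. An ordinal below \<open>\<omega>^(\<omega>^n)\<close> is isomorphic to the set of
  the finite subsets of \<open>\<omega>\<^sup>n * m\<close> below a fixed one \<open>u\<close>, compared at the largest
  difference, when coefficients are written in unary (\<open>segment_of_track_functions\<close>). Such a subset
  is a word of length \<open>\<omega>\<^sup>n\<close> with \<open>m\<close> tracks. One deterministic automaton checks that words have
  finitely many nonzero letters and form an increasing chain that ends below \<open>u\<close>
  (\<open>accepted_iff\<close>, \<open>chain_language\<close>); chains of one word give the domain and chains of two
  words the order.
\<close>

section \<open>Well-orders as strict relations\<close>

text \<open>All orders below are given by a carrier and a strict relation that need not vanish outside it:
  the relations come from types of words, and the carriers are restricted and pulled back often.\<close>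
definition strict_wo :: "'a set \<Rightarrow> ('a \<Rightarrow> 'a \<Rightarrow> bool) \<Rightarrow> bool" where
  "strict_wo A lt \<longleftrightarrow>
     (\<forall>x\<in>A. \<not> lt x x) \<and>
     (\<forall>x\<in>A. \<forall>y\<in>A. \<forall>z\<in>A. lt x y \<longrightarrow> lt y z \<longrightarrow> lt x z) \<and>
     (\<forall>x\<in>A. \<forall>y\<in>A. x = y \<or> lt x y \<or> lt y x) \<and>
     (\<forall>S\<subseteq>A. S \<noteq> {} \<longrightarrow> (\<exists>x\<in>S. \<forall>y\<in>S. \<not> lt y x))"

lemmas strict_woD =
  strict_wo_def[THEN iffD1, THEN conjunct1]
  strict_wo_def[THEN iffD1, THEN conjunct2, THEN conjunct1]
  strict_wo_def[THEN iffD1, THEN conjunct2, THEN conjunct2, THEN conjunct1]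
  strict_wo_def[THEN iffD1, THEN conjunct2, THEN conjunct2, THEN conjunct2]

lemma strict_wo_irrefl: "strict_wo A lt \<Longrightarrow> x \<in> A \<Longrightarrow> \<not> lt x x"
  using strict_woD(1) by blast

lemma strict_wo_trans:
  "strict_wo A lt \<Longrightarrow> lt x y \<Longrightarrow> lt y z \<Longrightarrow> x \<in> A \<Longrightarrow> y \<in> A \<Longrightarrow> z \<in> A \<Longrightarrow> lt x z"
  by (drule strict_woD(2)) blast

lemma strict_wo_total: "strict_wo A lt \<Longrightarrow> x \<in> A \<Longrightarrow> y \<in> A \<Longrightarrow> x = y \<or> lt x y \<or> lt y x"
  by (drule strict_woD(3)) blast

lemma strict_wo_min:
  "strict_wo A lt \<Longrightarrow> S \<subseteq> A \<Longrightarrow> S \<noteq> {} \<Longrightarrow> \<exists>x\<in>S. \<forall>y\<in>S. \<not> lt y x"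
  by (drule strict_woD(4)) blast

lemma strict_wo_subset:
  assumes wo: "strict_wo A lt" and "B \<subseteq> A"
  shows "strict_wo B lt"
  unfolding strict_wo_def
proof (intro conjI ballI allI impI)
  show "\<exists>x\<in>S. \<forall>y\<in>S. \<not> lt y x" if "S \<subseteq> B" "S \<noteq> {}" for S
    using strict_wo_min[OF wo] that \<open>B \<subseteq> A\<close> by (meson subset_trans)
  show "lt x z" if "x \<in> B" "y \<in> B" "z \<in> B" "lt x y" "lt y z" for x y z
    using that strict_wo_trans[OF wo that(4,5)] \<open>B \<subseteq> A\<close> by blast
  show "x = y \<or> lt x y \<or> lt y x" if "x \<in> B" "y \<in> B" for x y
    using that strict_wo_total[OF wo] \<open>B \<subseteq> A\<close> by blast
  show "\<not> lt x x" if "x \<in> B" for x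
    using that strict_wo_irrefl[OF wo] \<open>B \<subseteq> A\<close> by blast
qed

lemma strict_wo_induct [consumes 2, case_names less]:
  assumes wo: "strict_wo A lt" and "x \<in> A"
    and step: "\<And>x. x \<in> A \<Longrightarrow> (\<And>y. y \<in> A \<Longrightarrow> lt y x \<Longrightarrow> Q y) \<Longrightarrow> Q x"
  shows "Q x"
proof (rule ccontr)
  assume "\<not> Q x"
  then have "{x\<in>A. \<not> Q x} \<noteq> {}" using assms by blast
  then obtain m where "m \<in> {x\<in>A. \<not> Q x}" "\<forall>y\<in>{x\<in>A. \<not> Q x}. \<not> lt y m"
    using strict_wo_min[OF wo, of "{x\<in>A. \<not> Q x}"] by blast
  then show False using step[of m] by blast
qed

lemma strict_wo_pullback:
  assumes wo: "strict_wo B lt'" and f: "\<And>x. x \<in> A \<Longrightarrow> f x \<in> B" "inj_on f A"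
    and iff: "\<And>x y. x \<in> A \<Longrightarrow> y \<in> A \<Longrightarrow> lt x y \<longleftrightarrow> lt' (f x) (f y)"
  shows "strict_wo A lt"
  unfolding strict_wo_def
proof (intro conjI ballI allI impI)
  fix x assume "x \<in> A" then show "\<not> lt x x"
    using iff[of x x] strict_wo_irrefl[OF wo, of "f x"] f(1) by blast
next
  fix x y z assume "x \<in> A" "y \<in> A" "z \<in> A" "lt x y" "lt y z"
  then show "lt x z"
    using iff[of x y] iff[of y z] iff[of x z] strict_wo_trans[OF wo, of "f x" "f y" "f z"] f(1) by blast
next
  fix x y assume "x \<in> A" "y \<in> A"
  then show "x = y \<or> lt x y \<or> lt y x"
    using iff[of x y] iff[of y x] strict_wo_total[OF wo, of "f x" "f y"] f(1) inj_onD[OF f(2), of x y]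
    by blast
next
  fix S assume S: "S \<subseteq> A" "S \<noteq> {}"
  then obtain m where "m \<in> f ` S" "\<forall>y\<in>f ` S. \<not> lt' y m"
    using strict_wo_min[OF wo, of "f ` S"] f by blast
  then obtain x where x: "x \<in> S" "\<forall>y\<in>S. \<not> lt' (f y) (f x)" by blast
  then have "\<forall>y\<in>S. \<not> lt y x" using iff S by (meson subsetD)
  then show "\<exists>x\<in>S. \<forall>y\<in>S. \<not> lt y x" using x by blast
qed

lemma strict_wo_mono_not_less:
  assumes wo: "strict_wo A lt" and f: "\<And>x. x \<in> A \<Longrightarrow> f x \<in> A"
    and mono: "\<And>x y. x \<in> A \<Longrightarrow> y \<in> A \<Longrightarrow> lt x y \<Longrightarrow> lt (f x) (f y)" and "x \<in> A"
  shows "\<not> lt (f x) x"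
  using wo \<open>x \<in> A\<close>
proof (induction rule: strict_wo_induct)
  case (less x)
  then show ?case using f mono by blast
qed

lemma strict_wo_finite_max:
  assumes wo: "strict_wo A lt" and "finite S" "S \<noteq> {}" "S \<subseteq> A"
  shows "\<exists>m\<in>S. \<forall>x\<in>S. x = m \<or> lt x m"
  using assms(2-)
proof (induction rule: finite_ne_induct)
  case (insert x F)
  then obtain m where m: "m \<in> F" "\<forall>x\<in>F. x = m \<or> lt x m" by blast
  show ?case
  proof (cases "lt m x")
    case True
    have "lt y x" if "y \<in> F" for y
      using m that insert.prems strict_wo_trans[OF wo _ True, of y] True by (cases "y = m") auto
    then show ?thesis by blast
  next
    case False
    then show ?thesis using m insert.prems strict_wo_total[OF wo, of x m] by blast
  qed
qed auto

definition wo_of :: "'a set \<Rightarrow> ('a \<Rightarrow> 'a \<Rightarrow> bool) \<Rightarrow> 'a rel" where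
  "wo_of A lt = {(x, y). x \<in> A \<and> y \<in> A \<and> (x = y \<or> lt x y)}"

lemma Field_wo_of [simp]: "Field (wo_of A lt) = A"
  by (auto simp: wo_of_def Field_def)

lemma Well_order_wo_of:
  assumes wo: "strict_wo A lt"
  shows "Well_order (wo_of A lt)"
proof -
  let ?r = "wo_of A lt"
  have "wf (?r - Id)"
  proof (rule wfI_min)
    fix x Q assume x: "(x::'a) \<in> Q"
    show "\<exists>z\<in>Q. \<forall>y. (y, z) \<in> ?r - Id \<longrightarrow> y \<notin> Q"
    proof (cases "Q \<inter> A = {}")
      case True then show ?thesis using x by (auto simp: wo_of_def)
    next
      case False
      then obtain z where "z \<in> Q \<inter> A" "\<forall>y\<in>Q \<inter> A. \<not> lt y z"
        using strict_wo_min[OF wo, of "Q \<inter> A"] by blast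
      then show ?thesis by (auto simp: wo_of_def)
    qed
  qed
  moreover have "Refl ?r" by (auto simp: wo_of_def Field_def refl_on_def)
  moreover have "trans ?r"
  proof (rule transI)
    fix x y z assume "(x, y) \<in> ?r" "(y, z) \<in> ?r"
    then show "(x, z) \<in> ?r" using strict_wo_trans[OF wo, of x y z] by (auto simp: wo_of_def)
  qed
  moreover have "antisym ?r"
  proof (rule antisymI)
    fix x y assume "(x, y) \<in> ?r" "(y, x) \<in> ?r"
    then show "x = y"
      using strict_wo_trans[OF wo, of x y x] strict_wo_irrefl[OF wo, of x] by (auto simp: wo_of_def)
  qed
  moreover have "Total ?r"
    using strict_wo_total[OF wo] unfolding total_on_def Field_wo_of by (auto simp: wo_of_def)
  moreover have "?r \<subseteq> A \<times> A" by (auto simp: wo_of_def)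
  ultimately show ?thesis
    by (simp add: well_order_on_def linear_order_on_def partial_order_on_def preorder_on_def)
qed

lemma strict_wo_Well_order:
  assumes r: "Well_order r"
  shows "strict_wo (Field r) (\<lambda>x y. x \<in> underS r y)"
proof -
  interpret wo: wo_rel r using r by (simp add: wo_rel_def)
  show ?thesis
    unfolding strict_wo_def
  proof (intro conjI ballI allI impI)
    fix S assume S: "S \<subseteq> Field r" "S \<noteq> {}"
    have "wo.minim S \<in> S" using wo.minim_in S by blast
    moreover have "y \<notin> underS r (wo.minim S)" if "y \<in> S" for y
      using wo.minim_least[OF S(1) that] antisymD[OF wo.ANTISYM, of y "wo.minim S"] by (auto simp: underS_def)
    ultimately show "\<exists>x\<in>S. \<forall>y\<in>S. y \<notin> underS r x" by blast
  next
    fix x y z assume "x \<in> underS r y" "y \<in> underS r z"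
    then have "(x, y) \<in> r" "x \<noteq> y" "(y, z) \<in> r" by (auto simp: underS_def)
    then show "x \<in> underS r z"
      using transD[OF wo.TRANS, of x y z] antisymD[OF wo.ANTISYM, of x y] by (auto simp: underS_def)
  next
    fix x y assume "x \<in> Field r" "y \<in> Field r"
    then show "x = y \<or> x \<in> underS r y \<or> y \<in> underS r x"
      using wo.TOTALS by (auto simp: underS_def)
  qed (simp add: underS_def)
qed

lemma underS_wo_of:
  "strict_wo A lt \<Longrightarrow> y \<in> A \<Longrightarrow> underS (wo_of A lt) y = {x\<in>A. lt x y}"
  by (auto simp: underS_def wo_of_def dest: strict_wo_irrefl)

text \<open>Otherwise the target would be isomorphic to a proper initial segment of the source, and composing
  the two maps would send the bound of this segment strictly below itself.\<close>
lemma ordLeq_if_mono: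
  assumes r: "Well_order r" and s: "Well_order s"
    and f: "\<And>x. x \<in> Field r \<Longrightarrow> f x \<in> Field s"
    and mono: "\<And>x y. y \<in> Field r \<Longrightarrow> x \<in> underS r y \<Longrightarrow> f x \<in> underS s (f y)"
  shows "(r, s) \<in> ordLeq"
proof (rule ccontr)
  assume "(r, s) \<notin> ordLeq"
  then have "(s, r) \<in> ordLess" using r s by (simp add: not_ordLeq_iff_ordLess)
  then obtain p where p: "p \<in> Field r" "(s, Restr r (underS r p)) \<in> ordIso"
    using r s ordLess_iff_ordIso_Restr by blast
  have wop: "Well_order (Restr r (underS r p))" using r by (rule Well_order_Restr)
  from p(2) obtain g where g: "iso s (Restr r (underS r p)) g" by (auto simp: ordIso_def)
  have fr: "Field (Restr r (underS r p)) \<subseteq> underS r p" by (rule Field_Restr_subset)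
  have bij: "bij_betw g (Field s) (Field (Restr r (underS r p)))" using g by (simp add: iso_def)
  have g1: "g x \<in> underS r p" if "x \<in> Field s" for x
    using bij fr that by (auto simp: bij_betw_def)
  have g2: "g x \<in> underS r (g y)" if "x \<in> underS s y" for x y
  proof -
    have xy: "(x, y) \<in> s" "x \<noteq> y" using that by (auto simp: underS_def)
    then have fld: "x \<in> Field s" "y \<in> Field s" by (auto simp: Field_def)
    have "(g x, g y) \<in> Restr r (underS r p)"
      using g s wop xy by (metis embed_compat compat_def iso_def)
    moreover have "g x \<noteq> g y" using bij xy fld by (auto simp: bij_betw_def inj_on_def)
    ultimately show ?thesis by (auto simp: underS_def)
  qed
  have "\<not> g (f p) \<in> underS r p"
  proof (rule strict_wo_mono_not_less[OF strict_wo_Well_order[OF r], of "\<lambda>x. g (f x)"])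
    show "g (f x) \<in> Field r" if "x \<in> Field r" for x
      using g1[OF f[OF that]] by (auto simp: underS_def Field_def)
    show "g (f x) \<in> underS r (g (f y))" if "x \<in> Field r" "y \<in> Field r" "x \<in> underS r y" for x y
      using g2 mono that by blast
  qed (rule p(1))
  then show False using g1[OF f[OF p(1)]] by blast
qed

section \<open>Finitely supported functions\<close>

text \<open>
  With the exponents \<open>A\<close> ordered by \<open>lt\<close>, a function of finite support is a Cantor normal form: its
  value at \<open>e\<close> is the coefficient of \<open>\<omega>^e\<close>. Pointwise addition is the natural sum of ordinals.
\<close>

definition topdiff_less :: "('e \<Rightarrow> 'e \<Rightarrow> bool) \<Rightarrow> ('e \<Rightarrow> nat) \<Rightarrow> ('e \<Rightarrow> nat) \<Rightarrow> bool" where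
  "topdiff_less lt F G \<longleftrightarrow> (\<exists>b. F b < G b \<and> (\<forall>c. lt b c \<longrightarrow> F c = G c))"

definition fin_supp :: "'e set \<Rightarrow> ('e \<Rightarrow> nat) set" where
  "fin_supp A = {F. finite {e. F e \<noteq> 0} \<and> {e. F e \<noteq> 0} \<subseteq> A}"

lemma zero_fin_supp [simp]: "(\<lambda>_. 0) \<in> fin_supp A"
  by (simp add: fin_supp_def)

lemma fin_supp_finite: "F \<in> fin_supp A \<Longrightarrow> finite {e. F e \<noteq> 0}"
  by (simp add: fin_supp_def)

lemma fin_suppI: "finite B \<Longrightarrow> B \<subseteq> A \<Longrightarrow> (\<And>e. F e \<noteq> 0 \<Longrightarrow> e \<in> B) \<Longrightarrow> F \<in> fin_supp A"
  unfolding fin_supp_def using finite_subset[of "{e. F e \<noteq> 0}" B] by blast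

lemma fin_supp_outside: "F \<in> fin_supp A \<Longrightarrow> e \<notin> A \<Longrightarrow> F e = 0"
  by (auto simp: fin_supp_def)

lemma fin_supp_upd: "F \<in> fin_supp A \<Longrightarrow> b \<in> A \<Longrightarrow> F(b := k) \<in> fin_supp A"
  by (rule fin_suppI[of "insert b {e. F e \<noteq> 0}"])
    (auto simp: fin_supp_def split: if_splits)

lemma fin_supp_mono: "A \<subseteq> B \<Longrightarrow> fin_supp A \<subseteq> fin_supp B"
  by (auto simp: fin_supp_def)

lemma fin_supp_add: "F \<in> fin_supp A \<Longrightarrow> G \<in> fin_supp A \<Longrightarrow> (\<lambda>e. F e + G e) \<in> fin_supp A"
  by (rule fin_suppI[of "{e. F e \<noteq> 0} \<union> {e. G e \<noteq> 0}"]) (auto simp: fin_supp_def)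

lemma topdiff_less_add: "topdiff_less lt F G \<Longrightarrow> topdiff_less lt (\<lambda>e. F e + H e) (\<lambda>e. G e + H e)"
  by (auto simp: topdiff_less_def)

lemma topdiff_total:
  assumes wo: "strict_wo A lt" and F: "F \<in> fin_supp A" and G: "G \<in> fin_supp A" and "F \<noteq> G"
  shows "topdiff_less lt F G \<or> topdiff_less lt G F"
proof -
  let ?D = "{e. F e \<noteq> G e}"
  have "finite ?D"
    by (rule finite_subset[of _ "{e. F e \<noteq> 0} \<union> {e. G e \<noteq> 0}"])
      (use fin_supp_finite[OF F] fin_supp_finite[OF G] in auto)
  moreover have "?D \<noteq> {}" using \<open>F \<noteq> G\<close> by auto
  moreover have "?D \<subseteq> A"
    using fin_supp_outside[OF F] fin_supp_outside[OF G] by fastforce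
  ultimately obtain m where m: "m \<in> ?D" "\<forall>x\<in>?D. x = m \<or> lt x m" 
    using strict_wo_finite_max[OF wo] by meson
  have DA: "?D \<subseteq> A" using fin_supp_outside[OF F] fin_supp_outside[OF G] by fastforce
  have mA: "m \<in> A" using m DA by blast
  have "F c = G c" if "lt m c" for c
  proof (rule ccontr)
    assume "F c \<noteq> G c"
    then have "c \<in> A" "c = m \<or> lt c m" using m DA by auto
    then show False using that mA strict_wo_irrefl[OF wo, of m] strict_wo_irrefl[OF wo, of c] strict_wo_trans[OF wo that, of m] by blast
  qed
  moreover have "F m < G m \<or> G m < F m" using m by auto
  ultimately show ?thesis unfolding topdiff_less_def by metis
qed

lemma topdiff_trans:
  assumes wo: "strict_wo A lt" and F: "F \<in> fin_supp A" and G: "G \<in> fin_supp A" and H: "H \<in> fin_supp A"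
    and "topdiff_less lt F G" "topdiff_less lt G H"
  shows "topdiff_less lt F H"
proof -
  obtain b where b: "F b < G b" "\<And>c. lt b c \<Longrightarrow> F c = G c" using assms by (auto simp: topdiff_less_def)
  obtain c where c: "G c < H c" "\<And>d. lt c d \<Longrightarrow> G d = H d" using assms by (auto simp: topdiff_less_def)
  have bA: "b \<in> A" using b(1) fin_supp_outside[OF G] by fastforce
  have cA: "c \<in> A" using c(1) fin_supp_outside[OF H] by fastforce
  have out: "F d = H d" if "d \<notin> A" for d using that fin_supp_outside F H by metis
  consider "b = c" | "lt b c" | "lt c b" using strict_wo_total[OF wo bA cA] by blast
  then show ?thesis
  proof cases
    case 1
    then show ?thesis unfolding topdiff_less_def
      using b c by (intro exI[of _ b]) auto
  next
    case 2
    have "F d = H d" if "lt c d" for d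
      using out b(2)[of d] c(2)[of d] that 2 strict_wo_trans[OF wo 2 that bA cA] by (cases "d \<in> A") auto
    moreover have "F c < H c" using b(2)[OF 2] c(1) by simp
    ultimately show ?thesis unfolding topdiff_less_def by blast
  next
    case 3
    have "F d = H d" if "lt b d" for d
      using out b(2)[of d] c(2)[of d] that 3 strict_wo_trans[OF wo 3 that cA bA] by (cases "d \<in> A") auto
    moreover have "F b < H b" using c(2)[OF 3] b(1) by simp
    ultimately show ?thesis unfolding topdiff_less_def by blast
  qed
qed

lemma topdiff_irrefl: "\<not> topdiff_less lt F F"
  by (simp add: topdiff_less_def)

text \<open>Well-foundedness is an induction on the largest exponent \<open>b\<close>, then on its coefficient, then
  on the remaining part of the function, whose exponents are below \<open>b\<close>. It is phrased with the
  accessible part, since the induction on the remaining part needs it to be accessible already.\<close>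

lemma topdiff_accp:
  assumes wo: "strict_wo A lt" and "b \<in> A"
    and "F \<in> fin_supp A" "\<And>e. F e \<noteq> 0 \<Longrightarrow> e = b \<or> lt e b"
  shows "Wellfounded.accp (\<lambda>G F. G \<in> fin_supp A \<and> F \<in> fin_supp A \<and> topdiff_less lt G F) F"
  using wo assms(2-)
proof (induction b arbitrary: F rule: strict_wo_induct)
  case (less b F)
  let ?R = "\<lambda>G F. G \<in> fin_supp A \<and> F \<in> fin_supp A \<and> topdiff_less lt G F"
  define B where "B = {F \<in> fin_supp A. \<forall>e. F e \<noteq> 0 \<longrightarrow> lt e b}"
  have B_acc: "Wellfounded.accp ?R F" if "F \<in> B" for F
  proof (cases "F = (\<lambda>_. 0)")
    case True
    show ?thesis by (rule accp.accI) (use True in \<open>auto simp: topdiff_less_def\<close>)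
  next
    case False
    then have "{e. F e \<noteq> 0} \<noteq> {}" by auto
    moreover have fs: "finite {e. F e \<noteq> 0}" "{e. F e \<noteq> 0} \<subseteq> A"
      using that by (auto simp: B_def fin_supp_def)
    ultimately obtain m where m: "F m \<noteq> 0" "\<And>x. F x \<noteq> 0 \<Longrightarrow> x = m \<or> lt x m"
      using strict_wo_finite_max[OF wo, of "{e. F e \<noteq> 0}"] by auto
    then show ?thesis using that fs by (intro less.IH[of m]) (auto simp: B_def)
  qed
  have main: "\<forall>F\<in>B. Wellfounded.accp ?R (F(b := k))" for k
  proof (induction k rule: less_induct)
    case (less k)
    show ?case
    proof
      fix F assume "F \<in> B"
      show "Wellfounded.accp ?R (F(b := k))"
        using B_acc[OF \<open>F \<in> B\<close>] \<open>F \<in> B\<close>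
      proof (induction F rule: accp.induct[case_names acc])
        case (acc F)
        show ?case
        proof (rule accp.accI)
          fix G assume G: "?R G (F(b := k))"
          then obtain d where d: "G d < (F(b := k)) d" "\<And>c. lt d c \<Longrightarrow> G c = (F(b := k)) c"
            by (auto simp: topdiff_less_def)
          have G': "G \<in> fin_supp A" using G by blast
          have F0: "F b = 0" using acc.prems \<open>b \<in> A\<close> strict_wo_irrefl[OF wo] by (auto simp: B_def)
          have Fout: "F e = 0" if "\<not> lt e b" for e using acc.prems that by (auto simp: B_def)
          have db: "d = b \<or> lt d b" using d(1) Fout[of d] by (auto split: if_splits)
          have dA: "d \<in> A" using d(1) fin_supp_outside[of "F(b:=k)" A d] G by fastforce
          have Gs: "e = b \<or> lt e b" if "G e \<noteq> 0" for e
          proof (rule ccontr)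
            assume n: "\<not> (e = b \<or> lt e b)"
            have eA: "e \<in> A" using that fin_supp_outside[OF G', of e] by (cases "e \<in> A") auto
            then have "lt b e" using n strict_wo_total[OF wo, of e b] less.prems \<open>b \<in> A\<close> by blast
            then have "lt d e" using db strict_wo_trans[OF wo _ \<open>lt b e\<close> dA \<open>b \<in> A\<close> eA] by blast
            then have "G e = (F(b := k)) e" by (rule d(2))
            then show False using n Fout[of e] that by (auto split: if_splits)
          qed
          have GB: "G(b := 0) \<in> B"
            using Gs fin_supp_upd[OF G' \<open>b \<in> A\<close>] by (auto simp: B_def)
          have "G b \<le> k"
          proof (cases "d = b")
            case False
            then have "lt d b" using db by blast
            then show ?thesis using d(2) by simp
          qed (use d in auto)
          have eq: "G = (G(b := 0))(b := G b)" by simp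
          show "Wellfounded.accp ?R G"
          proof (cases "G b < k")
            case True
            then show ?thesis using bspec[OF less.IH[OF True] GB] by (simp only: eq[symmetric])
          next
            case False
            then have Gb: "G b = k" using \<open>G b \<le> k\<close> by simp
            then have "d \<noteq> b" using d(1) by auto
            have "topdiff_less lt (G(b := 0)) F"
              unfolding topdiff_less_def
            proof (intro exI conjI allI impI)
              show "(G(b := 0)) d < F d" using d(1) \<open>d \<noteq> b\<close> by simp
              show "(G(b := 0)) c = F c" if "lt d c" for c using d(2)[OF that] F0 by auto
            qed
            then have "?R (G(b := 0)) F" using GB acc.prems by (auto simp: B_def)
            then have "Wellfounded.accp ?R ((G(b := 0))(b := k))" using acc.IH GB by blast
            then show ?thesis by (simp only: Gb[symmetric] eq[symmetric])
          qed
        qed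
      qed
    qed
  qed
  have "F(b := 0) \<in> B" using less fin_supp_upd by (auto simp: B_def)
  then have "Wellfounded.accp ?R ((F(b := 0))(b := F b))" using main by blast
  then show ?case by simp
qed

lemma strict_wo_topdiff:
  assumes wo: "strict_wo A lt"
  shows "strict_wo (fin_supp A) (topdiff_less lt)"
  unfolding strict_wo_def
proof (intro conjI ballI allI impI)
  let ?R = "\<lambda>G F. G \<in> fin_supp A \<and> F \<in> fin_supp A \<and> topdiff_less lt G F"
  fix S assume S: "S \<subseteq> fin_supp A" "S \<noteq> {}"
  then obtain F where F: "F \<in> S" by blast
  have acc: "Wellfounded.accp ?R F"
  proof (cases "F = (\<lambda>_. 0)")
    case True
    show ?thesis by (rule accp.accI) (use True in \<open>auto simp: topdiff_less_def\<close>)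
  next
    case False
    then have "{e. F e \<noteq> 0} \<noteq> {}" by auto
    moreover have fs: "finite {e. F e \<noteq> 0}" "{e. F e \<noteq> 0} \<subseteq> A"
      using F S by (auto simp: fin_supp_def)
    ultimately obtain m where m: "F m \<noteq> 0" "\<And>x. F x \<noteq> 0 \<Longrightarrow> x = m \<or> lt x m"
      using strict_wo_finite_max[OF wo, of "{e. F e \<noteq> 0}"] by auto
    then show ?thesis using F S fs by (intro topdiff_accp[OF wo, of m]) auto
  qed
  then show "\<exists>x\<in>S. \<forall>y\<in>S. \<not> topdiff_less lt y x"
    using F
  proof (induction F rule: accp.induct)
    case (accI F)
    show ?case
    proof (cases "\<exists>G\<in>S. topdiff_less lt G F")
      case True
      then obtain G where "G \<in> S" "topdiff_less lt G F" by blast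
      then show ?thesis using accI.IH[of G] accI.prems S by blast
    qed (use accI.prems in blast)
  qed
next
  show "\<not> topdiff_less lt F F" for F by (rule topdiff_irrefl)
  show "topdiff_less lt F H"
    if "F \<in> fin_supp A" "G \<in> fin_supp A" "H \<in> fin_supp A" "topdiff_less lt F G" "topdiff_less lt G H"
    for F G H
    using topdiff_trans[OF wo that] .
  show "F = G \<or> topdiff_less lt F G \<or> topdiff_less lt G F"
    if "F \<in> fin_supp A" "G \<in> fin_supp A" for F G
    using topdiff_total[OF wo that] by blast
qed

section \<open>Tuples of natural numbers as ordinals\<close>
abbreviation colex :: "(nat \<Rightarrow> nat) \<Rightarrow> (nat \<Rightarrow> nat) \<Rightarrow> bool" (infix "\<sqsubset>" 50) where
  "colex \<equiv> topdiff_less (<)"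

text \<open>The tuple \<open>f\<close> stands for the sum of the \<open>\<omega>^i * f i\<close> with \<open>i < n\<close>, so \<open>tuples_upto n\<close> under \<open>colex\<close> is
  the ordinal \<open>\<omega>\<^sup>n\<close>. Tuples are functions on all numbers, padded by zeros, so that \<open>\<omega>\<^sup>n\<close> is an initial
  segment of \<open>\<omega>^(n+1)\<close> with first new element \<open>unit_at n\<close>.\<close>
definition tuples_upto :: "nat \<Rightarrow> (nat \<Rightarrow> nat) set" where
  "tuples_upto n = {f. \<forall>i\<ge>n. f i = 0}"

definition unit_at :: "nat \<Rightarrow> nat \<Rightarrow> nat" where
  "unit_at n = (\<lambda>i. if i = n then 1 else 0)"

lemma strict_wo_nat: "strict_wo UNIV ((<) :: nat \<Rightarrow> nat \<Rightarrow> bool)"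
  unfolding strict_wo_def
proof (intro conjI ballI allI impI)
  fix S :: "nat set" assume "S \<noteq> {}"
  then have "(LEAST x. x \<in> S) \<in> S" by (metis LeastI ex_in_conv)
  moreover have "\<not> y < (LEAST x. x \<in> S)" if "y \<in> S" for y
    using Least_le[of "\<lambda>x. x \<in> S" y] that by simp
  ultimately show "\<exists>x\<in>S. \<forall>y\<in>S. \<not> y < x" by blast
qed auto

lemma tuples_upto_fin_supp: "tuples_upto n \<subseteq> fin_supp UNIV"
proof
  fix f assume "f \<in> tuples_upto n"
  then have "{e. f e \<noteq> 0} \<subseteq> {..<n}" by (auto simp: tuples_upto_def intro: ccontr)
  then show "f \<in> fin_supp UNIV" by (auto simp: fin_supp_def finite_subset)
qed

lemma strict_wo_colex: "strict_wo (fin_supp UNIV) colex"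
  by (rule strict_wo_topdiff[OF strict_wo_nat])

lemma strict_wo_colex_tuples: "strict_wo (tuples_upto n) colex"
  by (rule strict_wo_subset[OF strict_wo_colex tuples_upto_fin_supp])

lemma tuples_upto_zero [simp]: "(\<lambda>_. 0) \<in> tuples_upto n"
  by (simp add: tuples_upto_def)

lemma tuples_upto_add: "a \<in> tuples_upto n \<Longrightarrow> b \<in> tuples_upto n \<Longrightarrow> (\<lambda>i. a i + b i) \<in> tuples_upto n"
  by (simp add: tuples_upto_def)

lemma tuples_upto_mono: "m \<le> n \<Longrightarrow> tuples_upto m \<subseteq> tuples_upto n"
  by (auto simp: tuples_upto_def)

lemma colex_tuples_upto_down: "a' \<sqsubset> a \<Longrightarrow> a \<in> tuples_upto n \<Longrightarrow> a' \<in> tuples_upto n"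
  unfolding topdiff_less_def tuples_upto_def by (auto, metis not_less0 not_le_imp_less order_less_le_trans)

lemma colex_top_le:
  assumes "a' \<sqsubset> a" "a \<in> tuples_upto (Suc n)"
  shows "a' n \<le> a n"
proof -
  obtain b where b: "a' b < a b" "\<And>c. b < c \<Longrightarrow> a' c = a c"
    using assms by (auto simp: topdiff_less_def)
  have "b \<le> n" using b(1) assms(2) by (auto simp: tuples_upto_def intro: ccontr)
  then show ?thesis using b by (cases "b = n") auto
qed

lemma colex_topI: "a n < b n \<Longrightarrow> a \<in> tuples_upto (Suc n) \<Longrightarrow> b \<in> tuples_upto (Suc n) \<Longrightarrow> a \<sqsubset> b"
  unfolding topdiff_less_def tuples_upto_def by (intro exI[of _ n]) auto

lemma colex_trans:
  "a \<sqsubset> b \<Longrightarrow> b \<sqsubset> c \<Longrightarrow> a \<in> tuples_upto n \<Longrightarrow> b \<in> tuples_upto n \<Longrightarrow> c \<in> tuples_upto n \<Longrightarrow> a \<sqsubset> c"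
  using strict_wo_trans[OF strict_wo_colex_tuples] .

lemma colex_total:
  "a \<in> tuples_upto n \<Longrightarrow> b \<in> tuples_upto n \<Longrightarrow> a = b \<or> a \<sqsubset> b \<or> b \<sqsubset> a"
  using strict_wo_total[OF strict_wo_colex_tuples] .

lemma colex_add_left: "a' \<sqsubset> a \<Longrightarrow> (\<lambda>i. a' i + b i) \<sqsubset> (\<lambda>i. a i + b i)"
  by (rule topdiff_less_add)

lemma colex_add_right: "b' \<sqsubset> b \<Longrightarrow> (\<lambda>i. a i + b' i) \<sqsubset> (\<lambda>i. a i + b i)"
  using topdiff_less_add[of _ b' b a] by (simp add: add.commute)

section \<open>Orders bounded by a power of \<open>\<omega>\<close>\<close>

text \<open>\<open>pow_bounded lt a S\<close> says that \<open>S\<close> is a finite union of sets of order type at most \<open>\<omega>^a\<close>, without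
  mentioning order types: a well-order has type at most \<open>\<omega>^a\<close> iff each of its proper initial segments
  is empty or has type at most \<open>\<omega>^a' * k\<close> for some \<open>a' < a\<close> and some number \<open>k\<close>. In this form it
  can be pulled back along maps that only preserve the relation.\<close>
inductive pow_bounded :: "('a \<Rightarrow> 'a \<Rightarrow> bool) \<Rightarrow> (nat \<Rightarrow> nat) \<Rightarrow> 'a set \<Rightarrow> bool"
  for lt :: "'a \<Rightarrow> 'a \<Rightarrow> bool" where
  empty: "pow_bounded lt a {}"
| union: "pow_bounded lt a S \<Longrightarrow> pow_bounded lt a T \<Longrightarrow> pow_bounded lt a (S \<union> T)"
| segments: "(\<And>p. p \<in> S \<Longrightarrow> {y\<in>S. lt y p} = {} \<or> (\<exists>a'. a' \<sqsubset> a \<and> pow_bounded lt a' {y\<in>S. lt y p}))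
    \<Longrightarrow> pow_bounded lt a S"

lemma pow_bounded_subset:
  assumes "pow_bounded lt a S" "T \<subseteq> S"
  shows "pow_bounded lt a T"
  using assms
proof (induction arbitrary: T rule: pow_bounded.induct)
  case (empty a)
  then show ?case by (simp add: pow_bounded.empty)
next
  case (union a S1 S2)
  have "pow_bounded lt a (T \<inter> S1)" "pow_bounded lt a (T \<inter> S2)" using union.IH by auto
  then have "pow_bounded lt a (T \<inter> S1 \<union> T \<inter> S2)" by (rule pow_bounded.union)
  moreover have "T \<inter> S1 \<union> T \<inter> S2 = T" using union.prems by blast
  ultimately show ?case by simp
next
  case (segments S a)
  show ?case
  proof (rule pow_bounded.segments)
    fix p assume "p \<in> T"
    then have pS: "p \<in> S" using segments.prems by blast
    have sub: "{y\<in>T. lt y p} \<subseteq> {y\<in>S. lt y p}" using segments.prems by blast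
    show "{y\<in>T. lt y p} = {} \<or> (\<exists>a'. a' \<sqsubset> a \<and> pow_bounded lt a' {y\<in>T. lt y p})"
      using segments.IH[OF pS] sub by blast
  qed
qed

lemma pow_bounded_mono:
  assumes "pow_bounded lt a S" "a \<in> tuples_upto n" "b \<in> tuples_upto n" "a = b \<or> a \<sqsubset> b"
  shows "pow_bounded lt b S"
  using assms
proof (induction rule: pow_bounded.induct)
  case (segments S a)
  show ?case
  proof (rule pow_bounded.segments)
    fix p assume "p \<in> S"
    from segments.IH[OF this] show "{y\<in>S. lt y p} = {} \<or> (\<exists>a'. a' \<sqsubset> b \<and> pow_bounded lt a' {y\<in>S. lt y p})"
    proof
      assume "\<exists>a'. a' \<sqsubset> a \<and> pow_bounded lt a' {y\<in>S. lt y p} \<and>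
        (a' \<in> tuples_upto n \<longrightarrow> b \<in> tuples_upto n \<longrightarrow> a' = b \<or> a' \<sqsubset> b \<longrightarrow> pow_bounded lt b {y\<in>S. lt y p})"
      then obtain a' where a': "a' \<sqsubset> a" "pow_bounded lt a' {y\<in>S. lt y p}" by blast
      have "a' \<sqsubset> b"
        using colex_trans[OF a'(1), of b n] colex_tuples_upto_down[OF a'(1)] segments.prems a'(1) by blast
      then show ?thesis using a' by blast
    qed simp
  qed
qed (auto intro: pow_bounded.intros)

lemma pow_bounded_pullback:
  assumes "pow_bounded lt a S"
    and "\<And>x. x \<in> T \<Longrightarrow> f x \<in> S"
    and "\<And>x y. x \<in> T \<Longrightarrow> y \<in> T \<Longrightarrow> lt' x y \<Longrightarrow> lt (f x) (f y)"
  shows "pow_bounded lt' a T"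
  using assms
proof (induction arbitrary: T rule: pow_bounded.induct)
  case (empty a)
  then have "T = {}" by auto
  then show ?case by (simp add: pow_bounded.empty)
next
  case (union a S1 S2)
  have "pow_bounded lt' a {x\<in>T. f x \<in> S1}" using union.prems(2) by (intro union.IH(1)) auto
  moreover have "pow_bounded lt' a {x\<in>T. f x \<in> S2}" using union.prems(2) by (intro union.IH(2)) auto
  ultimately have "pow_bounded lt' a ({x\<in>T. f x \<in> S1} \<union> {x\<in>T. f x \<in> S2})"
    by (rule pow_bounded.union)
  moreover have "{x\<in>T. f x \<in> S1} \<union> {x\<in>T. f x \<in> S2} = T" using union.prems(1) by blast
  ultimately show ?case by simp
next
  case (segments S a)
  show ?case
  proof (rule pow_bounded.segments)
    fix p assume p: "p \<in> T"
    have sub: "f x \<in> {y\<in>S. lt y (f p)}" if "x \<in> {y\<in>T. lt' y p}" for x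
      using that p segments.prems by auto
    from segments.IH[OF segments.prems(1)[OF p]]
    show "{y\<in>T. lt' y p} = {} \<or> (\<exists>a'. a' \<sqsubset> a \<and> pow_bounded lt' a' {y\<in>T. lt' y p})"
    proof
      assume "{y\<in>S. lt y (f p)} = {}"
      then show ?thesis using sub by blast
    next
      assume "\<exists>a'. a' \<sqsubset> a \<and> pow_bounded lt a' {y\<in>S. lt y (f p)} \<and>
         (\<forall>x. (\<forall>xa. xa \<in> x \<longrightarrow> f xa \<in> {y\<in>S. lt y (f p)}) \<longrightarrow>
           (\<forall>xa. xa \<in> x \<longrightarrow> (\<forall>xb. xb \<in> x \<longrightarrow> lt' xa xb \<longrightarrow> lt (f xa) (f xb))) \<longrightarrow> pow_bounded lt' a' x)"
      then obtain a' where a': "a' \<sqsubset> a" and IH: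
         "\<And>x. (\<forall>xa. xa \<in> x \<longrightarrow> f xa \<in> {y\<in>S. lt y (f p)}) \<Longrightarrow>
           (\<forall>xa. xa \<in> x \<longrightarrow> (\<forall>xb. xb \<in> x \<longrightarrow> lt' xa xb \<longrightarrow> lt (f xa) (f xb))) \<Longrightarrow> pow_bounded lt' a' x"
        by blast
      have "pow_bounded lt' a' {y\<in>T. lt' y p}"
        by (rule IH) (use sub segments.prems(2) in auto)
      then show ?thesis using a' by blast
    qed
  qed
qed

lemma pow_bounded_finite_Union:
  "finite I \<Longrightarrow> (\<And>i. i \<in> I \<Longrightarrow> pow_bounded lt a (S i)) \<Longrightarrow> pow_bounded lt a (\<Union>i\<in>I. S i)"
  by (induction I rule: finite_induct) (auto intro: pow_bounded.intros)

lemma pow_bounded_singleton: "\<not> lt x x \<Longrightarrow> pow_bounded lt a {x}"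
  by (rule pow_bounded.segments) auto

lemma pow_bounded_finite:
  assumes "finite S" "\<And>x. x \<in> S \<Longrightarrow> \<not> lt x x"
  shows "pow_bounded lt a S"
  using pow_bounded_finite_Union[of S lt a "\<lambda>x. {x}"] assms pow_bounded_singleton[of lt] by simp

text \<open>Below a point \<open>p\<close> lie only elements whose first coordinate is below that of \<open>p\<close>, or whose second one
  is. Each of these two sets is a box with one factor replaced by a smaller one, so it is bounded by
  the natural sum of exponents with one summand decreased.\<close>
lemma pow_bounded_box:
  assumes "pow_bounded lt1 a U" "pow_bounded lt2 b V" "a \<in> tuples_upto n" "b \<in> tuples_upto n"
    and "\<And>y. y \<in> S \<Longrightarrow> f y \<in> U \<and> g y \<in> V"
    and "\<And>y y'. y \<in> S \<Longrightarrow> y' \<in> S \<Longrightarrow> lt y' y \<Longrightarrow> lt1 (f y') (f y) \<or> lt2 (g y') (g y)"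
  shows "pow_bounded lt (\<lambda>i. a i + b i) S"
  using assms
proof (induction arbitrary: V b S rule: pow_bounded.induct)
  case (empty a)
  then have "S = {}" by auto
  then show ?case by (simp add: pow_bounded.empty)
next
  case (union a U1 U2)
  have "pow_bounded lt (\<lambda>i. a i + b i) {y\<in>S. f y \<in> U1}"
    using union.prems by (intro union.IH(1)[of b V]) auto
  moreover have "pow_bounded lt (\<lambda>i. a i + b i) {y\<in>S. f y \<in> U2}"
    using union.prems by (intro union.IH(2)[of b V]) auto
  ultimately have "pow_bounded lt (\<lambda>i. a i + b i) ({y\<in>S. f y \<in> U1} \<union> {y\<in>S. f y \<in> U2})"
    by (rule pow_bounded.union)
  moreover have "{y\<in>S. f y \<in> U1} \<union> {y\<in>S. f y \<in> U2} = S" using union.prems(4) by blast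
  ultimately show ?case by simp
next
  case (segments U a)
  have U: "{u\<in>U. lt1 u p} = {} \<or> (\<exists>a'. a' \<sqsubset> a \<and> (\<forall>b V S. pow_bounded lt2 b V \<longrightarrow> b \<in> tuples_upto n \<longrightarrow>
      (\<forall>y\<in>S. lt1 (f y) p \<and> f y \<in> U \<and> g y \<in> V) \<longrightarrow>
      (\<forall>y\<in>S. \<forall>y'\<in>S. lt y' y \<longrightarrow> lt1 (f y') (f y) \<or> lt2 (g y') (g y)) \<longrightarrow>
      pow_bounded lt (\<lambda>i. a' i + b i) S))" if "p \<in> U" for p
    using segments.IH[OF that]
  proof (elim disjE exE conjE, goal_cases)
    case (2 a')
    note IH = this
    have "a' \<in> tuples_upto n" using colex_tuples_upto_down[OF IH(1)] segments.prems(2) by blast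
    then show ?case using IH(1) IH(3) by (intro disjI2 exI[of _ a']) auto
  qed simp
  show ?case
    using segments.prems
  proof (induction arbitrary: S rule: pow_bounded.induct)
    case (empty b)
    then have "S = {}" by auto
    then show ?case by (simp add: pow_bounded.empty)
  next
    case (union b V1 V2)
    have "pow_bounded lt (\<lambda>i. a i + b i) {y\<in>S. g y \<in> V1}"
      using union.prems by (intro union.IH(1)) auto
    moreover have "pow_bounded lt (\<lambda>i. a i + b i) {y\<in>S. g y \<in> V2}"
      using union.prems by (intro union.IH(2)) auto
    ultimately have "pow_bounded lt (\<lambda>i. a i + b i) ({y\<in>S. g y \<in> V1} \<union> {y\<in>S. g y \<in> V2})"
      by (rule pow_bounded.union)
    moreover have "{y\<in>S. g y \<in> V1} \<union> {y\<in>S. g y \<in> V2} = S" using union.prems(3) by blast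
    ultimately show ?case by simp
  next
    case (segments V b)
    let ?ab = "\<lambda>i. a i + b i"
    have Vb: "pow_bounded lt2 b V"
    proof (rule pow_bounded.segments)
      fix v assume "v \<in> V"
      from segments.IH[OF this] show "{y\<in>V. lt2 y v} = {} \<or> (\<exists>b'. b' \<sqsubset> b \<and> pow_bounded lt2 b' {y\<in>V. lt2 y v})"
        by (elim disjE exE conjE) auto
    qed
    show ?case
    proof (rule pow_bounded.segments)
      fix p assume p: "p \<in> S"
      let ?S1 = "{y\<in>S. lt1 (f y) (f p)}" and ?S2 = "{y\<in>S. lt2 (g y) (g p)}"
      have sub: "{y\<in>S. lt y p} \<subseteq> ?S1 \<union> ?S2" using segments.prems(4)[OF p] by auto
      have small: "?S1 = {} \<or> (\<exists>c. c \<sqsubset> ?ab \<and> pow_bounded lt c ?S1)"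
      proof (cases "{u\<in>U. lt1 u (f p)} = {}")
        case True
        then show ?thesis using segments.prems(3) by blast
      next
        case False
        then obtain a' where a': "a' \<sqsubset> a" and IH: "\<forall>b V S. pow_bounded lt2 b V \<longrightarrow> b \<in> tuples_upto n \<longrightarrow>
            (\<forall>y\<in>S. lt1 (f y) (f p) \<and> f y \<in> U \<and> g y \<in> V) \<longrightarrow>
            (\<forall>y\<in>S. \<forall>y'\<in>S. lt y' y \<longrightarrow> lt1 (f y') (f y) \<or> lt2 (g y') (g y)) \<longrightarrow>
            pow_bounded lt (\<lambda>i. a' i + b i) S"
          using U[of "f p"] segments.prems(3)[OF p] by blast
        have "pow_bounded lt (\<lambda>i. a' i + b i) ?S1"
          by (rule IH[rule_format, OF Vb segments.prems(2)]) (use segments.prems(3,4) in auto)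
        then show ?thesis using colex_add_left[OF a'] by blast
      qed
      have small2: "?S2 = {} \<or> (\<exists>c. c \<sqsubset> ?ab \<and> pow_bounded lt c ?S2)"
        using segments.IH[OF conjunct2[OF segments.prems(3)[OF p]]]
      proof (elim disjE exE conjE, goal_cases)
        case 1
        then show ?case using segments.prems(3) by blast
      next
        case (2 b')
        have "pow_bounded lt (\<lambda>i. a i + b' i) ?S2"
          by (rule 2(3)[rule_format, OF segments.prems(1) colex_tuples_upto_down[OF 2(1) segments.prems(2)]])
            (use segments.prems(3,4) in auto)
        then show ?case using colex_add_right[OF 2(1)] by blast
      qed
      show "{y\<in>S. lt y p} = {} \<or> (\<exists>c. c \<sqsubset> ?ab \<and> pow_bounded lt c {y\<in>S. lt y p})"
      proof (cases "?S1 = {} \<or> ?S2 = {}")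
        case True
        then have "{y\<in>S. lt y p} \<subseteq> ?S1 \<or> {y\<in>S. lt y p} \<subseteq> ?S2" using sub by auto
        moreover have ?thesis if "{y\<in>S. lt y p} \<subseteq> T" "T = {} \<or> (\<exists>c. c \<sqsubset> ?ab \<and> pow_bounded lt c T)" for T
        proof (cases "T = {}")
          case False
          then show ?thesis using that pow_bounded_subset[OF _ that(1)] by meson
        qed (use that in auto)
        ultimately show ?thesis using small small2 by meson
      next
        case False
        then obtain c1 c2 where c: "c1 \<sqsubset> ?ab" "pow_bounded lt c1 ?S1" "c2 \<sqsubset> ?ab" "pow_bounded lt c2 ?S2"
          using small small2 by blast
        have ab: "?ab \<in> tuples_upto n" using segments.prems(1,2) by (rule tuples_upto_add)
        have ct: "c1 \<in> tuples_upto n" "c2 \<in> tuples_upto n"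
          using colex_tuples_upto_down[OF _ ab] c by auto
        have "\<exists>c. c \<sqsubset> ?ab \<and> pow_bounded lt c ?S1 \<and> pow_bounded lt c ?S2"
          using colex_total[OF ct] pow_bounded_mono[OF c(2) ct] pow_bounded_mono[OF c(4) ct(2,1)] c by blast
        then show ?thesis using pow_bounded_subset[OF pow_bounded.union sub] by blast
      qed
    qed
  qed
qed

section \<open>Bounded orders embed below \<open>\<omega>^(\<omega>^n)\<close>\<close>
lemma topdiff_less_add_right:
  "topdiff_less lt F G \<Longrightarrow> topdiff_less lt (\<lambda>e. H e + F e) (\<lambda>e. H e + G e)"
  by (auto simp: topdiff_less_def)

definition single :: "'e \<Rightarrow> 'e \<Rightarrow> nat" where
  "single e = (\<lambda>e'. if e' = e then 1 else 0)"

lemma single_fin_supp: "e \<in> A \<Longrightarrow> single e \<in> fin_supp A"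
  by (rule fin_suppI[of "{e}"]) (auto simp: single_def split: if_splits)

abbreviation (input) pw_less :: "((nat \<Rightarrow> nat) \<Rightarrow> nat) \<Rightarrow> ((nat \<Rightarrow> nat) \<Rightarrow> nat) \<Rightarrow> bool" (infix "\<lless>" 50) where
  "F \<lless> G \<equiv> topdiff_less colex F G"

lemma strict_wo_powers: "strict_wo (fin_supp (tuples_upto n)) (topdiff_less colex)"
  by (rule strict_wo_topdiff[OF strict_wo_colex_tuples])

lemma powers_le_trans:
  assumes "F \<in> fin_supp (tuples_upto n)" "G \<in> fin_supp (tuples_upto n)" "H \<in> fin_supp (tuples_upto n)"
  shows "F = G \<or> F \<lless> G \<Longrightarrow> G \<lless> H \<Longrightarrow> F \<lless> H"
    and "F \<lless> G \<Longrightarrow> G = H \<or> G \<lless> H \<Longrightarrow> F \<lless> H"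
  using strict_wo_trans[OF strict_wo_powers, of F G H] assms by auto

definition least_power :: "nat \<Rightarrow> (((nat \<Rightarrow> nat) \<Rightarrow> nat) \<Rightarrow> bool) \<Rightarrow> (nat \<Rightarrow> nat) \<Rightarrow> nat" where
  "least_power n Q = (SOME v. v \<in> fin_supp (tuples_upto n) \<and> Q v \<and>
     (\<forall>u\<in>fin_supp (tuples_upto n). Q u \<longrightarrow> \<not> u \<lless> v))"

lemma least_power:
  assumes "v \<in> fin_supp (tuples_upto n)" "Q v"
  shows "least_power n Q \<in> fin_supp (tuples_upto n)" "Q (least_power n Q)"
    "least_power n Q = v \<or> least_power n Q \<lless> v"
proof -
  let ?W = "fin_supp (tuples_upto n)"
  have "\<exists>x\<in>{v\<in>?W. Q v}. \<forall>y\<in>{v\<in>?W. Q v}. \<not> y \<lless> x"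
    using assms by (intro strict_wo_min[OF strict_wo_powers[of n]]) auto
  then have "\<exists>x. x \<in> ?W \<and> Q x \<and> (\<forall>u\<in>?W. Q u \<longrightarrow> \<not> u \<lless> x)" by blast
  then have *: "least_power n Q \<in> ?W \<and> Q (least_power n Q) \<and> (\<forall>u\<in>?W. Q u \<longrightarrow> \<not> u \<lless> least_power n Q)"
    unfolding least_power_def by (rule someI_ex)
  then show "least_power n Q \<in> ?W" "Q (least_power n Q)" by blast+
  show "least_power n Q = v \<or> least_power n Q \<lless> v"
    using * assms strict_wo_total[OF strict_wo_powers[of n], of "least_power n Q" v] by blast
qed

definition powers_upto :: "nat \<Rightarrow> (nat \<Rightarrow> nat) \<Rightarrow> ((nat \<Rightarrow> nat) \<Rightarrow> nat) set" where
  "powers_upto n a = fin_supp {e \<in> tuples_upto n. e = a \<or> e \<sqsubset> a}"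

lemma powers_upto_subset: "powers_upto n a \<subseteq> fin_supp (tuples_upto n)"
  unfolding powers_upto_def by (rule fin_supp_mono) auto

lemma colex_zero_le: "a = (\<lambda>_. 0) \<or> (\<lambda>_. 0) \<sqsubset> a" if "a \<in> tuples_upto n"
proof -
  have "\<not> a \<sqsubset> (\<lambda>_. 0)" by (simp add: topdiff_less_def)
  then show ?thesis using colex_total[OF that tuples_upto_zero] by blast
qed

lemma powers_upto_less_single:
  assumes w: "w \<in> powers_upto n a'" and "a' \<sqsubset> a" and a: "a \<in> tuples_upto n"
  shows "w \<lless> single a"
proof -
  have a': "a' \<in> tuples_upto n" using colex_tuples_upto_down assms by blast
  have irr: "\<not> a \<sqsubset> a" for a :: "nat \<Rightarrow> nat" by (rule topdiff_irrefl)
  have zero: "w c = 0" if "c = a \<or> a \<sqsubset> c" for c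
  proof (rule ccontr)
    assume "w c \<noteq> 0"
    then have c: "c \<in> tuples_upto n" "c = a' \<or> c \<sqsubset> a'" using w by (auto simp: powers_upto_def fin_supp_def)
    then have "c \<sqsubset> a" using colex_trans[OF _ \<open>a' \<sqsubset> a\<close> c(1) a' a] \<open>a' \<sqsubset> a\<close> by blast
    then show False using that irr colex_trans[OF _ _ c(1) a c(1)] by blast
  qed
  show ?thesis
    unfolding topdiff_less_def[of colex]
    by (rule exI[of _ a]) (use zero irr in \<open>auto simp: single_def\<close>)
qed

text \<open>A strictly increasing map from \<open>S\<close> into the ordinals below \<open>w\<close>.\<close>
definition power_rank :: "nat \<Rightarrow> ('a \<Rightarrow> 'a \<Rightarrow> bool) \<Rightarrow> 'a set \<Rightarrow> ((nat \<Rightarrow> nat) \<Rightarrow> nat) \<Rightarrow> ('a \<Rightarrow> (nat \<Rightarrow> nat) \<Rightarrow> nat) \<Rightarrow> bool" where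
  "power_rank n lt S w f \<longleftrightarrow>
     (\<forall>s\<in>S. f s \<in> fin_supp (tuples_upto n) \<and> f s \<lless> w) \<and> (\<forall>s\<in>S. \<forall>y\<in>S. lt s y \<longrightarrow> f s \<lless> f y)"

text \<open>An element \<open>y\<close> of the union splits both sets; its rank is the natural sum of the least ordinals above
  the ranks of the elements of \<open>S\<close>, respectively \<open>T\<close>, below \<open>y\<close>. Both summands are monotone in \<open>y\<close>,
  and one of them increases strictly on passing from an element of its set to a larger element.\<close>
lemma power_rank_union:
  assumes wo: "strict_wo L lt" and sub: "S \<subseteq> L" "T \<subseteq> L" and a: "a \<in> tuples_upto n"
    and f: "power_rank n lt S v f" "v \<in> powers_upto n a"
    and g: "power_rank n lt T w g" "w \<in> powers_upto n a"
  shows "\<exists>u\<in>powers_upto n a. \<exists>h. power_rank n lt (S \<union> T) u h"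
proof -
  let ?W = "fin_supp (tuples_upto n)"
  define G where "G S f y = least_power n (\<lambda>u. \<forall>s\<in>S. lt s y \<longrightarrow> f s \<lless> u)" for S and f :: "'a \<Rightarrow> (nat \<Rightarrow> nat) \<Rightarrow> nat" and y
  have G: "G S f y \<in> ?W" "\<forall>s\<in>S. lt s y \<longrightarrow> f s \<lless> G S f y" "G S f y = v \<or> G S f y \<lless> v"
     "x \<in> L \<Longrightarrow> y \<in> L \<Longrightarrow> lt x y \<Longrightarrow> G S f x = G S f y \<or> G S f x \<lless> G S f y"
     "x \<in> S \<Longrightarrow> y \<in> L \<Longrightarrow> lt x y \<Longrightarrow> G S f x \<lless> G S f y"
    if f: "power_rank n lt S v f" "v \<in> powers_upto n a" and S: "S \<subseteq> L" for S f v x y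
  proof -
    have v: "v \<in> ?W" "\<And>y. \<forall>s\<in>S. lt s y \<longrightarrow> f s \<lless> v"
      using f powers_upto_subset by (auto simp: power_rank_def)
    show G1: "G S f y \<in> ?W" for y
      unfolding G_def by (rule least_power(1)[where Q = "\<lambda>u. \<forall>s\<in>S. lt s y \<longrightarrow> f s \<lless> u", OF v])
    show G2: "\<forall>s\<in>S. lt s y \<longrightarrow> f s \<lless> G S f y" for y
      unfolding G_def by (rule least_power(2)[where Q = "\<lambda>u. \<forall>s\<in>S. lt s y \<longrightarrow> f s \<lless> u", OF v])
    show "G S f y = v \<or> G S f y \<lless> v" for y
      unfolding G_def by (rule least_power(3)[where Q = "\<lambda>u. \<forall>s\<in>S. lt s y \<longrightarrow> f s \<lless> u", OF v])
    show "G S f x = G S f y \<or> G S f x \<lless> G S f y" if xy: "x \<in> L" "y \<in> L" "lt x y"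
    proof -
      have "\<forall>s\<in>S. lt s x \<longrightarrow> f s \<lless> G S f y"
      proof (intro ballI impI)
        fix s assume s: "s \<in> S" "lt s x"
        then have "lt s y" using strict_wo_trans[OF wo s(2) xy(3)] xy S by blast
        then show "f s \<lless> G S f y" using G2[of y] s by blast
      qed
      then show ?thesis
        using least_power(3)[where Q = "\<lambda>u. \<forall>s\<in>S. lt s x \<longrightarrow> f s \<lless> u", OF G1[of y]]
        unfolding G_def[of S f x] by blast
    qed
    show "G S f x \<lless> G S f y" if xy: "x \<in> S" "y \<in> L" "lt x y"
    proof -
      have fx: "f x \<in> ?W" using f xy by (auto simp: power_rank_def)
      have "\<forall>s\<in>S. lt s x \<longrightarrow> f s \<lless> f x" using f xy by (auto simp: power_rank_def)
      then have "G S f x = f x \<or> G S f x \<lless> f x"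
        using least_power(3)[where Q = "\<lambda>u. \<forall>s\<in>S. lt s x \<longrightarrow> f s \<lless> u", OF fx] unfolding G_def[of S f x] by blast
      moreover have "f x \<lless> G S f y" using G2[of y] xy by blast
      ultimately show ?thesis using powers_le_trans(1)[OF G1 fx G1] by blast
    qed
  qed
  have vw: "v \<in> ?W" "w \<in> ?W" using f g powers_upto_subset by auto
  define h where "h y = (\<lambda>e. G S f y e + G T g y e)" for y
  \<comment> \<open>The summand \<open>\<omega>^0 = 1\<close> makes the bound strict, since the rank of \<open>y\<close> may attain \<open>v + w\<close>.\<close>
  define u where "u = (\<lambda>e. v e + w e + single (\<lambda>_. 0) e)"
  have s0: "single (\<lambda>_. 0) \<in> powers_upto n a"
    unfolding powers_upto_def using colex_zero_le[OF a] by (intro single_fin_supp) auto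
  have u: "u \<in> powers_upto n a"
    unfolding u_def using f(2) g(2) s0 by (auto simp: powers_upto_def intro!: fin_supp_add)
  have h: "h y \<in> ?W" for y unfolding h_def using G(1)[OF f sub(1)] G(1)[OF g sub(2)] by (rule fin_supp_add)
  have le_add: "(\<lambda>e. F e + H e) = (\<lambda>e. F' e + H' e) \<or> (\<lambda>e. F e + H e) \<lless> (\<lambda>e. F' e + H' e)"
    if "F = F' \<or> F \<lless> F'" "H = H' \<or> H \<lless> H'" "F \<in> ?W" "F' \<in> ?W" "H \<in> ?W" "H' \<in> ?W"
    for F F' H H'
  proof -
    have 1: "(\<lambda>e. F e + H e) = (\<lambda>e. F' e + H e) \<or> (\<lambda>e. F e + H e) \<lless> (\<lambda>e. F' e + H e)"
    proof (cases "F = F'")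
      case False
      then show ?thesis using that(1) topdiff_less_add[of colex F F' H] by simp
    qed simp
    show ?thesis
    proof (cases "H = H'")
      case True
      then show ?thesis using 1 by simp
    next
      case False
      then have "(\<lambda>e. F' e + H e) \<lless> (\<lambda>e. F' e + H' e)"
        using that(2) topdiff_less_add_right[of colex H H' F'] by simp
      then show ?thesis
        using powers_le_trans(1)[OF fin_supp_add[OF that(3,5)] fin_supp_add[OF that(4,5)]
          fin_supp_add[OF that(4,6)] 1] by simp
    qed
  qed
  have hu: "h y \<lless> u" for y
  proof -
    have 1: "h y = (\<lambda>e. v e + w e) \<or> h y \<lless> (\<lambda>e. v e + w e)"
      unfolding h_def using G(1,3)[OF f sub(1)] G(1,3)[OF g sub(2)] vw by (intro le_add) auto
    have z: "\<not> (\<lambda>_. 0) \<sqsubset> (\<lambda>_. 0::nat)" by (rule topdiff_irrefl)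
    have 2: "(\<lambda>e. v e + w e) \<lless> u"
      unfolding u_def topdiff_less_def[of colex]
      by (rule exI[of _ "\<lambda>_. 0"]) (use z in \<open>auto simp: single_def\<close>)
    show ?thesis
      using powers_le_trans(1)[OF h fin_supp_add[OF vw] subsetD[OF powers_upto_subset u]] 1 2 by blast
  qed
  have mono: "h x \<lless> h y" if xy: "x \<in> S \<union> T" "y \<in> S \<union> T" "lt x y" for x y
  proof -
    have L: "x \<in> L" "y \<in> L" using xy sub by auto
    have S: "G S f x = G S f y \<or> G S f x \<lless> G S f y" using G(4)[OF f sub(1) L xy(3)] .
    have T: "G T g x = G T g y \<or> G T g x \<lless> G T g y" using G(4)[OF g sub(2) L xy(3)] .
    let ?m = "\<lambda>e. G S f y e + G T g x e"
    have m: "?m \<in> ?W" using G(1)[OF f sub(1)] G(1)[OF g sub(2)] by (rule fin_supp_add)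
    have 1: "h x = ?m \<or> h x \<lless> ?m"
    proof (cases "G S f x = G S f y")
      case False
      then show ?thesis
        using S topdiff_less_add[of colex "G S f x" "G S f y" "G T g x"] unfolding h_def by simp
    qed (simp add: h_def)
    have 2: "?m = h y \<or> ?m \<lless> h y"
    proof (cases "G T g x = G T g y")
      case False
      then show ?thesis
        using T topdiff_less_add_right[of colex "G T g x" "G T g y" "G S f y"] unfolding h_def by simp
    qed (simp add: h_def)
    show ?thesis
    proof (cases "x \<in> S")
      case True
      then have "h x \<lless> ?m" using G(5)[OF f sub(1) True L(2) xy(3)]
        topdiff_less_add[of colex "G S f x" "G S f y" "G T g x"] unfolding h_def by simp
      then show ?thesis using powers_le_trans(2)[OF h m h] 2 by blast
    next
      case False
      then have "x \<in> T" using xy by blast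
      then have "?m \<lless> h y"
        using topdiff_less_add_right[OF G(5)[OF g sub(2) _ L(2) xy(3)], of "G S f y"] unfolding h_def by simp
      then show ?thesis using powers_le_trans(1)[OF h m h] 1 by blast
    qed
  qed
  have "power_rank n lt (S \<union> T) u h" unfolding power_rank_def using h hu mono by blast
  then show ?thesis using u by blast
qed

text \<open>In the case of initial segments, the rank of \<open>p\<close> is the least \<open>w\<close> into which the segment below \<open>p\<close>
  has a rank. It is below \<open>\<omega>^a\<close>, because the segment is bounded by a smaller exponent.\<close>
lemma pow_bounded_rank:
  assumes wo: "strict_wo L lt" and "pow_bounded lt a S" "S \<subseteq> L" "a \<in> tuples_upto n"
  shows "\<exists>w\<in>powers_upto n a. \<exists>f. power_rank n lt S w f"
  using assms(2-)
proof (induction rule: pow_bounded.induct)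
  case (empty a)
  have "(\<lambda>_. 0) \<in> powers_upto n a" by (simp add: powers_upto_def)
  then show ?case by (auto simp: power_rank_def)
next
  case (union a S T)
  then show ?case using power_rank_union[OF wo, of S T a n] by auto
next
  case (segments S a)
  let ?W = "fin_supp (tuples_upto n)"
  define Q where "Q p v \<longleftrightarrow> (\<exists>g. power_rank n lt {y\<in>S. lt y p} v g)" for p v
  define \<rho> where "\<rho> p = least_power n (Q p)" for p
  have bound: "\<exists>w\<in>?W. Q p w \<and> w \<lless> single a" if p: "p \<in> S" for p
    using segments.IH[OF p]
  proof (elim disjE exE conjE, goal_cases)
    case 1
    have "Q p (\<lambda>_. 0)" unfolding Q_def power_rank_def 1 by simp
    moreover have "(\<lambda>_. 0) \<lless> single a"
      unfolding topdiff_less_def[of colex] by (rule exI[of _ a]) (auto simp: single_def topdiff_irrefl)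
    ultimately show ?case using zero_fin_supp by blast
  next
    case (2 a')
    have "a' \<in> tuples_upto n" using colex_tuples_upto_down[OF 2(1) segments.prems(2)] .
    then obtain w where w: "w \<in> powers_upto n a'" "Q p w" using 2(3) segments.prems(1) unfolding Q_def by blast
    then show ?case using powers_upto_less_single[OF w(1) 2(1) segments.prems(2)] powers_upto_subset by blast
  qed
  have \<rho>: "\<rho> p \<in> ?W" "Q p (\<rho> p)" "\<rho> p \<lless> single a" if p: "p \<in> S" for p
  proof -
    obtain w where w: "w \<in> ?W" "Q p w" "w \<lless> single a" using bound[OF p] by blast
    show "\<rho> p \<in> ?W" "Q p (\<rho> p)" using least_power(1,2)[of w n "Q p"] w unfolding \<rho>_def by blast+
    show "\<rho> p \<lless> single a"
      using powers_le_trans(1)[OF \<open>\<rho> p \<in> ?W\<close> w(1) single_fin_supp[OF segments.prems(2)]] w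
        least_power(3)[of w n "Q p"] unfolding \<rho>_def by blast
  qed
  have mono: "\<rho> p \<lless> \<rho> q" if pq: "p \<in> S" "q \<in> S" "lt p q" for p q
  proof -
    obtain g where g: "power_rank n lt {y\<in>S. lt y q} (\<rho> q) g" using \<rho>(2)[OF pq(2)] Q_def by blast
    have gp: "g p \<in> ?W" "g p \<lless> \<rho> q" using g pq by (auto simp: power_rank_def)
    have sub: "y \<in> {y\<in>S. lt y q}" if "y \<in> S" "lt y p" for y
      using that pq strict_wo_trans[OF wo that(2) pq(3)] segments.prems(1) by auto
    have "power_rank n lt {y\<in>S. lt y p} (g p) g"
      using g sub pq unfolding power_rank_def by auto
    then have "\<rho> p = g p \<or> \<rho> p \<lless> g p"
      using least_power(3)[of "g p" n "Q p"] gp unfolding \<rho>_def Q_def by blast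
    then show ?thesis using powers_le_trans(1)[OF \<rho>(1)[OF pq(1)] gp(1) \<rho>(1)[OF pq(2)]] gp(2) by blast
  qed
  have "single a \<in> powers_upto n a"
    unfolding powers_upto_def using segments.prems(2) by (intro single_fin_supp) auto
  then show ?case unfolding power_rank_def using \<rho> mono by blast
qed

text \<open>
  A bound would give a strictly increasing map of \<open>\<omega>^(\<omega>^n)\<close> into the ordinals below one of its own
  elements \<open>w\<close>, and the image of \<open>w\<close> would be below \<open>w\<close>.\<close>

lemma not_pow_bounded_powers:
  assumes a: "a \<in> tuples_upto n"
  shows "\<not> pow_bounded (topdiff_less colex) a (fin_supp (tuples_upto n))"
proof
  let ?W = "fin_supp (tuples_upto n)"
  assume "pow_bounded (topdiff_less colex) a ?W"
  then obtain w f where w: "w \<in> powers_upto n a" and f: "power_rank n (topdiff_less colex) ?W w f"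
    using pow_bounded_rank[OF strict_wo_powers _ _ a] by blast
  have wW: "w \<in> ?W" using w powers_upto_subset by blast
  have "\<not> f w \<lless> w"
    by (rule strict_wo_mono_not_less[OF strict_wo_powers]) (use f wW in \<open>auto simp: power_rank_def\<close>)
  then show False using f wW by (auto simp: power_rank_def)
qed

lemma ordLess_if_pow_bounded:
  assumes \<alpha>: "Well_order \<alpha>" and a: "a \<in> tuples_upto n"
    and bd: "pow_bounded (\<lambda>x y. x \<in> underS \<alpha> y) a (Field \<alpha>)"
  shows "(\<alpha>, wo_of (fin_supp (tuples_upto n)) (topdiff_less colex)) \<in> ordLess"
proof (rule ccontr)
  let ?W = "fin_supp (tuples_upto n)" and ?w = "wo_of (fin_supp (tuples_upto n)) (topdiff_less colex)"
  have W: "Well_order ?w" by (rule Well_order_wo_of[OF strict_wo_powers])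
  assume "(\<alpha>, ?w) \<notin> ordLess"
  then have "(?w, \<alpha>) \<in> ordLeq" using \<alpha> W by (simp add: not_ordLess_iff_ordLeq)
  then obtain g where g: "embed ?w \<alpha> g" by (auto simp: ordLeq_def)
  have inj: "inj_on g ?W" using embed_inj_on[OF W g] by simp
  have gF: "g x \<in> Field \<alpha>" if "x \<in> ?W" for x
    using embed_in_Field[OF g] that by simp
  have "pow_bounded (topdiff_less colex) a ?W"
  proof (rule pow_bounded_pullback[OF bd gF])
    fix x y assume xy: "x \<in> ?W" "y \<in> ?W" "x \<lless> y"
    have "(x, y) \<in> ?w" using xy by (simp add: wo_of_def)
    then have "(g x, g y) \<in> \<alpha>" using embed_compat[OF g] by (auto simp: compat_def)
    moreover have "g x \<noteq> g y" using inj xy topdiff_irrefl by (auto simp: inj_on_def)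
    ultimately show "g x \<in> underS \<alpha> (g y)" by (simp add: underS_def)
  qed
  then show False using not_pow_bounded_powers[OF a] by blast
qed

section \<open>Finite monoids with an infinite product\<close>
primrec partial_prod :: "('t \<Rightarrow> 't \<Rightarrow> 't) \<Rightarrow> 't \<Rightarrow> (nat \<Rightarrow> 't) \<Rightarrow> nat \<Rightarrow> 't" where
  "partial_prod mult one s 0 = one"
| "partial_prod mult one s (Suc k) = mult (partial_prod mult one s k) (s k)"

definition shift :: "(nat \<Rightarrow> 'a) \<Rightarrow> nat \<Rightarrow> nat \<Rightarrow> 'a" where
  "shift s k = (\<lambda>i. s (k + i))"

lemma shift_apply: "shift s k i = s (k + i)"
  by (simp add: shift_def)

lemma shift_shift [simp]: "shift (shift s k) l = shift s (k + l)" "shift s 0 = s"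
  by (auto simp: shift_def add.assoc)

text \<open>The law \<open>Om_factor\<close> says that an infinite product may be evaluated along any factorisation into
  finite blocks. The unit need not lie in the finite set \<open>T\<close>, because the type of the empty word is the
  identity relation on all states, also on those that the automaton does not have.\<close>
locale omega_monoid =
  fixes mult :: "'t \<Rightarrow> 't \<Rightarrow> 't" (infixl "\<cdot>" 70)
    and one :: 't
    and Om :: "(nat \<Rightarrow> 't) \<Rightarrow> 't"
    and T :: "'t set"
  assumes assoc: "(a \<cdot> b) \<cdot> c = a \<cdot> (b \<cdot> c)"
    and one_left: "one \<cdot> a = a" and one_right: "a \<cdot> one = a"
    and finite_T: "finite T"
    and mult_T: "a \<in> T \<Longrightarrow> b \<in> T \<Longrightarrow> a \<cdot> b \<in> T"
    and Om_T: "(\<And>i. s i \<in> T) \<Longrightarrow> Om s \<in> T"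
    and Om_unfold: "Om s = s 0 \<cdot> Om (\<lambda>i. s (Suc i))"
    and Om_factor: "strict_mono k \<Longrightarrow> k 0 = 0 \<Longrightarrow>
      Om s = Om (\<lambda>i. partial_prod (\<cdot>) one (shift s (k i)) (k (Suc i) - k i))"
begin

abbreviation pr :: "(nat \<Rightarrow> 't) \<Rightarrow> nat \<Rightarrow> 't" where
  "pr \<equiv> partial_prod (\<cdot>) one"

lemma pr_cong: "(\<And>i. i < k \<Longrightarrow> s i = s' i) \<Longrightarrow> pr s k = pr s' k"
  by (induction k) auto

lemma pr_add: "pr s (a + b) = pr s a \<cdot> pr (shift s a) b"
  by (induction b) (auto simp: one_right assoc shift_apply)

definition T1 :: "'t set" where "T1 = insert one T"

lemma finite_T1: "finite T1"
  by (simp add: T1_def finite_T)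

lemma pr_T: "(\<And>i. i < k \<Longrightarrow> s i \<in> T) \<Longrightarrow> pr s k \<in> T1"
  by (induction k) (auto simp: T1_def one_left mult_T)

lemma Om_split: "Om s = pr s k \<cdot> Om (shift s k)"
proof (induction k)
  case 0
  then show ?case by (simp add: one_left)
next
  case (Suc k)
  have "Om (shift s k) = s k \<cdot> Om (shift s (Suc k))"
  proof -
    have "(\<lambda>i. shift s k (Suc i)) = shift s (Suc k)" by (auto simp: shift_apply)
    then show ?thesis using Om_unfold[of "shift s k"] by (simp add: shift_apply)
  qed
  then show ?case using Suc by (simp add: assoc)
qed

text \<open>Types of sequences spliced from four sequences: the form in which mixed sequences are compared.\<close>
lemma Om_pieces:
  assumes "k \<le> a" "a \<le> b"
    and "\<And>i. i < k \<Longrightarrow> s i = A i" "\<And>i. k \<le> i \<Longrightarrow> i < a \<Longrightarrow> s i = B i"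
    and "\<And>i. a \<le> i \<Longrightarrow> i < b \<Longrightarrow> s i = C i" "\<And>i. b \<le> i \<Longrightarrow> s i = D i"
  shows "Om s = pr A k \<cdot> pr (shift B k) (a - k) \<cdot> pr (shift C a) (b - a) \<cdot> Om (shift D b)"
proof -
  have "Om s = pr s b \<cdot> Om (shift s b)" by (rule Om_split)
  moreover have "pr s b = pr s a \<cdot> pr (shift s a) (b - a)" using pr_add[of s a "b - a"] assms by simp
  moreover have "pr s a = pr s k \<cdot> pr (shift s k) (a - k)" using pr_add[of s k "a - k"] assms by simp
  moreover have "pr s k = pr A k" using assms by (intro pr_cong) auto
  moreover have "pr (shift s k) (a - k) = pr (shift B k) (a - k)" using assms by (intro pr_cong) (auto simp: shift_apply)
  moreover have "pr (shift s a) (b - a) = pr (shift C a) (b - a)" using assms by (intro pr_cong) (auto simp: shift_apply)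
  moreover have "shift s b = shift D b" using assms by (auto simp: shift_def)
  ultimately show ?thesis by simp
qed

text \<open>All blocks between two of the cuts \<open>k 0 < k 1 < \<dots>\<close> have the same product, as in Ramsey's theorem.\<close>
definition homogeneous :: "(nat \<Rightarrow> 't) \<Rightarrow> (nat \<Rightarrow> nat) \<Rightarrow> 't \<Rightarrow> bool" where
  "homogeneous s k e \<longleftrightarrow> (\<forall>i j. i < j \<longrightarrow> pr (shift s (k i)) (k j - k i) = e)"

lemma Om_homogeneous:
  assumes k: "strict_mono k" and h: "homogeneous s k e"
  shows "Om (shift s (k i)) = Om (\<lambda>_. e)"
proof -
  define k' where "k' j = k (i + j) - k i" for j
  have le: "k i \<le> k (i + j)" for j using k by (simp add: strict_mono_less_eq)
  have "strict_mono k'"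
    unfolding strict_mono_Suc_iff k'_def
    using k le by (auto simp: strict_mono_less intro!: diff_less_mono)
  moreover have "k' 0 = 0" by (simp add: k'_def)
  ultimately have "Om (shift s (k i)) = Om (\<lambda>j. pr (shift (shift s (k i)) (k' j)) (k' (Suc j) - k' j))"
    by (rule Om_factor)
  moreover have "pr (shift (shift s (k i)) (k' j)) (k' (Suc j) - k' j) = e" for j
  proof -
    have "k' (Suc j) - k' j = k (Suc (i + j)) - k (i + j)" "k i + k' j = k (i + j)"
      using le by (auto simp: k'_def)
    then show ?thesis using h by (simp add: homogeneous_def)
  qed
  ultimately show ?thesis by simp
qed

text \<open>Ramsey's theorem for the colouring of pairs \<open>a < b\<close> by the tuple of the products over \<open>[a, b)\<close> of the
  finitely many sequences \<open>s j\<close>. The cuts can be chosen in any infinite set \<open>Z\<close>, which serves to fix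
  their residues.\<close>
lemma ramsey_homogeneous:
  assumes "finite J" and sT: "\<And>j i. j \<in> J \<Longrightarrow> s j i \<in> T" and Z: "infinite Z"
  obtains k e where "strict_mono k" "range k \<subseteq> Z" "\<And>j. j \<in> J \<Longrightarrow> homogeneous (s j) k (e j)"
proof -
  define C where "C = (J \<rightarrow>\<^sub>E T1)"
  have "finite C" unfolding C_def using \<open>finite J\<close> finite_T1 by (simp add: finite_PiE)
  then obtain c where c: "bij_betw c C {0..<card C}" using ex_bij_betw_finite_nat by blast
  define col where "col a b = (\<lambda>j\<in>J. pr (shift (s j) a) (b - a))" for a b
  have col: "col a b \<in> C" for a b
    unfolding C_def col_def using sT by (auto intro!: pr_T simp: shift_apply)
  define f where "f A = c (col (Min A) (Max A))" for A :: "nat set"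
  have "f {x, y} < card C" for x y
    using c col unfolding f_def bij_betw_def by auto
  then obtain Y t where Y: "Y \<subseteq> Z" "infinite Y" "\<forall>x\<in>Y. \<forall>y\<in>Y. x \<noteq> y \<longrightarrow> f {x, y} = t"
    using Ramsey2[OF Z, of f "card C"] by blast
  define k where "k = enumerate Y"
  have k: "strict_mono k" "range k = Y"
    using Y by (auto simp: k_def strict_mono_enumerate range_enumerate)
  define e where "e j = pr (shift (s j) (k 0)) (k 1 - k 0)" for j
  have fc: "f {k i, k l} = c (col (k i) (k l))" if "i < l" for i l
  proof -
    have "k i < k l" using k that by (simp add: strict_mono_less)
    then show ?thesis by (simp add: f_def)
  qed
  have "col (k i) (k l) = col (k 0) (k 1)" if "i < l" for i l
  proof -
    have ne: "k i \<noteq> k l" "k 0 \<noteq> k 1" using k that by (simp_all add: strict_mono_eq)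
    have "k m \<in> Y" for m using k(2) by blast
    then have "f {k i, k l} = t" "f {k 0, k 1} = t" using Y(3) ne by blast+
    then have "c (col (k i) (k l)) = c (col (k 0) (k 1))" using fc[OF that] fc[of 0 1] by simp
    then show ?thesis using c col by (auto simp: bij_betw_def inj_on_def)
  qed
  then have "homogeneous (s j) k (e j)" if "j \<in> J" for j
    unfolding homogeneous_def e_def using that by (metis (mono_tags, lifting) col_def restrict_apply')
  moreover have "range k \<subseteq> Z" using k Y by blast
  ultimately show ?thesis using that k by blast
qed

end

section \<open>Well-orders of \<open>\<omega>\<close>-sequences that are determined by types\<close>
text \<open>The induction hypothesis on the words \<open>X\<close> of length \<open>\<omega>\<^sup>n\<close>: \<open>t x y\<close> is the type of the pair of \<open>x\<close> and
  \<open>y\<close>, the set \<open>G\<close> of types picks out a domain and \<open>F\<close> an order on it. It speaks of all \<open>F\<close> and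
  \<open>G\<close> at once, since restricting an order of sequences to one position changes them.\<close>
definition type_bounded :: "nat \<Rightarrow> 'x set \<Rightarrow> ('x \<Rightarrow> 'x \<Rightarrow> 't) \<Rightarrow> bool" where
  "type_bounded n X t \<longleftrightarrow> (\<forall>F G. strict_wo {x\<in>X. t x x \<in> G} (\<lambda>x y. t x y \<in> F) \<longrightarrow>
     (\<exists>a\<in>tuples_upto n. pow_bounded (\<lambda>x y. t x y \<in> F) a {x\<in>X. t x x \<in> G}))"

text \<open>A well-order on sequences over \<open>X\<close> that is determined by infinite products of types. Below, \<open>L\<close> is its
  carrier, \<open>lt\<close> its relation, \<open>Y\<close> the set of all sequences over \<open>X\<close>, and \<open>pt x y\<close> the pointwise
  types of a pair of sequences.\<close>
locale typed_order = omega_monoid mult one Om T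
  for mult :: "'t \<Rightarrow> 't \<Rightarrow> 't" (infixl "\<cdot>" 70) and one Om T +
  fixes n :: nat and X :: "'x set" and t :: "'x \<Rightarrow> 'x \<Rightarrow> 't" and F G :: "'t set"
  assumes t_T: "x \<in> X \<Longrightarrow> y \<in> X \<Longrightarrow> t x y \<in> T"
    and bounded: "type_bounded n X t"
    and wo0: "strict_wo {x. (\<forall>i. x i \<in> X) \<and> Om (\<lambda>i. t (x i) (x i)) \<in> G} (\<lambda>x y. Om (\<lambda>i. t (x i) (y i)) \<in> F)"
begin

definition pt :: "(nat \<Rightarrow> 'x) \<Rightarrow> (nat \<Rightarrow> 'x) \<Rightarrow> nat \<Rightarrow> 't" where
  "pt x y = (\<lambda>i. t (x i) (y i))"

definition Y :: "(nat \<Rightarrow> 'x) set" where "Y = {x. \<forall>i. x i \<in> X}"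

definition L :: "(nat \<Rightarrow> 'x) set" where "L = {x\<in>Y. Om (pt x x) \<in> G}"

definition lt :: "(nat \<Rightarrow> 'x) \<Rightarrow> (nat \<Rightarrow> 'x) \<Rightarrow> bool" where "lt x y \<longleftrightarrow> Om (pt x y) \<in> F"

lemma wo: "strict_wo L lt"
  using wo0 unfolding L_def lt_def Y_def pt_def by simp

lemma pt_T: "x \<in> Y \<Longrightarrow> y \<in> Y \<Longrightarrow> pt x y i \<in> T"
  by (simp add: Y_def pt_def t_T)

lemma no_descent:
  assumes "\<And>i. f i \<in> L" "\<And>i. lt (f (Suc i)) (f i)"
  shows False
proof -
  obtain m where "m \<in> range f" "\<forall>y\<in>range f. \<not> lt y m"
    using strict_wo_min[OF wo, of "range f"] assms(1) by blast
  then show False using assms(2) by blast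
qed

text \<open>If \<open>x\<close> and \<open>y\<close> differ after \<open>k 1\<close>, insert into \<open>x\<close> a stretch of \<open>y\<close> from \<open>k 0\<close> to \<open>k j\<close>. The results
  \<open>u j\<close> lie in the domain, and the type of the pair of \<open>u a\<close> and \<open>u b\<close> is the same for all \<open>0 < a < b\<close>, so
  the sequence \<open>u\<close> either descends or ascends. If it ascends, then by the same type the sequences
  \<open>u' j\<close>, which follow \<open>x\<close> up to \<open>k j\<close> and then \<open>y\<close>, descend. Both contradict well-foundedness.\<close>
lemma tail_rigid:
  assumes x: "x \<in> L" and y: "y \<in> Y" and k: "strict_mono k"
    and xx: "homogeneous (pt x x) k e" and yy: "homogeneous (pt y y) k e"
    and xy: "homogeneous (pt x y) k h1" and yx: "homogeneous (pt y x) k h2"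
    and i: "k 1 \<le> i"
  shows "x i = y i"
proof (rule ccontr)
  assume neq: "x i \<noteq> y i"
  define u where "u j = (\<lambda>i. if i < k 0 then x i else if i < k j then y i else x i)" for j
  define u' where "u' j = (\<lambda>i. if i < k j then x i else y i)" for j
  define A where "A = pr (pt x x) (k 0)"
  define E where "E = Om (\<lambda>_. e)"
  have Ex: "Om (shift (pt x x) (k j)) = E" for j unfolding E_def by (rule Om_homogeneous[OF k xx])
  have Ey: "Om (shift (pt y y) (k j)) = E" for j unfolding E_def by (rule Om_homogeneous[OF k yy])
  have less: "k a < k b" if "a < b" for a b using k that by (simp add: strict_mono_less)
  have le: "k a \<le> k b" if "a \<le> b" for a b using k that by (simp add: strict_mono_less_eq)
  have H: "pr (shift (pt x x) (k a)) (k b - k a) = e" "pr (shift (pt y y) (k a)) (k b - k a) = e"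
    "pr (shift (pt x y) (k a)) (k b - k a) = h1" "pr (shift (pt y x) (k a)) (k b - k a) = h2" if "a < b" for a b
    using xx yy xy yx that by (auto simp: homogeneous_def)
  have xY: "x \<in> Y" using x by (simp add: L_def)
  have uY: "u j \<in> Y" "u' j \<in> Y" for j using xY y by (auto simp: u_def u'_def Y_def)
  have Gx: "A \<cdot> E \<in> G" using x Om_split[of "pt x x" "k 0"] Ex by (simp add: L_def A_def)
  have u_less: "Om (pt (u a) (u b)) = A \<cdot> e \<cdot> h1 \<cdot> E" "Om (pt (u b) (u a)) = A \<cdot> e \<cdot> h2 \<cdot> E"
    "Om (pt (u' b) (u' a)) = A \<cdot> e \<cdot> h1 \<cdot> E" if ab: "0 < a" "a < b" for a b
  proof -
    have ord: "k 0 \<le> k a" "k a \<le> k b" using ab by (auto intro: le)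
    show "Om (pt (u a) (u b)) = A \<cdot> e \<cdot> h1 \<cdot> E"
    proof -
      have "Om (pt (u a) (u b)) = pr (pt x x) (k 0) \<cdot> pr (shift (pt y y) (k 0)) (k a - k 0) \<cdot>
          pr (shift (pt x y) (k a)) (k b - k a) \<cdot> Om (shift (pt x x) (k b))"
        by (rule Om_pieces[OF ord]) (use ord in \<open>auto simp: pt_def u_def\<close>)
      then show ?thesis by (simp only: H[OF ab(1)] H[OF ab(2)] Ex A_def)
    qed
    show "Om (pt (u b) (u a)) = A \<cdot> e \<cdot> h2 \<cdot> E"
    proof -
      have "Om (pt (u b) (u a)) = pr (pt x x) (k 0) \<cdot> pr (shift (pt y y) (k 0)) (k a - k 0) \<cdot>
          pr (shift (pt y x) (k a)) (k b - k a) \<cdot> Om (shift (pt x x) (k b))"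
        by (rule Om_pieces[OF ord]) (use ord in \<open>auto simp: pt_def u_def\<close>)
      then show ?thesis by (simp only: H[OF ab(1)] H[OF ab(2)] Ex A_def)
    qed
    show "Om (pt (u' b) (u' a)) = A \<cdot> e \<cdot> h1 \<cdot> E"
    proof -
      have "Om (pt (u' b) (u' a)) = pr (pt x x) (k 0) \<cdot> pr (shift (pt x x) (k 0)) (k a - k 0) \<cdot>
          pr (shift (pt x y) (k a)) (k b - k a) \<cdot> Om (shift (pt y y) (k b))"
        by (rule Om_pieces[OF ord]) (use ord in \<open>auto simp: pt_def u'_def\<close>)
      then show ?thesis by (simp only: H[OF ab(1)] H[OF ab(2)] Ey A_def)
    qed
  qed
  have ee: "e \<cdot> E = E"
  proof -
    have "k 0 + (k 1 - k 0) = k 1" using less[of 0 1] by simp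
    then have "E = e \<cdot> E"
      using Om_split[of "shift (pt x x) (k 0)" "k 1 - k 0"] by (simp only: shift_shift H(1)[OF zero_less_one] Ex)
    then show ?thesis by (rule sym)
  qed
  have uL: "u a \<in> L" "u' a \<in> L" if "0 < a" for a
  proof -
    have ord: "k 0 \<le> k a" "k a \<le> k a" using that by (auto intro: le)
    have "Om (pt (u a) (u a)) = pr (pt x x) (k 0) \<cdot> pr (shift (pt y y) (k 0)) (k a - k 0) \<cdot>
        pr (shift (pt x x) (k a)) (k a - k a) \<cdot> Om (shift (pt x x) (k a))"
      by (rule Om_pieces[OF ord]) (use ord in \<open>auto simp: pt_def u_def\<close>)
    then show "u a \<in> L" using uY Gx ee by (simp add: H[OF that] Ex A_def L_def one_right assoc)
    have "Om (pt (u' a) (u' a)) = pr (pt x x) (k 0) \<cdot> pr (shift (pt x x) (k 0)) (k a - k 0) \<cdot>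
        pr (shift (pt x x) (k a)) (k a - k a) \<cdot> Om (shift (pt y y) (k a))"
      by (rule Om_pieces[OF ord]) (use ord in \<open>auto simp: pt_def u'_def\<close>)
    then show "u' a \<in> L" using uY Gx ee by (simp add: H[OF that] Ey A_def L_def one_right assoc)
  qed
  \<comment> \<open>The index \<open>j\<close> is so large that position \<open>i\<close> lies before \<open>k j\<close>; there \<open>u 1\<close> follows \<open>x\<close> and \<open>u j\<close> follows \<open>y\<close>.\<close>
  define j where "j = Suc (Suc i)"
  have "j \<le> k j" using k by (rule strict_mono_imp_increasing)
  then have j: "i < k j" "1 < j" by (auto simp: j_def)
  have "u 1 i \<noteq> u j i" using neq i j less[of 0 1] by (simp add: u_def)
  then have "lt (u 1) (u j) \<or> lt (u j) (u 1)"
    using strict_wo_total[OF wo uL(1)[of 1] uL(1)[of j]] j by auto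
  then show False
  proof
    assume "lt (u 1) (u j)"
    then have F: "A \<cdot> e \<cdot> h1 \<cdot> E \<in> F" using u_less(1)[of 1 j] j by (simp add: lt_def)
    show False by (rule no_descent[of "\<lambda>a. u' (Suc a)"]) (use uL F u_less(3) in \<open>auto simp: lt_def\<close>)
  next
    assume "lt (u j) (u 1)"
    then have F: "A \<cdot> e \<cdot> h2 \<cdot> E \<in> F" using u_less(2)[of 1 j] j by (simp add: lt_def)
    show False by (rule no_descent[of "\<lambda>a. u (Suc a)"]) (use uL F u_less(2) in \<open>auto simp: lt_def\<close>)
  qed
qed

end

section \<open>Cutting sequences into prefixes and tails\<close>
definition bounded_in :: "(nat \<Rightarrow> nat) set \<Rightarrow> ('a \<Rightarrow> 'a \<Rightarrow> bool) \<Rightarrow> 'a set \<Rightarrow> bool" where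
  "bounded_in A lt S \<longleftrightarrow> (\<exists>a\<in>A. pow_bounded lt a S)"

lemma bounded_in_subset: "bounded_in A lt S \<Longrightarrow> T \<subseteq> S \<Longrightarrow> bounded_in A lt T"
  unfolding bounded_in_def using pow_bounded_subset by blast

lemma bounded_in_mono: "bounded_in A lt S \<Longrightarrow> A \<subseteq> B \<Longrightarrow> bounded_in B lt S"
  unfolding bounded_in_def by blast

lemma bounded_in_pullback:
  assumes "bounded_in A lt S" "\<And>x. x \<in> T \<Longrightarrow> f x \<in> S"
    "\<And>x y. x \<in> T \<Longrightarrow> y \<in> T \<Longrightarrow> lt' x y \<Longrightarrow> lt (f x) (f y)"
  shows "bounded_in A lt' T"
proof -
  obtain a where a: "a \<in> A" "pow_bounded lt a S" using assms(1) bounded_in_def by blast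
  have "pow_bounded lt' a T" by (rule pow_bounded_pullback[where f = f, OF a(2)]) (fact assms(2,3))+
  then show ?thesis using a(1) by (auto simp: bounded_in_def)
qed

lemma bounded_in_union:
  assumes A: "A \<subseteq> tuples_upto n" and S: "bounded_in A lt S" and T: "bounded_in A lt T"
  shows "bounded_in A lt (S \<union> T)"
proof -
  obtain a where a: "a \<in> A" "pow_bounded lt a S" using S bounded_in_def by blast
  obtain b where b: "b \<in> A" "pow_bounded lt b T" using T bounded_in_def by blast
  have ab: "a \<in> tuples_upto n" "b \<in> tuples_upto n" using a b A by auto
  consider "a = b \<or> a \<sqsubset> b" | "b \<sqsubset> a" using colex_total[OF ab] by blast
  then show ?thesis
  proof cases
    case 1
    have "pow_bounded lt b S" by (rule pow_bounded_mono[OF a(2) ab 1])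
    then show ?thesis unfolding bounded_in_def using b by (intro bexI[of _ b] pow_bounded.union)
  next
    case 2
    have "pow_bounded lt a T" by (rule pow_bounded_mono[OF b(2) ab(2,1)]) (use 2 in blast)
    then show ?thesis unfolding bounded_in_def using a by (intro bexI[of _ a] pow_bounded.union)
  qed
qed

lemma bounded_in_finite_Union:
  assumes A: "A \<subseteq> tuples_upto n" "A \<noteq> {}" and "finite I" "\<And>i. i \<in> I \<Longrightarrow> bounded_in A lt (S i)"
  shows "bounded_in A lt (\<Union>i\<in>I. S i)"
  using assms(3,4)
proof (induction I rule: finite_induct)
  case empty
  then show ?case using A by (auto simp: bounded_in_def intro: pow_bounded.empty)
next
  case (insert i I)
  then have "bounded_in A lt (S i \<union> (\<Union>i\<in>I. S i))" by (intro bounded_in_union[OF A(1)]) auto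
  then show ?case by simp
qed

lemma tuples_upto_nonempty: "tuples_upto n \<noteq> {}"
  using tuples_upto_zero by blast

definition mix :: "nat \<Rightarrow> (nat \<Rightarrow> 'x) \<Rightarrow> (nat \<Rightarrow> 'x) \<Rightarrow> nat \<Rightarrow> 'x" where
  "mix k u v = (\<lambda>i. if i < k then u i else v i)"

definition tail_eq :: "(nat \<Rightarrow> 'x) \<Rightarrow> (nat \<Rightarrow> 'x) \<Rightarrow> bool" where
  "tail_eq x y \<longleftrightarrow> (\<exists>j. \<forall>i\<ge>j. x i = y i)"

context typed_order
begin

lemma Om_mix: "Om (pt (mix k a b) (mix k c d)) = pr (pt a c) k \<cdot> Om (shift (pt b d) k)"
proof -
  have "pr (pt (mix k a b) (mix k c d)) k = pr (pt a c) k"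
    by (rule pr_cong) (simp add: pt_def mix_def)
  moreover have "shift (pt (mix k a b) (mix k c d)) k = shift (pt b d) k"
    by (simp add: shift_def pt_def mix_def)
  ultimately show ?thesis using Om_split[of "pt (mix k a b) (mix k c d)" k] by simp
qed

lemma mix_Y: "u \<in> Y \<Longrightarrow> v \<in> Y \<Longrightarrow> mix k u v \<in> Y"
  by (simp add: Y_def mix_def)

lemma L_Y: "x \<in> L \<Longrightarrow> x \<in> Y"
  by (simp add: L_def)

text \<open>Among more sequences than there are types, factorised simultaneously, two have the same type on all
  blocks, and these two agree on a tail by rigidity.\<close>
lemma finite_tail_classes: "\<exists>C. finite C \<and> C \<subseteq> L \<and> (\<forall>x\<in>L. \<exists>c\<in>C. tail_eq x c)"
proof (rule ccontr)
  assume no: "\<nexists>C. finite C \<and> C \<subseteq> L \<and> (\<forall>x\<in>L. \<exists>c\<in>C. tail_eq x c)"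
  have "\<exists>C. finite C \<and> C \<subseteq> L \<and> card C = N \<and> (\<forall>c\<in>C. \<forall>d\<in>C. c \<noteq> d \<longrightarrow> \<not> tail_eq c d)" for N
  proof (induction N)
    case 0
    then show ?case by (intro exI[of _ "{}"]) auto
  next
    case (Suc N)
    then obtain C where C: "finite C" "C \<subseteq> L" "card C = N" "\<forall>c\<in>C. \<forall>d\<in>C. c \<noteq> d \<longrightarrow> \<not> tail_eq c d"
      by (elim exE conjE)
    have "\<not> (finite C \<and> C \<subseteq> L \<and> (\<forall>x\<in>L. \<exists>c\<in>C. tail_eq x c))" by (rule spec[OF no[unfolded not_ex]])
    then obtain x where x: "x \<in> L" "\<forall>c\<in>C. \<not> tail_eq x c" using C(1,2) by auto
    have refl: "tail_eq c c" for c :: "nat \<Rightarrow> 'x" by (simp add: tail_eq_def)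
    have sym: "tail_eq d c" if "tail_eq c d" for c d :: "nat \<Rightarrow> 'x"
      using that unfolding tail_eq_def by metis
    have "x \<notin> C" using x refl by blast
    moreover have "\<forall>c\<in>C. \<not> tail_eq c x" using x(2) sym by blast
    ultimately show ?case using C x by (intro exI[of _ "insert x C"]) simp
  qed
  from this[of "Suc (card T1)"] obtain C where C: "finite C" "C \<subseteq> L" "card C = Suc (card T1)"
    "\<forall>c\<in>C. \<forall>d\<in>C. c \<noteq> d \<longrightarrow> \<not> tail_eq c d" by (elim exE conjE)
  obtain k e where k: "strict_mono k"
    and e: "\<And>j. j \<in> C \<times> C \<Longrightarrow> homogeneous (case j of (a, b) \<Rightarrow> pt a b) k (e j)"
  proof (rule ramsey_homogeneous[of "C \<times> C" "\<lambda>(a, b). pt a b" "UNIV :: nat set"])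
    show "(case j of (a, b) \<Rightarrow> pt a b) i \<in> T" if "j \<in> C \<times> C" for j i
      using that C(2) L_Y by (auto intro: pt_T)
  qed (use C(1) that in auto)
  have eT: "e (a, a) \<in> T1" if "a \<in> C" for a
  proof -
    have "pr (shift (pt a a) (k 0)) (k 1 - k 0) = e (a, a)"
      using e[of "(a, a)"] that by (simp add: homogeneous_def)
    moreover have "pr (shift (pt a a) (k 0)) (k 1 - k 0) \<in> T1"
      using that C(2) L_Y by (intro pr_T) (auto simp: shift_apply intro!: pt_T)
    ultimately show ?thesis by simp
  qed
  have "\<not> inj_on (\<lambda>a. e (a, a)) C"
  proof
    assume "inj_on (\<lambda>a. e (a, a)) C"
    then have "card C \<le> card T1" using eT finite_T1 by (intro card_inj_on_le[of "\<lambda>a. e (a, a)"]) auto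
    then show False using C(3) by simp
  qed
  then obtain a b where ab: "a \<in> C" "b \<in> C" "a \<noteq> b" "e (a, a) = e (b, b)" by (auto simp: inj_on_def)
  have "a i = b i" if "k 1 \<le> i" for i
  proof (rule tail_rigid[OF _ _ k _ _ _ _ that])
    show "a \<in> L" "b \<in> Y" using ab C(2) L_Y by auto
    show "homogeneous (pt a a) k (e (a, a))" "homogeneous (pt b b) k (e (a, a))"
      "homogeneous (pt a b) k (e (a, b))" "homogeneous (pt b a) k (e (b, a))"
      using e[of "(a, a)"] e[of "(b, b)"] e[of "(a, b)"] e[of "(b, a)"] ab by auto
  qed
  then have "tail_eq a b" unfolding tail_eq_def by blast
  then show False using C(4) ab by blast
qed

text \<open>Repeating one block of a homogeneous factorisation of \<open>x\<close> forever gives a periodic sequence \<open>y\<close> with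
  the same idempotent type \<open>e\<close> on its blocks. When a common factorisation of \<open>x\<close> and \<open>y\<close> uses only cuts
  in one residue class modulo the period \<open>l\<close>, its blocks have type \<open>e\<close> for both, so \<open>x\<close> and \<open>y\<close> agree on
  a tail.\<close>
lemma eventually_periodic:
  assumes x: "x \<in> L"
  shows "\<exists>c l. 0 < l \<and> (\<forall>i\<ge>c. x (i + l) = x i)"
proof -
  have xY: "x \<in> Y" using x by (rule L_Y)
  obtain k e0 where k: "strict_mono k" and h: "homogeneous (pt x x) k (e0 ())"
  proof (rule ramsey_homogeneous[of "{()}" "\<lambda>_. pt x x" "UNIV :: nat set"])
  qed (use that pt_T[OF xY xY] in auto)
  define e where "e = e0 ()"
  have H: "pr (shift (pt x x) (k i)) (k j - k i) = e" if "i < j" for i j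
    using h that by (simp add: homogeneous_def e_def)
  define l where "l = k 1 - k 0"
  have less: "k a < k b" if "a < b" for a b using k that by (simp add: strict_mono_less)
  have l: "0 < l" using less[of 0 1] by (simp add: l_def)
  have ee: "e \<cdot> e = e"
  proof -
    have "k 2 - k 0 = l + (k 2 - k 1)" "k 0 + l = k 1" using less[of 0 1] less[of 1 2] by (auto simp: l_def)
    then have "pr (shift (pt x x) (k 0)) (k 2 - k 0) = pr (shift (pt x x) (k 0)) l \<cdot> pr (shift (pt x x) (k 1)) (k 2 - k 1)"
      using pr_add[of "shift (pt x x) (k 0)" l "k 2 - k 1"] by simp
    moreover have "pr (shift (pt x x) (k 0)) (k 2 - k 0) = e" "pr (shift (pt x x) (k 0)) l = e"
      "pr (shift (pt x x) (k 1)) (k 2 - k 1) = e"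
      unfolding l_def by (rule H, simp)+
    ultimately show ?thesis by metis
  qed
  have inf_k: "infinite (range k)" using k by (simp add: range_inj_infinite strict_mono_imp_inj_on)
  have fin_mod: "finite ((\<lambda>z. z mod l) ` range k)"
    by (rule finite_subset[of _ "{..<l}"]) (use l in auto)
  obtain z0 where z0: "z0 \<in> range k" and inf: "infinite {z\<in>range k. z mod l = z0 mod l}"
    by (rule bexE[OF pigeonhole_infinite[OF inf_k fin_mod]])
  \<comment> \<open>Only cuts of the given factorisation of \<open>x\<close> are allowed, so that blocks of \<open>x\<close> have type \<open>e\<close>; only one
    residue class, so that blocks of \<open>y\<close> consist of whole periods.\<close>
  define Z where "Z = {z\<in>range k. z mod l = z0 mod l} - {..<z0}"
  have Z: "infinite Z" unfolding Z_def using inf by (simp add: Diff_infinite_finite)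
  define y where "y i = (if i < z0 then x i else x (k 0 + (i - z0) mod l))" for i
  have yY: "y \<in> Y" using xY by (auto simp: y_def Y_def)
  obtain k' e' where k': "strict_mono k'" "range k' \<subseteq> Z"
    and e': "\<And>j. j \<in> {x, y} \<times> {x, y} \<Longrightarrow> homogeneous (case j of (a, b) \<Rightarrow> pt a b) k' (e' j)"
  proof (rule ramsey_homogeneous[of "{x, y} \<times> {x, y}" "\<lambda>(a, b). pt a b" Z])
    show "(case j of (a, b) \<Rightarrow> pt a b) i \<in> T" if "j \<in> {x, y} \<times> {x, y}" for j i
      using that xY yY by (auto intro: pt_T)
  qed (use Z that in auto)
  have k'Z: "k' i \<in> Z" for i using k'(2) by blast
  have k'01: "k' 0 < k' 1" using k'(1) by (simp add: strict_mono_less)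
  have xx: "e' (x, x) = e"
  proof -
    obtain p q where pq: "k' 0 = k p" "k' 1 = k q" using k'Z[of 0] k'Z[of 1] by (auto simp: Z_def)
    then have "p < q" using k'01 k by (simp add: strict_mono_less)
    then have "pr (shift (pt x x) (k' 0)) (k' 1 - k' 0) = e" using H pq by simp
    then show ?thesis using e'[of "(x, x)"] by (simp add: homogeneous_def)
  qed
  have block: "pr (shift (pt y y) a) (Suc q * l) = e" if a: "z0 \<le> a" "(a - z0) mod l = 0" for a q
  proof -
    have one_block: "pr (shift (pt y y) a) l = e" if a: "z0 \<le> a" "(a - z0) mod l = 0" for a
    proof -
      have "y (a + i) = x (k 0 + i)" if "i < l" for i
      proof -
        have "(a + i - z0) mod l = ((a - z0) + i) mod l" using a(1) by (simp add: add.commute)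
        also have "\<dots> = i" using a(2) that by (metis add_0 mod_add_left_eq mod_less)
        finally show ?thesis using a(1) by (simp add: y_def)
      qed
      then have "pr (shift (pt y y) a) l = pr (shift (pt x x) (k 0)) l"
        by (intro pr_cong) (simp add: shift_apply pt_def)
      then show ?thesis using H[of 0 1] by (simp add: l_def)
    qed
    show ?thesis
    proof (induction q)
      case 0
      then show ?case using one_block[OF a] by simp
    next
      case (Suc q)
      have b: "z0 \<le> a + Suc q * l" using a by simp
      have "(a + Suc q * l - z0) mod l = ((a - z0) + Suc q * l) mod l" using a(1) by (simp add: add.commute)
      also have "\<dots> = 0" using a(2) by (metis mod_mult_self1)
      finally have "pr (shift (pt y y) (a + Suc q * l)) l = e" using one_block[OF b] by simp
      moreover have "pr (shift (pt y y) a) (Suc q * l + l) = pr (shift (pt y y) a) (Suc q * l) \<cdot> pr (shift (pt y y) (a + Suc q * l)) l"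
        using pr_add[of "shift (pt y y) a" "Suc q * l" l] by (simp only: shift_shift)
      moreover have "Suc (Suc q) * l = Suc q * l + l" by simp
      ultimately show ?case using Suc ee by (simp only:)
    qed
  qed
  have yy: "e' (y, y) = e"
  proof -
    have z: "z0 \<le> k' i" "k' i mod l = z0 mod l" for i using k'Z[of i] by (auto simp: Z_def)
    have "(k' 0 - z0) mod l = 0" using z[of 0] by (metis mod_eq_dvd_iff_nat dvd_imp_mod_0)
    moreover have "l dvd k' 1 - k' 0" using z k'01 by (metis less_imp_le mod_eq_dvd_iff_nat)
    then obtain q where q: "k' 1 - k' 0 = q * l" by (metis dvd_def mult.commute)
    then obtain q' where "q = Suc q'" using k'01 by (cases q) auto
    ultimately have "pr (shift (pt y y) (k' 0)) (k' 1 - k' 0) = e" using block z q by metis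
    then show ?thesis using e'[of "(y, y)"] by (simp add: homogeneous_def)
  qed
  have eq: "x i = y i" if "k' 1 \<le> i" for i
  proof (rule tail_rigid[OF x yY k'(1) _ _ _ _ that])
    show "homogeneous (pt x x) k' e" "homogeneous (pt y y) k' e"
      "homogeneous (pt x y) k' (e' (x, y))" "homogeneous (pt y x) k' (e' (y, x))"
      using e'[of "(x, x)"] e'[of "(y, y)"] e'[of "(x, y)"] e'[of "(y, x)"] xx yy by auto
  qed
  have "x (i + l) = x i" if i: "k' 1 \<le> i" for i
  proof -
    have z: "z0 \<le> i" using k'Z[of 1] i by (auto simp: Z_def)
    then have "i + l - z0 = (i - z0) + l" by simp
    then have "(i + l - z0) mod l = (i - z0) mod l" by simp
    then have "y (i + l) = y i" using z by (simp add: y_def)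
    then show ?thesis using eq[of i] eq[of "i + l"] i by simp
  qed
  then show ?thesis using l by blast
qed

text \<open>Since the types of both halves are constant on \<open>S\<close>, any prefix of an element of \<open>S\<close> may be combined
  with any tail, and the comparison of two combinations with a common half does not depend on this half.
  If \<open>y' < y\<close> although neither the prefix nor the tail decreases, then \<open>y \<le> w \<le> y'\<close> for the element
  \<open>w\<close> with the prefix of \<open>y'\<close> and the tail of \<open>y\<close>.\<close>
lemma cut_box:
  assumes S: "S \<subseteq> L" and type: "\<And>y. y \<in> S \<Longrightarrow> pr (pt y y) k = \<tau>" "\<And>y. y \<in> S \<Longrightarrow> Om (shift (pt y y) k) = \<theta>"
    and y1: "y1 \<in> S" and ab: "a \<in> tuples_upto m" "b \<in> tuples_upto m"
    and U: "pow_bounded lt a ((\<lambda>y. mix k y y1) ` S)" and V: "pow_bounded lt b ((\<lambda>y. mix k y1 y) ` S)"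
  shows "pow_bounded lt (\<lambda>i. a i + b i) S"
proof (rule pow_bounded_box[OF U V ab])
  show "mix k y y1 \<in> (\<lambda>y. mix k y y1) ` S \<and> mix k y1 y \<in> (\<lambda>y. mix k y1 y) ` S" if "y \<in> S" for y
    using that by blast
  fix y y' assume y: "y \<in> S" and y': "y' \<in> S" and less: "lt y' y"
  have mixL: "mix k u v \<in> L" if "u \<in> S" "v \<in> S" for u v
  proof -
    have "\<tau> \<cdot> \<theta> \<in> G" using Om_split[of "pt y1 y1" k] type y1 S by (auto simp: L_def)
    moreover have "mix k u v \<in> Y" using that S L_Y mix_Y by blast
    ultimately show ?thesis using Om_mix[of k u v u v] type that by (simp add: L_def)
  qed
  show "lt (mix k y' y1) (mix k y y1) \<or> lt (mix k y1 y') (mix k y1 y)"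
  proof (rule ccontr)
    assume "\<not> ?thesis"
    then have no: "\<not> lt (mix k y' y1) (mix k y y1)" "\<not> lt (mix k y1 y') (mix k y1 y)" by auto
    let ?w = "mix k y' y"
    have 1: "y = ?w \<or> lt y ?w"
    proof -
      have "mix k y y1 = mix k y' y1 \<or> lt (mix k y y1) (mix k y' y1)"
        using strict_wo_total[OF wo mixL[OF y y1] mixL[OF y' y1]] no by blast
      then show ?thesis
      proof
        assume "mix k y y1 = mix k y' y1"
        then have "y i = y' i" if "i < k" for i using fun_cong[of _ _ i] that by (auto simp: mix_def dest: fun_cong[of _ _ i])
        then have "y = ?w" by (auto simp: mix_def)
        then show ?thesis ..
      next
        assume "lt (mix k y y1) (mix k y' y1)"
        then have "lt (mix k y y) ?w" using Om_mix[of k y y1 y' y1] Om_mix[of k y y y' y] type y y1 by (simp add: lt_def)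
        moreover have "mix k y y = y" by (auto simp: mix_def)
        ultimately show ?thesis by simp
      qed
    qed
    have 2: "?w = y' \<or> lt ?w y'"
    proof -
      have "mix k y1 y = mix k y1 y' \<or> lt (mix k y1 y) (mix k y1 y')"
        using strict_wo_total[OF wo mixL[OF y1 y] mixL[OF y1 y']] no by blast
      then show ?thesis
      proof
        assume "mix k y1 y = mix k y1 y'"
        then have "y i = y' i" if "\<not> i < k" for i using that by (auto simp: mix_def dest: fun_cong[of _ _ i])
        then have "?w = y'" by (auto simp: mix_def)
        then show ?thesis ..
      next
        assume "lt (mix k y1 y) (mix k y1 y')"
        then have "lt ?w (mix k y' y')" using Om_mix[of k y1 y y1 y'] Om_mix[of k y' y y' y'] type y' y1 by (simp add: lt_def)
        moreover have "mix k y' y' = y'" by (auto simp: mix_def)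
        ultimately show ?thesis by simp
      qed
    qed
    have in_L: "y \<in> L" "y' \<in> L" "?w \<in> L" using y y' S mixL by auto
    have "y = y' \<or> lt y y'"
      using 1 2 strict_wo_trans[OF wo, of y ?w y'] in_L by metis
    then show False
      using less strict_wo_trans[OF wo, of y y' y] strict_wo_irrefl[OF wo, of y] in_L by metis
  qed
qed

text \<open>Sequences that differ only in the first \<open>k\<close> places form, up to finitely many pieces, a box of \<open>k\<close>
  factors, each of which is a type-determined well-order on the letters \<open>X\<close>. Hence the exponents stay
  below \<open>\<omega>\<^sup>n\<close>.\<close>
lemma prefix_bounded:
  assumes "y0 \<in> L"
  shows "bounded_in (tuples_upto n) lt {y\<in>L. \<forall>i\<ge>k. y i = y0 i}"
  using assms
proof (induction k arbitrary: y0)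
  case 0
  have "{y\<in>L. \<forall>i\<ge>0. y i = y0 i} = {y0}" using 0 by auto
  moreover have "pow_bounded lt (\<lambda>_. 0) {y0}"
    by (rule pow_bounded_singleton) (use strict_wo_irrefl[OF wo 0] in simp)
  ultimately show ?case unfolding bounded_in_def by (intro bexI[of _ "\<lambda>_. 0"]) simp_all
next
  case (Suc k)
  let ?S = "{y\<in>L. \<forall>i\<ge>Suc k. y i = y0 i}"
  define P where "P q = {y\<in>?S. pr (pt y y) k = fst q \<and> Om (shift (pt y y) k) = snd q}" for q
  have "bounded_in (tuples_upto n) lt (P q)" for q
  proof (cases "P q = {}")
    case True
    then show ?thesis by (auto simp: bounded_in_def intro: pow_bounded.empty bexI[of _ "\<lambda>_. 0"])
  next
    case False
    then obtain y1 where y1: "y1 \<in> P q" by blast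
    then have y1L: "y1 \<in> L" by (simp add: P_def)
    have PL: "P q \<subseteq> L" by (auto simp: P_def)
    have mixL: "mix k u v \<in> L" if "u \<in> P q" "v \<in> P q" for u v
    proof -
      have "fst q \<cdot> snd q \<in> G" using Om_split[of "pt y1 y1" k] y1 by (auto simp: L_def P_def)
      moreover have "mix k u v \<in> Y" using that PL by (intro mix_Y L_Y) auto
      ultimately show ?thesis using Om_mix[of k u v u v] that by (simp add: L_def P_def)
    qed
    have "bounded_in (tuples_upto n) lt ((\<lambda>y. mix k y y1) ` P q)"
      by (rule bounded_in_subset[OF Suc.IH[OF y1L]]) (use y1 mixL in \<open>auto simp: mix_def[abs_def]\<close>)
    then obtain a where a: "a \<in> tuples_upto n" "pow_bounded lt a ((\<lambda>y. mix k y y1) ` P q)"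
      by (auto simp: bounded_in_def)
    define E where "E = Om (shift (pt y1 y1) (Suc k))"
    \<comment> \<open>With a common prefix and a common tail, a sequence is determined by its letter at \<open>k\<close>. The order of these
      letters is given by the sets of types that complete to \<open>F\<close> and \<open>G\<close> in this context.\<close>
    define w where "w c = y1(k := c)" for c
    have Om_w: "Om (pt (w c) (w d)) = pr (pt y1 y1) k \<cdot> (t c d \<cdot> E)" for c d
    proof -
      have "pr (pt (w c) (w d)) k = pr (pt y1 y1) k" by (rule pr_cong) (simp add: pt_def w_def)
      moreover have "shift (pt (w c) (w d)) (Suc k) = shift (pt y1 y1) (Suc k)"
        by (simp add: shift_def pt_def w_def)
      moreover have "pt (w c) (w d) k = t c d" by (simp add: pt_def w_def)
      ultimately show ?thesis using Om_split[of "pt (w c) (w d)" "Suc k"] by (simp add: E_def assoc)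
    qed
    have w_Y: "w c \<in> Y" if "c \<in> X" for c using that L_Y[OF y1L] by (simp add: w_def Y_def)
    define F' where "F' = {\<sigma>. pr (pt y1 y1) k \<cdot> (\<sigma> \<cdot> E) \<in> F}"
    define G' where "G' = {\<sigma>. pr (pt y1 y1) k \<cdot> (\<sigma> \<cdot> E) \<in> G}"
    have wL: "w c \<in> L" if "c \<in> X" "t c c \<in> G'" for c
      using that w_Y by (simp add: L_def Om_w G'_def)
    have lt_w: "lt (w c) (w d) \<longleftrightarrow> t c d \<in> F'" for c d by (simp add: lt_def Om_w F'_def)
    have "strict_wo {x\<in>X. t x x \<in> G'} (\<lambda>x y. t x y \<in> F')"
    proof (rule strict_wo_pullback[OF wo, of _ w])
      show "inj_on w {x\<in>X. t x x \<in> G'}" by (auto simp: inj_on_def w_def dest: fun_cong[of _ _ k])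
    qed (use wL lt_w in auto)
    then obtain b where b: "b \<in> tuples_upto n" "pow_bounded (\<lambda>x y. t x y \<in> F') b {x\<in>X. t x x \<in> G'}"
      using bounded unfolding type_bounded_def by blast
    have V: "pow_bounded lt b ((\<lambda>y. mix k y1 y) ` P q)"
    proof (rule pow_bounded_pullback[OF b(2), of _ "\<lambda>v. v k"])
      have mw: "mix k y1 y = w (y k)" if "y \<in> P q" for y
        using that y1 by (auto simp: mix_def w_def P_def fun_eq_iff not_less_eq_eq[symmetric] le_less_Suc_eq)
      have vw: "v = w (v k) \<and> v \<in> L" if v: "v \<in> (\<lambda>y. mix k y1 y) ` P q" for v
      proof -
        obtain y where y: "y \<in> P q" "v = mix k y1 y" using v by blast
        then have "v k = y k" by (simp add: mix_def)
        then show ?thesis using mw[OF y(1)] y mixL[OF y1 y(1)] by simp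
      qed
      show "v k \<in> {x\<in>X. t x x \<in> G'}" if v: "v \<in> (\<lambda>y. mix k y1 y) ` P q" for v
      proof -
        have "v \<in> L" "v = w (v k)" using vw[OF v] by auto
        then have "Om (pt (w (v k)) (w (v k))) \<in> G" "v k \<in> X" by (simp_all add: L_def Y_def)
        then show ?thesis by (simp add: Om_w G'_def)
      qed
      show "t (v k) (v' k) \<in> F'" if v: "v \<in> (\<lambda>y. mix k y1 y) ` P q" "v' \<in> (\<lambda>y. mix k y1 y) ` P q" "lt v v'" for v v'
      proof -
        have "v = w (v k)" "v' = w (v' k)" using vw[OF v(1)] vw[OF v(2)] by auto
        then have "lt (w (v k)) (w (v' k))" using v(3) by simp
        then show ?thesis by (simp add: lt_w)
      qed
    qed
    have "pow_bounded lt (\<lambda>i. a i + b i) (P q)"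
      by (rule cut_box[OF PL _ _ y1 a(1) b(1) a(2) V, of "fst q" "snd q"]) (auto simp: P_def)
    then show ?thesis unfolding bounded_in_def using tuples_upto_add[OF a(1) b(1)] by blast
  qed
  then have "bounded_in (tuples_upto n) lt (\<Union>q\<in>T1 \<times> T. P q)"
    using finite_T finite_T1 tuples_upto_nonempty by (intro bounded_in_finite_Union[of _ n]) auto
  moreover have "(\<Union>q\<in>T1 \<times> T. P q) = ?S"
  proof -
    have "pr (pt y y) k \<in> T1 \<and> Om (shift (pt y y) k) \<in> T" if "y \<in> L" for y
      using L_Y[OF that] by (auto intro!: pr_T Om_T pt_T simp: shift_apply)
    then show ?thesis by (auto simp: P_def)
  qed
  ultimately show ?case by simp
qed

text \<open>The exponents below \<open>\<omega>\<^sup>n * m\<close>.\<close>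
definition level :: "nat \<Rightarrow> (nat \<Rightarrow> nat) set" where
  "level m = {a\<in>tuples_upto (Suc n). a n < m}"

lemma level_mono: "m \<le> m' \<Longrightarrow> level m \<subseteq> level m'"
  by (auto simp: level_def)

lemma level_sub: "level m \<subseteq> tuples_upto (Suc n)"
  by (auto simp: level_def)

lemma level_nonempty: "0 < m \<Longrightarrow> level m \<noteq> {}"
  by (auto simp: level_def intro!: exI[of _ "\<lambda>_. 0"])

text \<open>The order has exponent at most \<open>\<omega>\<^sup>n * m\<close>, which is the first one after level \<open>m\<close>.\<close>
lemma segments_level:
  assumes "\<And>p. p \<in> S \<Longrightarrow> bounded_in (level m) lt' {y\<in>S. lt' y p}"
  shows "bounded_in (level (Suc m)) lt' S"
proof -
  define a where "a = (\<lambda>i. if i = n then m else 0)"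
  have a: "a \<in> level (Suc m)" by (simp add: a_def level_def tuples_upto_def)
  have "pow_bounded lt' a S"
  proof (rule pow_bounded.segments)
    fix p assume "p \<in> S"
    then obtain a' where a': "a' \<in> level m" "pow_bounded lt' a' {y\<in>S. lt' y p}"
      using assms bounded_in_def by blast
    have "a' \<sqsubset> a" by (rule colex_topI[of _ n]) (use a' a in \<open>auto simp: level_def a_def\<close>)
    then show "{y\<in>S. lt' y p} = {} \<or> (\<exists>a'. a' \<sqsubset> a \<and> pow_bounded lt' a' {y\<in>S. lt' y p})"
      using a'(2) by blast
  qed
  then show ?thesis using a by (auto simp: bounded_in_def)
qed

text \<open>Otherwise some tail class is not bounded by any level. For each \<open>m\<close> take its least element \<open>p\<close> below
  which it exceeds level \<open>m\<close>; the segment below \<open>p\<close> then has level exactly \<open>m + 1\<close>. Cut it at a place \<open>k\<close>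
  after which \<open>p\<close> coincides with the eventually periodic representative \<open>x\<close>. Prefixes have exponents
  below \<open>\<omega>\<^sup>n\<close>, which do not change the level, so the tails of one type \<open>q\<close> still exceed level \<open>m\<close>;
  and they are within level \<open>m + 1\<close>, because a fixed prefix puts them back below \<open>p\<close>. As \<open>k\<close> lies a
  multiple of the period after the point \<open>c\<close> where \<open>x\<close> becomes periodic, the tail of \<open>p\<close> is one fixed
  sequence \<open>\<xi>\<close>, and the order on the tails depends on \<open>q\<close> only. There are finitely many \<open>q\<close> but infinitely many \<open>m\<close>.\<close>
lemma order_bounded: "bounded_in (tuples_upto (Suc n)) lt L"
proof (rule ccontr)
  assume unb: "\<not> bounded_in (tuples_upto (Suc n)) lt L"
  define cls where "cls x = {y\<in>L. tail_eq y x}" for x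
  obtain x where x: "x \<in> L" and cls_unb: "\<And>m. \<not> bounded_in (level m) lt (cls x)"
  proof -
    obtain C where C: "finite C" "C \<subseteq> L" "\<forall>x\<in>L. \<exists>c\<in>C. tail_eq x c"
      using finite_tail_classes by (elim exE conjE)
    have "\<exists>x\<in>C. \<forall>m. \<not> bounded_in (level m) lt (cls x)"
    proof (rule ccontr)
      assume "\<not> ?thesis"
      then have "\<forall>x\<in>C. \<exists>m. bounded_in (level m) lt (cls x)" by blast
      then have "\<forall>x\<in>C. bounded_in (tuples_upto (Suc n)) lt (cls x)"
        using bounded_in_mono[OF _ level_sub] by blast
      then have "bounded_in (tuples_upto (Suc n)) lt (\<Union>c\<in>C. cls c)"
        using tuples_upto_nonempty C(1) by (intro bounded_in_finite_Union[of _ "Suc n"]) auto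
      moreover have "(\<Union>c\<in>C. cls c) = L" using C(3) by (auto simp: cls_def)
      ultimately show False using unb by simp
    qed
    then obtain x where "x \<in> C" "\<forall>m. \<not> bounded_in (level m) lt (cls x)" by (elim bexE)
    then show ?thesis using C(2) by (intro that[of x]) auto
  qed
  obtain c l where l: "0 < l" and per: "\<forall>i\<ge>c. x (i + l) = x i"
    using eventually_periodic[OF x] by (elim exE conjE)
  define \<xi> where "\<xi> = shift x c"
  have shift_x: "shift x (c + l * j) = \<xi>" for j
  proof (induction j)
    case (Suc j)
    have "x (c + l * Suc j + i) = x (c + l * j + i)" for i
      using per[rule_format, of "c + l * j + i"] by (simp add: algebra_simps)
    then show ?case using Suc by (simp add: shift_def)
  qed (simp add: \<xi>_def)
  \<comment> \<open>Here \<open>\<tau>\<close> is the type of the prefix, \<open>\<rho>\<close> that of the pair of the prefix and the prefix of \<open>p\<close>, and \<open>\<theta>\<close>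
    that of the tail: the conditions say that the combined sequence is in the domain and below \<open>p\<close>.\<close>
  define tails where "tails q = (case q of (\<tau>, \<rho>, \<theta>) \<Rightarrow>
     {v\<in>Y. tail_eq v \<xi> \<and> Om (pt v v) = \<theta> \<and> \<rho> \<cdot> Om (pt v \<xi>) \<in> F \<and> \<tau> \<cdot> \<theta> \<in> G})" for q
  define lt_at where "lt_at q v v' = (fst q \<cdot> Om (pt v v') \<in> F)" for q :: "'t \<times> 't \<times> 't" and v v'
  have key: "\<exists>q\<in>T1 \<times> T1 \<times> T. \<not> bounded_in (level m) (lt_at q) (tails q) \<and>
      bounded_in (level (Suc m)) (lt_at q) (tails q)" if m: "0 < m" for m
  proof -
    let ?C = "cls x"
    have CL: "?C \<subseteq> L" by (auto simp: cls_def)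
    let ?P = "{p\<in>?C. \<not> bounded_in (level m) lt {y\<in>?C. lt y p}}"
    have "?P \<noteq> {}" using segments_level[of ?C m lt] cls_unb[of "Suc m"] by blast
    moreover have "?P \<subseteq> L" using CL by auto
    ultimately obtain p where p: "p \<in> ?P" "\<forall>y\<in>?P. \<not> lt y p" using strict_wo_min[OF wo, of ?P] by meson
    have pC: "p \<in> ?C" and pL: "p \<in> L" and pY: "p \<in> Y" using p(1) CL L_Y by auto
    define S0 where "S0 = {y\<in>?C. lt y p}"
    have S0L: "S0 \<subseteq> L" using CL by (auto simp: S0_def)
    have S0_unb: "\<not> bounded_in (level m) lt S0" using p(1) by (simp add: S0_def)
    have S0_bd: "bounded_in (level (Suc m)) lt S0"
    proof (rule segments_level)
      fix q assume q: "q \<in> S0"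
      then have "bounded_in (level m) lt {y\<in>?C. lt y q}" using p(2) by (auto simp: S0_def)
      then show "bounded_in (level m) lt {y\<in>S0. lt y q}"
        by (rule bounded_in_subset) (auto simp: S0_def)
    qed
    obtain j where j: "\<And>i. j \<le> i \<Longrightarrow> p i = x i" using pC by (auto simp: cls_def tail_eq_def)
    define k where "k = c + l * j"
    have "j \<le> k" using l by (simp add: k_def trans_le_add2)
    then have shift_p: "shift p k = \<xi>"
      using j shift_x[of j] by (auto simp: shift_def k_def fun_eq_iff)
    have shift_xk: "shift x k = \<xi>" using shift_x[of j] by (simp add: k_def)
    define S where "S q = {y\<in>S0. pr (pt y y) k = fst q \<and> pr (pt y p) k = fst (snd q) \<and>
        Om (shift (pt y y) k) = snd (snd q)}" for q
    have "S0 = (\<Union>q\<in>T1 \<times> T1 \<times> T. S q)"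
    proof -
      have "pr (pt y y) k \<in> T1 \<and> pr (pt y p) k \<in> T1 \<and> Om (shift (pt y y) k) \<in> T" if "y \<in> S0" for y
        using L_Y[of y] that S0L pY by (auto intro!: pr_T Om_T pt_T simp: shift_apply)
      then show ?thesis by (auto simp: S_def)
    qed
    then have "\<not> (\<forall>q\<in>T1 \<times> T1 \<times> T. bounded_in (level m) lt (S q))"
      using S0_unb bounded_in_finite_Union[OF level_sub level_nonempty[OF m], of "T1 \<times> T1 \<times> T" lt S] finite_T finite_T1 by auto
    then obtain q where q: "q \<in> T1 \<times> T1 \<times> T" and Sq: "\<not> bounded_in (level m) lt (S q)" by blast
    obtain \<tau> \<rho> \<theta> where q_eq: "q = (\<tau>, \<rho>, \<theta>)" by (cases q) auto
    have "S q \<noteq> {}"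
      using Sq level_nonempty[OF m] by (auto simp: bounded_in_def pow_bounded.empty)
    then obtain y0 where y0: "y0 \<in> S q" by blast
    have SL: "S q \<subseteq> L" using S0L by (auto simp: S_def)
    have y0L: "y0 \<in> L" using y0 SL by blast
    then have y0Y: "y0 \<in> Y" by (rule L_Y)
    have G: "\<tau> \<cdot> \<theta> \<in> G" using Om_split[of "pt y0 y0" k] y0 y0L by (auto simp: L_def S_def q_eq)
    have mixL: "mix k u v \<in> L" if "u \<in> S q" "v \<in> S q" for u v
    proof -
      have "mix k u v \<in> Y" using that SL by (intro mix_Y L_Y) auto
      then show ?thesis using Om_mix[of k u v u v] that G by (simp add: L_def S_def q_eq)
    qed
    have V_unb: "\<not> bounded_in (level m) lt ((\<lambda>y. mix k y0 y) ` S q)"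
    proof
      assume "bounded_in (level m) lt ((\<lambda>y. mix k y0 y) ` S q)"
      then obtain b where b: "b \<in> level m" "pow_bounded lt b ((\<lambda>y. mix k y0 y) ` S q)" by (auto simp: bounded_in_def)
      have "bounded_in (tuples_upto n) lt ((\<lambda>y. mix k y y0) ` S q)"
        by (rule bounded_in_subset[OF prefix_bounded[OF y0L, of k]]) (use y0 mixL in \<open>auto simp: mix_def[abs_def]\<close>)
      then obtain a where a: "a \<in> tuples_upto n" "pow_bounded lt a ((\<lambda>y. mix k y y0) ` S q)" by (auto simp: bounded_in_def)
      have a': "a \<in> tuples_upto (Suc n)" "a n = 0" using a(1) by (auto simp: tuples_upto_def)
      have b': "b \<in> tuples_upto (Suc n)" "b n < m" using b(1) by (auto simp: level_def)
      have "pow_bounded lt (\<lambda>i. a i + b i) (S q)"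
        by (rule cut_box[OF SL _ _ y0 a'(1) b'(1) a(2) b(2), of \<tau> \<theta>]) (auto simp: S_def q_eq)
      moreover have "(\<lambda>i. a i + b i) \<in> level m" using tuples_upto_add[OF a'(1) b'(1)] a' b' by (simp add: level_def)
      ultimately show False using Sq by (auto simp: bounded_in_def)
    qed
    have unb_q: "\<not> bounded_in (level m) (lt_at q) (tails q)"
    proof
      assume bd: "bounded_in (level m) (lt_at q) (tails q)"
      have "bounded_in (level m) lt ((\<lambda>y. mix k y0 y) ` S q)"
      proof (rule bounded_in_pullback[OF bd, of _ "\<lambda>v. shift v k"])
        show "shift v k \<in> tails q" if v: "v \<in> (\<lambda>y. mix k y0 y) ` S q" for v
        proof -
          obtain y where y: "y \<in> S q" "v = mix k y0 y" using v by blast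
          have vy: "shift v k = shift y k" by (simp add: y shift_def mix_def)
          have yL: "y \<in> L" using y SL by blast
          have 1: "shift y k \<in> Y" using L_Y[OF yL] by (simp add: Y_def shift_def)
          obtain i0 where "\<forall>i\<ge>i0. y i = x i" using y by (auto simp: S_def S0_def cls_def tail_eq_def)
          then have "\<forall>i\<ge>i0. shift y k i = shift x k i" by (simp add: shift_def)
          then have 2: "tail_eq (shift y k) \<xi>" unfolding tail_eq_def shift_xk by blast
          have 3: "Om (pt (shift y k) (shift y k)) = \<theta>"
          proof -
            have "pt (shift y k) (shift y k) = shift (pt y y) k" by (simp add: pt_def shift_def)
            then show ?thesis using y by (simp add: S_def q_eq)
          qed
          have 4: "\<rho> \<cdot> Om (pt (shift y k) \<xi>) \<in> F"
          proof -
            have "pt (shift y k) \<xi> = shift (pt y p) k" unfolding shift_p[symmetric] by (simp add: pt_def shift_def)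
            moreover have "Om (pt y p) \<in> F" using y by (simp add: S_def S0_def lt_def)
            ultimately show ?thesis using y Om_split[of "pt y p" k] by (simp add: S_def q_eq)
          qed
          show ?thesis using 1 2 3 4 G by (simp add: vy tails_def q_eq)
        qed
        show "lt_at q (shift v k) (shift v' k)"
          if v: "v \<in> (\<lambda>y. mix k y0 y) ` S q" "v' \<in> (\<lambda>y. mix k y0 y) ` S q" "lt v v'" for v v'
        proof -
          have "pr (pt v v') k = pr (pt y0 y0) k" using v by (intro pr_cong) (auto simp: pt_def mix_def)
          moreover have "pr (pt y0 y0) k = \<tau>" using y0 by (simp add: S_def q_eq)
          moreover have "pt (shift v k) (shift v' k) = shift (pt v v') k" by (simp add: pt_def shift_def)
          ultimately show ?thesis using v(3) Om_split[of "pt v v'" k] by (simp add: lt_def lt_at_def q_eq)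
        qed
      qed
      then show False using V_unb by blast
    qed
    have "bounded_in (level (Suc m)) (lt_at q) (tails q)"
    proof (rule bounded_in_pullback[OF S0_bd, of _ "\<lambda>v. mix k y0 (\<lambda>i. v (i - k))"])
      have Om_glue: "Om (pt (mix k y0 (\<lambda>i. v (i - k))) (mix k y (\<lambda>i. v' (i - k)))) = pr (pt y0 y) k \<cdot> Om (pt v v')"
        for v v' y
      proof -
        have "shift (pt (\<lambda>i. v (i - k)) (\<lambda>i. v' (i - k))) k = pt v v'" by (simp add: pt_def shift_def)
        then show ?thesis using Om_mix[of k y0 "\<lambda>i. v (i - k)" y "\<lambda>i. v' (i - k)"] by simp
      qed
      have \<tau>: "pr (pt y0 y0) k = \<tau>" and \<rho>: "pr (pt y0 p) k = \<rho>" using y0 by (simp_all add: S_def q_eq)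
      show "mix k y0 (\<lambda>i. v (i - k)) \<in> S0" (is "?v \<in> S0") if v: "v \<in> tails q" for v
      proof -
        have vY: "v \<in> Y" using v by (simp add: tails_def q_eq)
        have 1: "?v \<in> Y" using y0Y vY by (simp add: Y_def mix_def)
        have "Om (pt ?v ?v) = \<tau> \<cdot> \<theta>" using Om_glue[of v y0 v] \<tau> v by (simp add: tails_def q_eq)
        then have 2: "?v \<in> L" using 1 G by (simp add: L_def)
        obtain i0 where i0: "\<forall>i\<ge>i0. v i = \<xi> i" using v by (auto simp: tails_def q_eq tail_eq_def)
        have "?v i = x i" if "k + i0 \<le> i" for i
        proof -
          have "v (i - k) = \<xi> (i - k)" using i0 that by simp
          also have "\<dots> = x i" unfolding shift_xk[symmetric] using that by (simp add: shift_def)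
          finally show ?thesis using that by (simp add: mix_def)
        qed
        then have 3: "tail_eq ?v x" unfolding tail_eq_def by blast
        have "mix k p (\<lambda>i. \<xi> (i - k)) = p"
          unfolding shift_p[symmetric] by (auto simp: mix_def shift_def)
        then have "Om (pt ?v p) = \<rho> \<cdot> Om (pt v \<xi>)" using Om_glue[of v p \<xi>] \<rho> by simp
        then have "lt ?v p" using v by (simp add: lt_def tails_def q_eq)
        then show ?thesis using 2 3 by (simp add: S0_def cls_def)
      qed
      show "lt (mix k y0 (\<lambda>i. v (i - k))) (mix k y0 (\<lambda>i. v' (i - k)))" if "lt_at q v v'" for v v'
        using that Om_glue[of v y0 v'] \<tau> by (simp add: lt_def lt_at_def q_eq)
    qed
    then show ?thesis using q unb_q by blast
  qed
  then have "\<forall>m. \<exists>q\<in>T1 \<times> T1 \<times> T. \<not> bounded_in (level (Suc m)) (lt_at q) (tails q) \<and>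
      bounded_in (level (Suc (Suc m))) (lt_at q) (tails q)" by blast
  then obtain Q where Q: "\<And>m. Q m \<in> T1 \<times> T1 \<times> T"
    "\<And>m. \<not> bounded_in (level (Suc m)) (lt_at (Q m)) (tails (Q m))"
    "\<And>m. bounded_in (level (Suc (Suc m))) (lt_at (Q m)) (tails (Q m))" by metis
  have "range Q \<subseteq> T1 \<times> T1 \<times> T" using Q(1) by blast
  then have "finite (range Q)" using finite_T finite_T1 by (meson finite_SigmaI finite_subset)
  then have "\<not> inj Q" using finite_imageD[of Q UNIV] by auto
  then obtain m m' where mm: "Q m = Q m'" "m < m'" unfolding inj_def by (metis linorder_neqE_nat)
  have "bounded_in (level (Suc m')) (lt_at (Q m)) (tails (Q m))"
    by (rule bounded_in_mono[OF Q(3) level_mono]) (use mm in simp)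
  then show False using Q(2)[of m'] mm by simp
qed

end

theorem type_bounded_omega_words:
  fixes mult :: "'t \<Rightarrow> 't \<Rightarrow> 't" and t :: "'x \<Rightarrow> 'x \<Rightarrow> 't"
  assumes "omega_monoid mult one Om T" and "\<And>x y. x \<in> X \<Longrightarrow> y \<in> X \<Longrightarrow> t x y \<in> T"
    and "type_bounded n X t"
  shows "type_bounded (Suc n) {x. \<forall>i. x i \<in> X} (\<lambda>x y. Om (\<lambda>i. t (x i) (y i)))"
  unfolding type_bounded_def
proof (intro allI impI)
  fix F G
  assume "strict_wo {x \<in> {x. \<forall>i. x i \<in> X}. Om (\<lambda>i. t (x i) (x i)) \<in> G} (\<lambda>x y. Om (\<lambda>i. t (x i) (y i)) \<in> F)"
  then interpret typed_order mult one Om T n X t F G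
    using assms by (auto simp: typed_order_def typed_order_axioms_def)
  show "\<exists>a\<in>tuples_upto (Suc n). pow_bounded (\<lambda>x y. Om (\<lambda>i. t (x i) (y i)) \<in> F) a
      {x \<in> {x. \<forall>i. x i \<in> X}. Om (\<lambda>i. t (x i) (x i)) \<in> G}"
    using order_bounded unfolding bounded_in_def L_def lt_def[abs_def] Y_def pt_def by simp
qed

section \<open>Types of runs\<close>

text \<open>A triple \<open>(q, P, q')\<close> stands for a run from \<open>q\<close> to \<open>q'\<close> whose states before the end are those in \<open>P\<close>.
  The sets \<open>P\<close> are needed for limit transitions: the states that occur cofinally before the limit of
  infinitely many runs are those that lie in infinitely many of the sets.\<close>
type_synonym 'q run_type = "('q \<times> 'q set \<times> 'q) set"

definition rt_mult :: "'q run_type \<Rightarrow> 'q run_type \<Rightarrow> 'q run_type" where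
  "rt_mult a b = {(q, P \<union> P', q'') | q P q' P' q''. (q, P, q') \<in> a \<and> (q', P', q'') \<in> b}"

definition rt_one :: "'q run_type" where
  "rt_one = {(q, {}, q) | q. True}"

definition limsup_sets :: "(nat \<Rightarrow> 'q set) \<Rightarrow> 'q set" where
  "limsup_sets Ps = {q. \<forall>m. \<exists>i\<ge>m. q \<in> Ps i}"

definition rt_omega :: "('q set \<times> 'q) set \<Rightarrow> (nat \<Rightarrow> 'q run_type) \<Rightarrow> 'q run_type" where
  "rt_omega \<gamma> s = {(q, P, q'). \<exists>qs Ps. qs 0 = q \<and> (\<forall>i. (qs i, Ps i, qs (Suc i)) \<in> s i) \<and>
     P = (\<Union>i. Ps i) \<and> (limsup_sets Ps, q') \<in> \<gamma>}"

lemma partial_prod_rt: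
  "(q, P, q') \<in> partial_prod rt_mult rt_one s k \<longleftrightarrow>
     (\<exists>qs Ps. qs 0 = q \<and> qs k = q' \<and> (\<forall>i<k. (qs i, Ps i, qs (Suc i)) \<in> s i) \<and> P = (\<Union>i<k. Ps i))"
proof (induction k arbitrary: P q')
  case 0
  show ?case by (auto simp: rt_one_def)
next
  case (Suc k)
  show ?case
  proof
    assume "(q, P, q') \<in> partial_prod rt_mult rt_one s (Suc k)"
    then obtain P1 q1 P2 where 1: "(q, P1, q1) \<in> partial_prod rt_mult rt_one s k" "(q1, P2, q') \<in> s k" "P = P1 \<union> P2"
      by (auto simp: rt_mult_def)
    then obtain qs Ps where 2: "qs 0 = q" "qs k = q1" "\<forall>i<k. (qs i, Ps i, qs (Suc i)) \<in> s i" "P1 = (\<Union>i<k. Ps i)"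
      using Suc.IH[of P1 q1] by (elim iffD1[THEN exE] exE conjE) auto
    have "(\<Union>i<Suc k. (Ps(k := P2)) i) = P"
      using 1 2 by (auto simp: lessThan_Suc)
    then show "\<exists>qs Ps. qs 0 = q \<and> qs (Suc k) = q' \<and> (\<forall>i<Suc k. (qs i, Ps i, qs (Suc i)) \<in> s i) \<and> P = (\<Union>i<Suc k. Ps i)"
      using 1 2 by (intro exI[of _ "qs(Suc k := q')"] exI[of _ "Ps(k := P2)"]) (auto simp: less_Suc_eq)
  next
    assume "\<exists>qs Ps. qs 0 = q \<and> qs (Suc k) = q' \<and> (\<forall>i<Suc k. (qs i, Ps i, qs (Suc i)) \<in> s i) \<and> P = (\<Union>i<Suc k. Ps i)"
    then obtain qs Ps where 2: "qs 0 = q" "qs (Suc k) = q'" "\<forall>i<Suc k. (qs i, Ps i, qs (Suc i)) \<in> s i" "P = (\<Union>i<Suc k. Ps i)"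
      by (elim exE conjE)
    then have "(q, (\<Union>i<k. Ps i), qs k) \<in> partial_prod rt_mult rt_one s k"
      unfolding Suc.IH by (intro exI[of _ qs] exI[of _ Ps]) auto
    moreover have "P = (\<Union>i<k. Ps i) \<union> Ps k" using 2 by (auto simp: lessThan_Suc)
    moreover have "(qs k, Ps k, q') \<in> s k" using 2 by auto
    ultimately show "(q, P, q') \<in> partial_prod rt_mult rt_one s (Suc k)" by (auto simp: rt_mult_def)
  qed
qed

definition block_of :: "(nat \<Rightarrow> nat) \<Rightarrow> nat \<Rightarrow> nat" where
  "block_of k p = (LEAST i. p < k (Suc i))"

lemma block_of:
  assumes k: "strict_mono k" "k 0 = 0"
  shows "k (block_of k p) \<le> p" "p < k (Suc (block_of k p))"
    and "k i \<le> p \<Longrightarrow> p < k (Suc i) \<Longrightarrow> block_of k p = i"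
proof -
  have "Suc p \<le> k (Suc p)" using k(1) by (rule strict_mono_imp_increasing)
  then have "p < k (Suc p)" by simp
  then show "p < k (Suc (block_of k p))" unfolding block_of_def by (rule LeastI)
  show "k (block_of k p) \<le> p"
  proof (cases "block_of k p")
    case (Suc j)
    then have "\<not> p < k (Suc j)" unfolding block_of_def by (intro not_less_Least) simp
    then show ?thesis using Suc by simp
  qed (simp add: k)
  show "block_of k p = i" if "k i \<le> p" "p < k (Suc i)"
    unfolding block_of_def
  proof (rule Least_equality)
    show "i \<le> y" if "p < k (Suc y)" for y
    proof (rule ccontr)
      assume "\<not> i \<le> y"
      then have "k (Suc y) \<le> k i" using k(1) by (simp add: strict_mono_less_eq)
      then show False using that \<open>k i \<le> p\<close> by simp
    qed
  qed (rule that)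
qed

lemma blocks_sets:
  assumes k: "strict_mono k" "k 0 = 0"
  shows "(\<Union>i. \<Union>j<k (Suc i) - k i. Ps (k i + j)) = (\<Union>p. Ps p)" (is ?U)
    and "limsup_sets (\<lambda>i. \<Union>j<k (Suc i) - k i. Ps (k i + j)) = limsup_sets Ps" (is ?L)
proof -
  have in_block: "\<exists>j<k (Suc (block_of k p)) - k (block_of k p). p = k (block_of k p) + j" for p
    using block_of(1,2)[OF k, of p] by (intro exI[of _ "p - k (block_of k p)"]) auto
  show ?U
  proof (intro equalityI subsetI)
    fix q assume "q \<in> (\<Union>p. Ps p)"
    then obtain p where "q \<in> Ps p" by (elim UN_E)
    moreover obtain j where "j < k (Suc (block_of k p)) - k (block_of k p)" "p = k (block_of k p) + j"
      using in_block[of p] by (elim exE conjE)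
    ultimately have "q \<in> (\<Union>j<k (Suc (block_of k p)) - k (block_of k p). Ps (k (block_of k p) + j))"
      by (intro UN_I[of j]) simp_all
    then show "q \<in> (\<Union>i. \<Union>j<k (Suc i) - k i. Ps (k i + j))" by (rule UN_I[OF UNIV_I])
  qed (elim UN_E, rule UN_I[OF UNIV_I])
  show ?L
  proof (intro set_eqI iffI)
    fix q assume q: "q \<in> limsup_sets Ps"
    show "q \<in> limsup_sets (\<lambda>i. \<Union>j<k (Suc i) - k i. Ps (k i + j))"
      unfolding limsup_sets_def mem_Collect_eq
    proof
      fix m
      obtain p where p: "k m \<le> p" "q \<in> Ps p" using q by (auto simp: limsup_sets_def)
      have "k m < k (Suc (block_of k p))" using p(1) block_of(2)[OF k, of p] by simp
      then have "m \<le> block_of k p" using k(1) by (simp add: strict_mono_less)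
      moreover have "q \<in> (\<Union>j<k (Suc (block_of k p)) - k (block_of k p). Ps (k (block_of k p) + j))"
      proof -
        obtain j where "j < k (Suc (block_of k p)) - k (block_of k p)" "p = k (block_of k p) + j"
          using in_block[of p] by (elim exE conjE)
        then show ?thesis using p(2) by (intro UN_I[of j]) simp_all
      qed
      ultimately show "\<exists>i\<ge>m. q \<in> (\<Union>j<k (Suc i) - k i. Ps (k i + j))" by blast
    qed
  next
    fix q assume q: "q \<in> limsup_sets (\<lambda>i. \<Union>j<k (Suc i) - k i. Ps (k i + j))"
    show "q \<in> limsup_sets Ps"
      unfolding limsup_sets_def mem_Collect_eq
    proof
      fix m
      have "\<exists>i\<ge>m. q \<in> (\<Union>j<k (Suc i) - k i. Ps (k i + j))"
        using q by (simp only: limsup_sets_def mem_Collect_eq)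
      then obtain i j where i: "m \<le> i" "q \<in> Ps (k i + j)" by (elim exE conjE UN_E)
      have "i \<le> k i" using k(1) by (rule strict_mono_imp_increasing)
      then show "\<exists>p\<ge>m. q \<in> Ps p" using i by (intro exI[of _ "k i + j"]) simp
    qed
  qed
qed

lemma limsup_sets_Suc: "limsup_sets (\<lambda>i. Ps (Suc i)) = limsup_sets Ps"
proof (intro set_eqI iffI)
  fix q assume q: "q \<in> limsup_sets (\<lambda>i. Ps (Suc i))"
  have "\<exists>i\<ge>m. q \<in> Ps i" for m
  proof -
    obtain i where "m \<le> i" "q \<in> Ps (Suc i)" using q by (auto simp: limsup_sets_def)
    then show ?thesis by (intro exI[of _ "Suc i"]) simp
  qed
  then show "q \<in> limsup_sets Ps" by (simp add: limsup_sets_def)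
next
  fix q assume q: "q \<in> limsup_sets Ps"
  have "\<exists>i\<ge>m. q \<in> Ps (Suc i)" for m
  proof -
    have "\<exists>i\<ge>Suc m. q \<in> Ps i" using q by (simp only: limsup_sets_def mem_Collect_eq)
    then obtain i where "Suc m \<le> i" "q \<in> Ps i" by (elim exE conjE)
    then show ?thesis by (intro exI[of _ "i - 1"]) simp
  qed
  then show "q \<in> limsup_sets (\<lambda>i. Ps (Suc i))" by (simp add: limsup_sets_def)
qed

lemma UN_nat_Suc: "(\<Union>i::nat. f i) = f 0 \<union> (\<Union>i. f (Suc i))"
proof (intro equalityI subsetI)
  fix x assume "x \<in> (\<Union>i. f i)"
  then obtain i where "x \<in> f i" by blast
  then show "x \<in> f 0 \<union> (\<Union>i. f (Suc i))" by (cases i) auto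
qed auto

text \<open>The law of factorisation holds because a sequence of runs can be regrouped into blocks, and,
  conversely, runs through the blocks can be glued; finite blocks do not affect which
  states occur infinitely often.\<close>
lemma omega_monoid_run_types:
  assumes Q: "finite Q" and \<gamma>: "\<gamma> \<subseteq> Pow Q \<times> Q"
  shows "omega_monoid rt_mult rt_one (rt_omega \<gamma>) (Pow (Q \<times> Pow Q \<times> Q))"
proof
  show "rt_mult (rt_mult a b) c = rt_mult a (rt_mult b c)" for a b c :: "'a run_type"
    unfolding rt_mult_def by (auto simp: Un_assoc) (metis Un_assoc)+
  show "rt_mult rt_one a = a" "rt_mult a rt_one = a" for a :: "'a run_type"
    by (auto simp: rt_mult_def rt_one_def)
  show "finite (Pow (Q \<times> Pow Q \<times> Q))" using Q by simp
  show "rt_mult a b \<in> Pow (Q \<times> Pow Q \<times> Q)" if "a \<in> Pow (Q \<times> Pow Q \<times> Q)" "b \<in> Pow (Q \<times> Pow Q \<times> Q)" for a b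
    using that by (auto simp: rt_mult_def)
  show "rt_omega \<gamma> s \<in> Pow (Q \<times> Pow Q \<times> Q)" if s: "\<And>i. s i \<in> Pow (Q \<times> Pow Q \<times> Q)" for s
  proof
    show "rt_omega \<gamma> s \<subseteq> Q \<times> Pow Q \<times> Q"
    proof
      fix z assume "z \<in> rt_omega \<gamma> s"
      then obtain qs Ps q' where z: "z = (qs 0, (\<Union>i. Ps i), q')" "\<And>i. (qs i, Ps i, qs (Suc i)) \<in> s i" "(limsup_sets Ps, q') \<in> \<gamma>"
        by (auto simp: rt_omega_def)
      have "qs i \<in> Q \<and> Ps i \<subseteq> Q" for i using z(2)[of i] s[of i] by blast
      then show "z \<in> Q \<times> Pow Q \<times> Q" using z \<gamma> by auto
    qed
  qed
  show "rt_omega \<gamma> s = rt_mult (s 0) (rt_omega \<gamma> (\<lambda>i. s (Suc i)))" for s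
  proof (intro set_eqI iffI)
    fix z assume "z \<in> rt_omega \<gamma> s"
    then obtain qs Ps q' where z: "z = (qs 0, (\<Union>i. Ps i), q')" "\<And>i. (qs i, Ps i, qs (Suc i)) \<in> s i" "(limsup_sets Ps, q') \<in> \<gamma>"
      by (auto simp: rt_omega_def)
    have "(qs 1, (\<Union>i. Ps (Suc i)), q') \<in> rt_omega \<gamma> (\<lambda>i. s (Suc i))"
      unfolding rt_omega_def using z limsup_sets_Suc[of Ps]
      by (auto intro!: exI[of _ "\<lambda>i. qs (Suc i)"] exI[of _ "\<lambda>i. Ps (Suc i)"])
    moreover have "(\<Union>i. Ps i) = Ps 0 \<union> (\<Union>i. Ps (Suc i))" by (rule UN_nat_Suc)
    ultimately show "z \<in> rt_mult (s 0) (rt_omega \<gamma> (\<lambda>i. s (Suc i)))"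
      using z(2)[of 0] unfolding rt_mult_def z(1) by auto
  next
    fix z assume "z \<in> rt_mult (s 0) (rt_omega \<gamma> (\<lambda>i. s (Suc i)))"
    then obtain q P qs Ps q' where z: "z = (q, P \<union> (\<Union>i. Ps i), q')" "(q, P, qs 0) \<in> s 0"
      "\<And>i. (qs i, Ps i, qs (Suc i)) \<in> s (Suc i)" "(limsup_sets Ps, q') \<in> \<gamma>"
      by (auto simp: rt_omega_def rt_mult_def)
    have "limsup_sets (case_nat P Ps) = limsup_sets Ps"
      using limsup_sets_Suc[of "case_nat P Ps"] by simp
    moreover have "(\<Union>i. case_nat P Ps i) = P \<union> (\<Union>i. Ps i)"
      using UN_nat_Suc[of "case_nat P Ps"] by simp
    moreover have "(case_nat q qs i, case_nat P Ps i, case_nat q qs (Suc i)) \<in> s i" for i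
      using z by (cases i) auto
    ultimately show "z \<in> rt_omega \<gamma> s"
      unfolding rt_omega_def using z by (auto intro!: exI[of _ "case_nat q qs"] exI[of _ "case_nat P Ps"])
  qed
  show "rt_omega \<gamma> s = rt_omega \<gamma> (\<lambda>i. partial_prod rt_mult rt_one (shift s (k i)) (k (Suc i) - k i))"
    if k: "strict_mono k" "k 0 = 0" for k s
  proof (intro set_eqI iffI)
    have len: "k i < k (Suc i)" for i using k(1) by (simp add: strict_mono_less)
    fix z assume "z \<in> rt_omega \<gamma> s"
    then obtain qs Ps q' where z: "z = (qs 0, (\<Union>i. Ps i), q')" "\<And>i. (qs i, Ps i, qs (Suc i)) \<in> s i" "(limsup_sets Ps, q') \<in> \<gamma>"
      by (auto simp: rt_omega_def)
    define Ps' where "Ps' i = (\<Union>j<k (Suc i) - k i. Ps (k i + j))" for i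
    have "(qs (k i), Ps' i, qs (k (Suc i))) \<in> partial_prod rt_mult rt_one (shift s (k i)) (k (Suc i) - k i)" for i
      unfolding partial_prod_rt
      using z(2) len[of i] by (intro exI[of _ "\<lambda>j. qs (k i + j)"] exI[of _ "\<lambda>j. Ps (k i + j)"]) (auto simp: Ps'_def shift_apply)
    moreover have "(\<Union>i. Ps' i) = (\<Union>i. Ps i)" "limsup_sets Ps' = limsup_sets Ps"
      unfolding Ps'_def by (rule blocks_sets[OF k])+
    ultimately show "z \<in> rt_omega \<gamma> (\<lambda>i. partial_prod rt_mult rt_one (shift s (k i)) (k (Suc i) - k i))"
      unfolding rt_omega_def using z k(2) by (auto intro!: exI[of _ "\<lambda>i. qs (k i)"] exI[of _ Ps'])
  next
    have len: "k i < k (Suc i)" for i using k(1) by (simp add: strict_mono_less)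
    fix z assume "z \<in> rt_omega \<gamma> (\<lambda>i. partial_prod rt_mult rt_one (shift s (k i)) (k (Suc i) - k i))"
    then obtain qs' Ps' q' where z: "z = (qs' 0, (\<Union>i. Ps' i), q')"
      "\<And>i. (qs' i, Ps' i, qs' (Suc i)) \<in> partial_prod rt_mult rt_one (shift s (k i)) (k (Suc i) - k i)" "(limsup_sets Ps', q') \<in> \<gamma>"
      by (auto simp: rt_omega_def)
    have "\<forall>i. \<exists>A B. A 0 = qs' i \<and> A (k (Suc i) - k i) = qs' (Suc i) \<and>
        (\<forall>j<k (Suc i) - k i. (A j, B j, A (Suc j)) \<in> shift s (k i) j) \<and> Ps' i = (\<Union>j<k (Suc i) - k i. B j)"
      by (rule allI) (rule z(2)[unfolded partial_prod_rt])
    from choice[OF this] obtain A where "\<forall>i. \<exists>B. A i 0 = qs' i \<and> A i (k (Suc i) - k i) = qs' (Suc i) \<and>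
        (\<forall>j<k (Suc i) - k i. (A i j, B j, A i (Suc j)) \<in> shift s (k i) j) \<and> Ps' i = (\<Union>j<k (Suc i) - k i. B j)" ..
    from choice[OF this] obtain B where AB0: "\<forall>i. A i 0 = qs' i \<and> A i (k (Suc i) - k i) = qs' (Suc i) \<and>
        (\<forall>j<k (Suc i) - k i. (A i j, B i j, A i (Suc j)) \<in> shift s (k i) j) \<and> Ps' i = (\<Union>j<k (Suc i) - k i. B i j)" ..
    then have AB: "\<And>i. A i 0 = qs' i" "\<And>i. A i (k (Suc i) - k i) = qs' (Suc i)"
       "\<And>i j. j < k (Suc i) - k i \<Longrightarrow> (A i j, B i j, A i (Suc j)) \<in> shift s (k i) j" "\<And>i. Ps' i = (\<Union>j<k (Suc i) - k i. B i j)"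
      by simp_all
    define qs where "qs p = A (block_of k p) (p - k (block_of k p))" for p
    define Ps where "Ps p = B (block_of k p) (p - k (block_of k p))" for p
    have blk: "block_of k (k i + j) = i" if "j < k (Suc i) - k i" for i j
      using block_of(3)[OF k, of i "k i + j"] that by simp
    have Ps': "Ps' = (\<lambda>i. \<Union>j<k (Suc i) - k i. Ps (k i + j))"
      unfolding AB(4) Ps_def by (intro ext SUP_cong) (auto simp: blk)
    have "(qs p, Ps p, qs (Suc p)) \<in> s p" for p
    proof -
      let ?b = "block_of k p" and ?j = "p - k (block_of k p)"
      have b: "k ?b \<le> p" "p < k (Suc ?b)" using block_of(1,2)[OF k] by auto
      have "(A ?b ?j, B ?b ?j, A ?b (Suc ?j)) \<in> shift s (k ?b) ?j" using b by (intro AB(3)) auto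
      moreover have "A ?b (Suc ?j) = qs (Suc p)"
      proof (cases "Suc p < k (Suc ?b)")
        case True
        then have "block_of k (Suc p) = ?b" using b by (intro block_of(3)[OF k]) auto
        then show ?thesis using b by (simp add: qs_def Suc_diff_le)
      next
        case False
        then have p: "Suc p = k (Suc ?b)" using b by simp
        have "block_of k (Suc p) = Suc ?b" using p len[of "Suc ?b"] by (intro block_of(3)[OF k]) auto
        then have "qs (Suc p) = qs' (Suc ?b)" using p by (simp add: qs_def AB(1))
        moreover have "Suc ?j = k (Suc ?b) - k ?b" using p b by simp
        ultimately show ?thesis using AB(2) by simp
      qed
      ultimately show ?thesis using b by (simp add: qs_def Ps_def shift_apply)
    qed
    moreover have "(\<Union>i. Ps' i) = (\<Union>i. Ps i)" "limsup_sets Ps' = limsup_sets Ps"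
      unfolding Ps' by (rule blocks_sets[OF k])+
    moreover have "qs 0 = qs' 0"
      using blk[of 0 0] len[of 0] k(2) by (simp add: qs_def AB(1))
    ultimately show "z \<in> rt_omega \<gamma> s"
      unfolding rt_omega_def using z by (auto intro!: exI[of _ qs] exI[of _ Ps])
  qed
qed

section \<open>Runs on words indexed by tuples\<close>
text \<open>The positions of a run on a word of length \<open>\<omega>\<^sup>n\<close>, with \<open>unit_at n\<close> as the position after the word.
  Limit positions are the nonzero ones with \<open>f 0 = 0\<close>, and every other nonzero position is a successor.\<close>
definition positions_le :: "nat \<Rightarrow> (nat \<Rightarrow> nat) set" where
  "positions_le n = insert (unit_at n) (tuples_upto n)"

definition next_pos :: "(nat \<Rightarrow> nat) \<Rightarrow> nat \<Rightarrow> nat" where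
  "next_pos f = f(0 := Suc (f 0))"

definition inf_before :: "((nat \<Rightarrow> nat) \<Rightarrow> 'q) \<Rightarrow> (nat \<Rightarrow> nat) \<Rightarrow> 'q set" where
  "inf_before x f = {q. \<forall>\<mu>. \<mu> \<sqsubset> f \<longrightarrow> (\<exists>\<nu>. \<mu> \<sqsubset> \<nu> \<and> \<nu> \<sqsubset> f \<and> x \<nu> = q)}"

definition run_seg :: "('q \<times> 'l \<times> 'q) set \<Rightarrow> ('q set \<times> 'q) set \<Rightarrow> nat \<Rightarrow> ((nat \<Rightarrow> nat) \<Rightarrow> 'l) \<Rightarrow> ((nat \<Rightarrow> nat) \<Rightarrow> 'q) \<Rightarrow> bool" where
  "run_seg \<Delta> \<gamma> n w x \<longleftrightarrow>
     (\<forall>f\<in>tuples_upto n. (x f, w f, x (next_pos f)) \<in> \<Delta>) \<and>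
     (\<forall>f\<in>positions_le n. f \<noteq> (\<lambda>_. 0) \<longrightarrow> f 0 = 0 \<longrightarrow> (inf_before x f, x f) \<in> \<gamma>)"

text \<open>The position \<open>\<omega>\<^sup>n * i + f\<close>.\<close>
definition in_block :: "nat \<Rightarrow> nat \<Rightarrow> (nat \<Rightarrow> nat) \<Rightarrow> nat \<Rightarrow> nat" where
  "in_block n i f = f(n := f n + i)"

lemma in_block_less [simp]: "in_block n i f \<sqsubset> in_block n i g \<longleftrightarrow> f \<sqsubset> g"
  unfolding topdiff_less_def in_block_def by (intro iff_exI) auto

lemma tuples_upto_Suc: "f \<in> tuples_upto n \<Longrightarrow> f \<in> tuples_upto (Suc n)"
  using tuples_upto_mono[of n "Suc n"] by auto

lemma unit_at_Suc: "unit_at n \<in> tuples_upto (Suc n)"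
  by (simp add: unit_at_def tuples_upto_def)

lemma less_unit_at_iff: "f \<sqsubset> unit_at n \<longleftrightarrow> f \<in> tuples_upto n"
proof
  assume f: "f \<sqsubset> unit_at n"
  then obtain b where b: "f b < unit_at n b" "\<And>c. b < c \<Longrightarrow> f c = unit_at n c"
    by (auto simp: topdiff_less_def)
  then have bn: "b = n" "f n = 0" by (auto simp: unit_at_def split: if_splits)
  have "f c = 0" if "n \<le> c" for c
  proof (cases "c = n")
    case False
    then show ?thesis using b(2)[of c] that bn by (simp add: unit_at_def)
  qed (simp add: bn)
  then show "f \<in> tuples_upto n" by (simp add: tuples_upto_def)
next
  assume "f \<in> tuples_upto n"
  then show "f \<sqsubset> unit_at n"
    unfolding topdiff_less_def tuples_upto_def unit_at_def by (intro exI[of _ n]) auto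
qed

lemma below_positions_le: "\<nu> \<sqsubset> f \<Longrightarrow> f \<in> positions_le n \<Longrightarrow> \<nu> \<in> tuples_upto n"
  using colex_tuples_upto_down[of \<nu> f n] less_unit_at_iff[of \<nu> n] by (auto simp: positions_le_def)

lemma in_block_split: "g \<in> tuples_upto (Suc n) \<Longrightarrow> g(n := 0) \<in> tuples_upto n \<and> in_block n (g n) (g(n := 0)) = g"
  by (auto simp: tuples_upto_def in_block_def fun_eq_iff not_less_eq_eq[symmetric] le_Suc_eq)

lemma in_block_tuples: "f \<in> tuples_upto n \<Longrightarrow> in_block n i f \<in> tuples_upto (Suc n)"
  by (simp add: tuples_upto_def in_block_def)

lemma in_block_top: "f \<in> tuples_upto n \<Longrightarrow> in_block n i f n = i"
  by (simp add: tuples_upto_def in_block_def)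

lemma in_block_unit: "in_block n i (unit_at n) = in_block n (Suc i) (\<lambda>_. 0)"
  by (auto simp: in_block_def unit_at_def)

lemma in_block_positions: "f \<in> positions_le n \<Longrightarrow> in_block n i f \<in> tuples_upto (Suc n)"
  unfolding positions_le_def by (auto simp: in_block_tuples tuples_upto_def in_block_def unit_at_def)

text \<open>The number of the block is the last coordinate, which grows along the order. The end of block \<open>i\<close> is the
  first position of block \<open>i + 1\<close>, so positions before it still have last coordinate \<open>i\<close>.\<close>
lemma in_block_convex:
  assumes a: "a \<in> tuples_upto n" and b: "b \<in> positions_le n"
    and \<nu>: "in_block n i a \<sqsubset> \<nu> \<or> in_block n i a = \<nu>" "\<nu> \<sqsubset> in_block n i b"
  shows "\<exists>\<nu>'\<in>tuples_upto n. \<nu> = in_block n i \<nu>'"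
proof -
  have t: "\<nu> \<in> tuples_upto (Suc n)" using \<nu>(2) colex_tuples_upto_down in_block_positions[OF b] by blast
  have lo: "i \<le> \<nu> n" using \<nu>(1) colex_top_le[of "in_block n i a" \<nu> n] t in_block_top[OF a, of i] by auto
  have "\<nu> n = i"
  proof (cases "b = unit_at n")
    case False
    then have "b \<in> tuples_upto n" using b by (simp add: positions_le_def)
    then show ?thesis using lo colex_top_le[OF \<nu>(2) in_block_tuples] in_block_top[of b n i] by simp
  next
    case True
    obtain d where d: "\<nu> d < in_block n i b d" using \<nu>(2) by (auto simp: topdiff_less_def)
    then have "d = n" unfolding True by (auto simp: in_block_def unit_at_def split: if_splits)
    then show ?thesis using d lo unfolding True by (simp add: in_block_def unit_at_def)
  qed
  then show ?thesis using in_block_split[OF t] by (intro bexI[of _ "\<nu>(n := 0)"]) auto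
qed

lemma inf_before_cong:
  assumes "\<And>\<nu>. \<nu> \<sqsubset> f \<Longrightarrow> x \<nu> = y \<nu>"
  shows "inf_before x f = inf_before y f"
proof -
  have "(\<mu> \<sqsubset> \<nu> \<and> \<nu> \<sqsubset> f \<and> x \<nu> = q) = (\<mu> \<sqsubset> \<nu> \<and> \<nu> \<sqsubset> f \<and> y \<nu> = q)" for \<mu> \<nu> q
    using assms by auto
  then show ?thesis unfolding inf_before_def by simp
qed

lemma zero_less: "f \<noteq> (\<lambda>_. 0) \<Longrightarrow> f \<in> tuples_upto n \<Longrightarrow> (\<lambda>_. 0) \<sqsubset> f"
  using colex_zero_le by blast

text \<open>A nonzero position of a block has all its cofinal predecessors in the same block, so the shift by
  \<open>\<omega>\<^sup>n * i\<close> does not change which states occur cofinally.\<close>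
lemma inf_before_block:
  assumes f: "f \<in> positions_le n" "f \<noteq> (\<lambda>_. 0)"
  shows "inf_before (\<lambda>g. x (in_block n i g)) f = inf_before x (in_block n i f)"
proof -
  have f': "f \<in> tuples_upto (Suc n)" using f(1) unit_at_Suc tuples_upto_Suc by (auto simp: positions_le_def)
  have 0: "(\<lambda>_. 0) \<sqsubset> f" by (rule zero_less[OF f(2) f'])
  show ?thesis
  proof (intro set_eqI iffI)
    fix q assume q: "q \<in> inf_before (\<lambda>g. x (in_block n i g)) f"
    have q': "\<exists>\<nu>. \<mu> \<sqsubset> \<nu> \<and> \<nu> \<sqsubset> f \<and> x (in_block n i \<nu>) = q" if "\<mu> \<sqsubset> f" for \<mu>
      using q that by (simp add: inf_before_def)
    have "\<exists>\<nu>. \<mu> \<sqsubset> \<nu> \<and> \<nu> \<sqsubset> in_block n i f \<and> x \<nu> = q" if \<mu>: "\<mu> \<sqsubset> in_block n i f" for \<mu>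
    proof -
      have \<mu>t: "\<mu> \<in> tuples_upto (Suc n)" using \<mu> colex_tuples_upto_down in_block_positions[OF f(1)] by blast
      have z: "in_block n i (\<lambda>_. 0) \<in> tuples_upto (Suc n)" by (rule in_block_tuples) simp
      have "\<exists>\<mu>'. \<mu>' \<sqsubset> f \<and> (\<mu> = in_block n i \<mu>' \<or> \<mu> \<sqsubset> in_block n i \<mu>')"
      proof (cases "\<mu> \<sqsubset> in_block n i (\<lambda>_. 0)")
        case True
        then show ?thesis using 0 by blast
      next
        case False
        then have "in_block n i (\<lambda>_. 0) \<sqsubset> \<mu> \<or> in_block n i (\<lambda>_. 0) = \<mu>" using colex_total[OF \<mu>t z] by blast
        then obtain \<mu>' where "\<mu> = in_block n i \<mu>'"
          using in_block_convex[OF tuples_upto_zero f(1) _ \<mu>] by blast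
        then show ?thesis using \<mu> by auto
      qed
      then obtain \<mu>' where \<mu>': "\<mu>' \<sqsubset> f" "\<mu> = in_block n i \<mu>' \<or> \<mu> \<sqsubset> in_block n i \<mu>'" by blast
      obtain \<nu> where \<nu>: "\<mu>' \<sqsubset> \<nu>" "\<nu> \<sqsubset> f" "x (in_block n i \<nu>) = q" using q'[OF \<mu>'(1)] by blast
      have t: "in_block n i \<mu>' \<in> tuples_upto (Suc n)" "in_block n i \<nu> \<in> tuples_upto (Suc n)"
        using below_positions_le[OF _ f(1)] \<mu>'(1) \<nu>(2) in_block_tuples by blast+
      have "in_block n i \<mu>' \<sqsubset> in_block n i \<nu>" using \<nu>(1) by simp
      then have "\<mu> \<sqsubset> in_block n i \<nu>" using \<mu>'(2) colex_trans[OF _ _ \<mu>t t] by blast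
      then show ?thesis using \<nu> by (intro exI[of _ "in_block n i \<nu>"]) simp
    qed
    then show "q \<in> inf_before x (in_block n i f)" by (simp add: inf_before_def)
  next
    fix q assume q: "q \<in> inf_before x (in_block n i f)"
    have "\<exists>\<nu>. \<mu> \<sqsubset> \<nu> \<and> \<nu> \<sqsubset> f \<and> x (in_block n i \<nu>) = q" if \<mu>: "\<mu> \<sqsubset> f" for \<mu>
    proof -
      have "in_block n i \<mu> \<sqsubset> in_block n i f" using \<mu> by simp
      then obtain \<nu> where \<nu>: "in_block n i \<mu> \<sqsubset> \<nu>" "\<nu> \<sqsubset> in_block n i f" "x \<nu> = q"
        using q unfolding inf_before_def by blast
      then obtain \<nu>' where "\<nu> = in_block n i \<nu>'"
        using in_block_convex[OF below_positions_le[OF \<mu> f(1)] f(1) _ \<nu>(2)] by blast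
      then show ?thesis using \<nu> by auto
    qed
    then show "q \<in> inf_before (\<lambda>g. x (in_block n i g)) f" by (simp add: inf_before_def)
  qed
qed

lemma inf_before_top:
  "inf_before x (unit_at (Suc n)) = limsup_sets (\<lambda>i. (\<lambda>f. x (in_block n i f)) ` tuples_upto n)"
proof (intro set_eqI iffI)
  fix q assume q: "q \<in> inf_before x (unit_at (Suc n))"
  have "\<exists>i\<ge>m. q \<in> (\<lambda>f. x (in_block n i f)) ` tuples_upto n" for m
  proof -
    have "in_block n m (\<lambda>_. 0) \<sqsubset> unit_at (Suc n)" unfolding less_unit_at_iff by (rule in_block_tuples) simp
    then obtain \<nu> where \<nu>: "in_block n m (\<lambda>_. 0) \<sqsubset> \<nu>" "\<nu> \<sqsubset> unit_at (Suc n)" "x \<nu> = q"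
      using q unfolding inf_before_def by blast
    have t: "\<nu> \<in> tuples_upto (Suc n)" using \<nu>(2) by (simp add: less_unit_at_iff)
    have "m \<le> \<nu> n" using colex_top_le[OF \<nu>(1) t] in_block_top[of "\<lambda>_. 0" n m] by simp
    moreover have "q \<in> (\<lambda>f. x (in_block n (\<nu> n) f)) ` tuples_upto n"
      using in_block_split[OF t] \<nu>(3) by (intro image_eqI[of _ _ "\<nu>(n := 0)"]) auto
    ultimately show ?thesis by blast
  qed
  then show "q \<in> limsup_sets (\<lambda>i. (\<lambda>f. x (in_block n i f)) ` tuples_upto n)" by (simp add: limsup_sets_def)
next
  fix q assume q: "q \<in> limsup_sets (\<lambda>i. (\<lambda>f. x (in_block n i f)) ` tuples_upto n)"
  have "\<exists>\<nu>. \<mu> \<sqsubset> \<nu> \<and> \<nu> \<sqsubset> unit_at (Suc n) \<and> x \<nu> = q" if \<mu>: "\<mu> \<sqsubset> unit_at (Suc n)" for \<mu>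
  proof -
    have t: "\<mu> \<in> tuples_upto (Suc n)" using \<mu> by (simp add: less_unit_at_iff)
    have "\<exists>i\<ge>Suc (\<mu> n). q \<in> (\<lambda>f. x (in_block n i f)) ` tuples_upto n"
      using q by (simp only: limsup_sets_def mem_Collect_eq)
    then obtain i f where i: "Suc (\<mu> n) \<le> i" "f \<in> tuples_upto n" "q = x (in_block n i f)" by (elim exE conjE imageE)
    have "\<mu> \<sqsubset> in_block n i f"
      using i t in_block_tuples[OF i(2)] by (intro colex_topI[of _ n]) (simp_all add: in_block_top)
    then show ?thesis using i in_block_tuples[OF i(2)] by (intro exI[of _ "in_block n i f"]) (simp add: less_unit_at_iff)
  qed
  then show "q \<in> inf_before x (unit_at (Suc n))" by (simp add: inf_before_def)
qed

lemma next_pos_positions: "f \<in> tuples_upto n \<Longrightarrow> next_pos f \<in> positions_le n"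
proof (cases n)
  case 0
  assume "f \<in> tuples_upto n"
  then have "next_pos f = unit_at n" using 0 by (auto simp: next_pos_def unit_at_def tuples_upto_def)
  then show ?thesis by (simp add: positions_le_def)
qed (auto simp: positions_le_def tuples_upto_def next_pos_def)

lemma next_pos_in_block: "next_pos (in_block n i f) = in_block n i (next_pos f)"
  by (auto simp: next_pos_def in_block_def)

text \<open>A run on a word of length \<open>\<omega>^(n+1)\<close> is a sequence of runs on its blocks of length \<open>\<omega>\<^sup>n\<close> that share end
  points, with a limit transition at the end. The run on block \<open>i\<close> reads its last state at
  \<open>\<omega>\<^sup>n * i + \<omega>\<^sup>n\<close>, the first position of the next block (\<open>in_block_unit\<close>).\<close>
lemma run_seg_Suc:
  "run_seg \<Delta> \<gamma> (Suc n) w x \<longleftrightarrow>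
     (\<forall>i. run_seg \<Delta> \<gamma> n (\<lambda>f. w (in_block n i f)) (\<lambda>f. x (in_block n i f))) \<and>
     (limsup_sets (\<lambda>i. (\<lambda>f. x (in_block n i f)) ` tuples_upto n), x (unit_at (Suc n))) \<in> \<gamma>"
  (is "?L \<longleftrightarrow> ?R")
proof
  assume L: ?L
  have top: "unit_at (Suc n) \<in> positions_le (Suc n)" "unit_at (Suc n) \<noteq> (\<lambda>_. 0)" "unit_at (Suc n) 0 = 0"
    by (auto simp: positions_le_def unit_at_def fun_eq_iff)
  have "run_seg \<Delta> \<gamma> n (\<lambda>f. w (in_block n i f)) (\<lambda>f. x (in_block n i f))" for i
    unfolding run_seg_def
  proof (intro conjI ballI impI)
    fix f assume "f \<in> tuples_upto n"
    then show "(x (in_block n i f), w (in_block n i f), x (in_block n i (next_pos f))) \<in> \<Delta>"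
      using L in_block_tuples[of f n i] by (simp add: run_seg_def next_pos_in_block[symmetric])
  next
    fix f assume f: "f \<in> positions_le n" "f \<noteq> (\<lambda>_. 0)" "f 0 = 0"
    have "n \<noteq> 0"
    proof
      assume "n = 0"
      then have "f = (\<lambda>_. 0) \<or> f = unit_at 0" using f(1) by (auto simp: positions_le_def tuples_upto_def)
      then show False using f(2,3) by (auto simp: unit_at_def)
    qed
    then have "in_block n i f 0 = 0" using f(3) by (simp add: in_block_def)
    moreover have "in_block n i f \<noteq> (\<lambda>_. 0)"
    proof
      assume "in_block n i f = (\<lambda>_. 0)"
      then have "f c = 0" for c by (auto simp: in_block_def fun_eq_iff split: if_splits)
      then show False using f(2) by auto
    qed
    moreover have "in_block n i f \<in> positions_le (Suc n)" using in_block_positions[OF f(1)] by (simp add: positions_le_def)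
    ultimately have "(inf_before x (in_block n i f), x (in_block n i f)) \<in> \<gamma>" using L by (simp add: run_seg_def)
    then show "(inf_before (\<lambda>f. x (in_block n i f)) f, x (in_block n i f)) \<in> \<gamma>"
      by (simp add: inf_before_block[OF f(1,2)])
  qed
  moreover have "(inf_before x (unit_at (Suc n)), x (unit_at (Suc n))) \<in> \<gamma>" using L top by (simp add: run_seg_def)
  ultimately show ?R by (simp add: inf_before_top)
next
  assume R: ?R
  show ?L
    unfolding run_seg_def
  proof (intro conjI ballI impI)
    fix g assume g: "g \<in> tuples_upto (Suc n)"
    have s: "g(n := 0) \<in> tuples_upto n" "in_block n (g n) (g(n := 0)) = g" using in_block_split[OF g] by auto
    have "(x (in_block n (g n) (g(n := 0))), w (in_block n (g n) (g(n := 0))), x (in_block n (g n) (next_pos (g(n := 0))))) \<in> \<Delta>"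
      using R s(1) by (simp add: run_seg_def)
    then show "(x g, w g, x (next_pos g)) \<in> \<Delta>"
      by (simp only: next_pos_in_block[symmetric] s(2))
  next
    fix g assume g: "g \<in> positions_le (Suc n)" "g \<noteq> (\<lambda>_. 0)" "g 0 = 0"
    show "(inf_before x g, x g) \<in> \<gamma>"
    proof (cases "g = unit_at (Suc n)")
      case True
      then show ?thesis using R by (simp add: inf_before_top)
    next
      case False
      then have gt: "g \<in> tuples_upto (Suc n)" using g(1) by (simp add: positions_le_def)
      have "\<exists>i f. f \<in> positions_le n \<and> f \<noteq> (\<lambda>_. 0) \<and> f 0 = 0 \<and> in_block n i f = g"
      proof (cases "g(n := 0) = (\<lambda>_. 0)")
        case False
        then show ?thesis using in_block_split[OF gt] g(3)
          by (intro exI[of _ "g n"] exI[of _ "g(n := 0)"]) (auto simp: positions_le_def)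
      next
        case True
        have g0: "g c = 0" if "c \<noteq> n" for c
        proof -
          have "g c = (g(n := 0)) c" using that by simp
          then show ?thesis by (simp only: True)
        qed
        have "g n \<noteq> 0"
        proof
          assume "g n = 0"
          then have "g c = 0" for c using g0[of c] by (cases "c = n") auto
          then show False using g(2) by auto
        qed
        then have "n \<noteq> 0" using g(3) by (cases "n = 0") auto
        then have "unit_at n \<noteq> (\<lambda>_. 0)" "unit_at n 0 = 0" by (auto simp: unit_at_def fun_eq_iff)
        moreover have "in_block n (g n - 1) (unit_at n) = g"
          using g0 \<open>g n \<noteq> 0\<close> by (auto simp: in_block_def unit_at_def fun_eq_iff)
        ultimately show ?thesis by (auto simp: positions_le_def)
      qed
      then obtain i f where f: "f \<in> positions_le n" "f \<noteq> (\<lambda>_. 0)" "f 0 = 0" "in_block n i f = g" by blast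
      have "(inf_before (\<lambda>f. x (in_block n i f)) f, x (in_block n i f)) \<in> \<gamma>"
        using conjunct1[OF R, rule_format, of i] f(1-3) unfolding run_seg_def by simp
      then show ?thesis using inf_before_block[OF f(1,2), of x i] f(4) by simp
    qed
  qed
qed

primrec run_type :: "('q \<times> 'l \<times> 'q) set \<Rightarrow> ('q set \<times> 'q) set \<Rightarrow> nat \<Rightarrow> ((nat \<Rightarrow> nat) \<Rightarrow> 'l) \<Rightarrow> 'q run_type" where
  "run_type \<Delta> \<gamma> 0 w = {(q, {q}, q') | q q'. (q, w (\<lambda>_. 0), q') \<in> \<Delta>}"
| "run_type \<Delta> \<gamma> (Suc n) w = rt_omega \<gamma> (\<lambda>i. run_type \<Delta> \<gamma> n (\<lambda>f. w (in_block n i f)))"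

lemma run_seg_0: "run_seg \<Delta> \<gamma> 0 w x \<longleftrightarrow> (x (\<lambda>_. 0), w (\<lambda>_. 0), x (unit_at 0)) \<in> \<Delta>"
proof -
  have "tuples_upto 0 = {\<lambda>_. 0}" by (auto simp: tuples_upto_def)
  moreover have "next_pos (\<lambda>_. 0) = unit_at 0" by (auto simp: next_pos_def unit_at_def)
  ultimately show ?thesis by (auto simp: run_seg_def positions_le_def unit_at_def)
qed

lemma run_type_iff:
  "(q, P, q') \<in> run_type \<Delta> \<gamma> n w \<longleftrightarrow>
     (\<exists>x. run_seg \<Delta> \<gamma> n w x \<and> x (\<lambda>_. 0) = q \<and> x ` tuples_upto n = P \<and> x (unit_at n) = q')"
proof (induction n arbitrary: w q P q')
  case 0
  have t: "tuples_upto 0 = {\<lambda>_. 0}" by (auto simp: tuples_upto_def)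
  have u: "unit_at 0 \<noteq> (\<lambda>_. 0)" by (auto simp: unit_at_def fun_eq_iff)
  show ?case
  proof
    assume "(q, P, q') \<in> run_type \<Delta> \<gamma> 0 w"
    then have "(q, w (\<lambda>_. 0), q') \<in> \<Delta>" "P = {q}" by auto
    then show "\<exists>x. run_seg \<Delta> \<gamma> 0 w x \<and> x (\<lambda>_. 0) = q \<and> x ` tuples_upto 0 = P \<and> x (unit_at 0) = q'"
      using u by (intro exI[of _ "\<lambda>f. if f = unit_at 0 then q' else q"]) (auto simp: run_seg_0 t)
  qed (auto simp: run_seg_0 t)
next
  case (Suc n)
  have T: "tuples_upto (Suc n) = (\<Union>i. in_block n i ` tuples_upto n)"
    using in_block_split in_block_tuples by (auto simp: image_iff) metis
  show ?case
  proof
    assume "(q, P, q') \<in> run_type \<Delta> \<gamma> (Suc n) w"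
    then obtain qs Ps where qs: "qs 0 = q" "\<And>i. (qs i, Ps i, qs (Suc i)) \<in> run_type \<Delta> \<gamma> n (\<lambda>f. w (in_block n i f))"
      "P = (\<Union>i. Ps i)" "(limsup_sets Ps, q') \<in> \<gamma>" by (auto simp: rt_omega_def)
    have "\<forall>i. \<exists>x. run_seg \<Delta> \<gamma> n (\<lambda>f. w (in_block n i f)) x \<and> x (\<lambda>_. 0) = qs i \<and>
        x ` tuples_upto n = Ps i \<and> x (unit_at n) = qs (Suc i)"
      using qs(2) by (simp only: Suc.IH) simp
    from choice[OF this] obtain y where y: "\<And>i. run_seg \<Delta> \<gamma> n (\<lambda>f. w (in_block n i f)) (y i)"
      "\<And>i. y i (\<lambda>_. 0) = qs i" "\<And>i. y i ` tuples_upto n = Ps i" "\<And>i. y i (unit_at n) = qs (Suc i)" by blast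
    define x where "x f = (if f \<in> tuples_upto (Suc n) then y (f n) (f(n := 0)) else q')" for f
    have xb: "x (in_block n i f) = y i f" if "f \<in> positions_le n" for i f
    proof (cases "f = unit_at n")
      case False
      then have f: "f \<in> tuples_upto n" using that by (simp add: positions_le_def)
      then have "(in_block n i f)(n := 0) = f" by (auto simp: in_block_def tuples_upto_def)
      then show ?thesis using in_block_tuples[OF f] in_block_top[OF f] by (simp add: x_def)
    next
      case True
      have z: "in_block n (Suc i) (\<lambda>_. 0) \<in> tuples_upto (Suc n)" by (rule in_block_tuples) simp
      have "(in_block n (Suc i) (\<lambda>_. 0))(n := 0) = (\<lambda>_. 0)" by (auto simp: in_block_def)
      then have "x (in_block n (Suc i) (\<lambda>_. 0)) = y (Suc i) (\<lambda>_. 0)"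
        using z in_block_top[of "\<lambda>_. 0" n "Suc i"] by (simp add: x_def)
      then show ?thesis using y(2)[of "Suc i"] y(4)[of i] by (simp add: True in_block_unit)
    qed
    have img: "(\<lambda>f. x (in_block n i f)) ` tuples_upto n = Ps i" for i
      using y(3)[of i] xb[of _ i] by (auto simp: positions_le_def image_iff)
    have seg: "run_seg \<Delta> \<gamma> n (\<lambda>f. w (in_block n i f)) (\<lambda>f. x (in_block n i f))" for i
    proof -
      have "inf_before (\<lambda>f. x (in_block n i f)) f = inf_before (y i) f" if "f \<in> positions_le n" for f
        by (rule inf_before_cong, rule xb) (use below_positions_le[OF _ that] in \<open>simp add: positions_le_def\<close>)
      moreover have "f \<in> positions_le n" if "f \<in> tuples_upto n" for f using that by (simp add: positions_le_def)
      ultimately show ?thesis using y(1)[of i] unfolding run_seg_def by (simp add: xb next_pos_positions)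
    qed
    have top: "x (unit_at (Suc n)) = q'"
    proof -
      have "unit_at (Suc n) \<notin> tuples_upto (Suc n)" by (simp add: unit_at_def tuples_upto_def)
      then show ?thesis by (simp add: x_def)
    qed
    have "run_seg \<Delta> \<gamma> (Suc n) w x" unfolding run_seg_Suc img top using seg qs(4) by simp
    moreover have "x (\<lambda>_. 0) = q"
    proof -
      have "in_block n 0 (\<lambda>_. 0) = (\<lambda>_. 0)" by (auto simp: in_block_def)
      then show ?thesis using xb[of "\<lambda>_. 0" 0] y(2)[of 0] qs(1) by (simp add: positions_le_def)
    qed
    moreover have "x ` tuples_upto (Suc n) = P"
      unfolding T image_UN image_image img qs(3) ..
    ultimately show "\<exists>x. run_seg \<Delta> \<gamma> (Suc n) w x \<and> x (\<lambda>_. 0) = q \<and> x ` tuples_upto (Suc n) = P \<and> x (unit_at (Suc n)) = q'"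
      using top by blast
  next
    assume "\<exists>x. run_seg \<Delta> \<gamma> (Suc n) w x \<and> x (\<lambda>_. 0) = q \<and> x ` tuples_upto (Suc n) = P \<and> x (unit_at (Suc n)) = q'"
    then obtain x where x: "run_seg \<Delta> \<gamma> (Suc n) w x" "x (\<lambda>_. 0) = q" "x ` tuples_upto (Suc n) = P" "x (unit_at (Suc n)) = q'"
      by blast
    define qs where "qs i = x (in_block n i (\<lambda>_. 0))" for i
    define Ps where "Ps i = (\<lambda>f. x (in_block n i f)) ` tuples_upto n" for i
    have "(qs i, Ps i, qs (Suc i)) \<in> run_type \<Delta> \<gamma> n (\<lambda>f. w (in_block n i f))" for i
      unfolding Suc.IH using x(1)[unfolded run_seg_Suc]
      by (intro exI[of _ "\<lambda>f. x (in_block n i f)"]) (auto simp: qs_def Ps_def in_block_unit)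
    moreover have "qs 0 = q"
    proof -
      have "in_block n 0 (\<lambda>_. 0) = (\<lambda>_. 0)" by (auto simp: in_block_def)
      then show ?thesis using x(2) by (simp add: qs_def)
    qed
    moreover have "P = (\<Union>i. Ps i)" unfolding x(3)[symmetric] T image_UN image_image Ps_def ..
    moreover have "(limsup_sets Ps, q') \<in> \<gamma>" using x(1)[unfolded run_seg_Suc] x(4) by (simp add: Ps_def[abs_def])
    ultimately show "(q, P, q') \<in> run_type \<Delta> \<gamma> (Suc n) w" by (auto simp: rt_omega_def)
  qed
qed

section \<open>Powers of \<open>\<omega>\<close> as finitely supported functions\<close>
lemma opow_carrier_natLeq:
  "opow_carrier natLeq s = {f \<in> Field s \<rightarrow>\<^sub>E UNIV. finite {b \<in> Field s. f b \<noteq> 0}}"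
proof -
  interpret wo_rel natLeq by (simp add: wo_rel_def natLeq_Well_order)
  have "0 = minim (Field natLeq)"
    unfolding Field_natLeq by (rule equals_minim) (simp_all add: Field_natLeq, simp add: natLeq_def)
  then show ?thesis by (simp add: opow_carrier_def Field_natLeq)
qed

lemma Field_opow: "Field (opow r s) = opow_carrier r s"
  by (auto simp: opow_def Field_def)

lemma opow_iff:
  "(F, G) \<in> opow r s \<longleftrightarrow> F \<in> Field (opow r s) \<and> G \<in> Field (opow r s) \<and>
     (F = G \<or> (\<exists>b\<in>Field s. F b \<noteq> G b \<and> (F b, G b) \<in> r \<and> (\<forall>c\<in>Field s. b \<in> underS s c \<longrightarrow> F c = G c)))"
  unfolding Field_opow by (simp add: opow_def)

text \<open>Elements of \<open>opow\<close> are extensional functions on the exponents. The map \<open>N\<close> renames the exponents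
  along \<open>e\<close>, with inverse \<open>d\<close>, and replaces the undefined values by zeros. It is applied to
  \<open>\<omega>\<^sup>n\<close>, with numbers below \<open>n\<close> as exponents, and then to \<open>\<omega>^(\<omega>^n)\<close>, with tuples as exponents.\<close>
lemma opow_natLeq:
  assumes e: "\<And>x. x \<in> Field s \<Longrightarrow> e x \<in> B \<and> d (e x) = x" and d: "\<And>f. f \<in> B \<Longrightarrow> d f \<in> Field s \<and> e (d f) = f"
    and lt: "\<And>x y. x \<in> Field s \<Longrightarrow> y \<in> Field s \<Longrightarrow> x \<in> underS s y \<longleftrightarrow> lt (e x) (e y)"
    and N: "\<And>F. N F = (\<lambda>f. if f \<in> B then F (d f) else (0::nat))"
  shows "bij_betw N (Field (opow natLeq s)) (fin_supp B)"
    and "opow natLeq s = wo_of (Field (opow natLeq s)) (\<lambda>F G. topdiff_less lt (N F) (N G))"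
    and "G \<in> fin_supp B \<Longrightarrow> (\<lambda>x\<in>Field s. G (e x)) \<in> Field (opow natLeq s) \<and> N (\<lambda>x\<in>Field s. G (e x)) = G"
proof -
  have N1: "N F \<in> fin_supp B" if F: "F \<in> Field (opow natLeq s)" for F
  proof (rule fin_suppI)
    show "finite (e ` {b \<in> Field s. F b \<noteq> 0})" using F by (simp add: Field_opow opow_carrier_natLeq)
    show "e ` {b \<in> Field s. F b \<noteq> 0} \<subseteq> B" using e by auto
    show "f \<in> e ` {b \<in> Field s. F b \<noteq> 0}" if "N F f \<noteq> 0" for f
      using that d[of f] by (auto simp: N image_iff split: if_splits intro!: exI[of _ "d f"])
  qed
  have Ne: "N F (e x) = F x" if "x \<in> Field s" for F x using e[OF that] by (simp add: N)
  have eqI: "F = G" if "F \<in> Field (opow natLeq s)" "G \<in> Field (opow natLeq s)" "\<And>x. x \<in> Field s \<Longrightarrow> F x = G x" for F G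
    using that by (auto simp: Field_opow opow_carrier_natLeq intro: PiE_ext)
  have inj: "inj_on N (Field (opow natLeq s))"
  proof (rule inj_onI)
    fix F G assume F: "F \<in> Field (opow natLeq s)" "G \<in> Field (opow natLeq s)" and eq: "N F = N G"
    have "F x = G x" if "x \<in> Field s" for x using Ne[OF that, of F] Ne[OF that, of G] eq by simp
    then show "F = G" using eqI[OF F] by blast
  qed
  show sur: "(\<lambda>x\<in>Field s. G (e x)) \<in> Field (opow natLeq s) \<and> N (\<lambda>x\<in>Field s. G (e x)) = G" (is "?F \<in> _ \<and> _")
    if G: "G \<in> fin_supp B" for G
  proof
    have "{b \<in> Field s. ?F b \<noteq> 0} \<subseteq> d ` {f. G f \<noteq> 0}"
    proof
      fix b assume "b \<in> {b \<in> Field s. ?F b \<noteq> 0}"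
      then have "b \<in> Field s" "G (e b) \<noteq> 0" by auto
      then show "b \<in> d ` {f. G f \<noteq> 0}" using e[of b] by (intro image_eqI[of _ _ "e b"]) auto
    qed
    then have "finite {b \<in> Field s. ?F b \<noteq> 0}" using finite_subset[OF _ finite_imageI[OF fin_supp_finite[OF G]]] by blast
    then show "?F \<in> Field (opow natLeq s)" by (simp add: Field_opow opow_carrier_natLeq)
    show "N ?F = G"
    proof
      fix f show "N ?F f = G f"
        using d[of f] fin_supp_outside[OF G, of f] by (cases "f \<in> B") (simp_all add: N)
    qed
  qed
  show "bij_betw N (Field (opow natLeq s)) (fin_supp B)"
    unfolding bij_betw_def
  proof (intro conjI equalityI subsetI)
    fix G assume "G \<in> fin_supp B"
    then show "G \<in> N ` Field (opow natLeq s)" using sur[of G] by (metis image_eqI)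
  qed (use inj N1 in auto)
  have less: "(\<exists>b\<in>Field s. F b \<noteq> G b \<and> (F b, G b) \<in> natLeq \<and> (\<forall>c\<in>Field s. b \<in> underS s c \<longrightarrow> F c = G c)) \<longleftrightarrow>
      topdiff_less lt (N F) (N G)" (is "?A \<longleftrightarrow> ?B") if "F \<in> Field (opow natLeq s)" "G \<in> Field (opow natLeq s)" for F G
  proof
    assume ?A
    then obtain b where b: "b \<in> Field s" "F b < G b" "\<forall>c\<in>Field s. b \<in> underS s c \<longrightarrow> F c = G c"
      by (auto simp: natLeq_def)
    have "N F c = N G c" if "lt (e b) c" for c
    proof (cases "c \<in> B")
      case True
      then have "d c \<in> Field s" "b \<in> underS s (d c)" using d[OF True] lt[OF b(1), of "d c"] that by auto
      then show ?thesis using b(3) True by (simp add: N)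
    qed (simp add: N)
    then show ?B unfolding topdiff_less_def using b Ne by (intro exI[of _ "e b"]) simp
  next
    assume ?B
    then obtain f where f: "N F f < N G f" "\<And>c. lt f c \<Longrightarrow> N F c = N G c" by (auto simp: topdiff_less_def)
    have fB: "f \<in> B" using f(1) by (auto simp: N split: if_splits)
    have "F (d f) < G (d f)" using f(1) fB by (simp add: N)
    moreover have "F c = G c" if "c \<in> Field s" "d f \<in> underS s c" for c
      using f(2)[of "e c"] lt[of "d f" c] that d[OF fB] Ne[OF that(1)] by simp
    ultimately show ?A using d[OF fB] by (intro bexI[of _ "d f"]) (auto simp: natLeq_def)
  qed
  show "opow natLeq s = wo_of (Field (opow natLeq s)) (\<lambda>F G. topdiff_less lt (N F) (N G))"
  proof (intro set_eqI)
    fix z :: "('a \<Rightarrow> nat) \<times> ('a \<Rightarrow> nat)"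
    obtain F G where z: "z = (F, G)" by (cases z)
    show "z \<in> opow natLeq s \<longleftrightarrow> z \<in> wo_of (Field (opow natLeq s)) (\<lambda>F G. topdiff_less lt (N F) (N G))"
      unfolding z wo_of_def opow_iff[of F G] using less[of F G] by auto
  qed
qed

text \<open>Positions of words are functions that are undefined outside of \<open>{..<n}\<close>; tuples are zero there.\<close>
definition code_pos :: "nat \<Rightarrow> (nat \<Rightarrow> nat) \<Rightarrow> nat \<Rightarrow> nat" where
  "code_pos n c = (\<lambda>i. if i \<in> {..<n} then c i else 0)"

abbreviation pos_of :: "nat \<Rightarrow> (nat \<Rightarrow> nat) \<Rightarrow> nat \<Rightarrow> nat" where
  "pos_of n f \<equiv> (\<lambda>i\<in>{..<n}. f i)"

lemma tuples_upto_fin_supp_eq: "tuples_upto n = fin_supp {..<n}"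
proof (intro equalityI subsetI)
  fix f assume f: "f \<in> tuples_upto n"
  then have "finite {e. f e \<noteq> 0}" using tuples_upto_fin_supp fin_supp_finite by blast
  moreover have "{e. f e \<noteq> 0} \<subseteq> {..<n}" using f by (auto simp: tuples_upto_def intro: ccontr)
  ultimately show "f \<in> fin_supp {..<n}" by (simp add: fin_supp_def)
qed (auto simp: tuples_upto_def fin_supp_def)

lemma topdiff_natLeq_on:
  assumes "f \<in> tuples_upto n" "g \<in> tuples_upto n"
  shows "topdiff_less (\<lambda>x y. x \<in> underS (natLeq_on n) y) f g \<longleftrightarrow> f \<sqsubset> g"
proof -
  have out: "f c = 0" "g c = 0" if "n \<le> c" for c using assms that by (auto simp: tuples_upto_def)
  have "(\<forall>c. b \<in> underS (natLeq_on n) c \<longrightarrow> f c = g c) \<longleftrightarrow> (\<forall>c>b. f c = g c)" for b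
  proof
    assume *: "\<forall>c. b \<in> underS (natLeq_on n) c \<longrightarrow> f c = g c"
    show "\<forall>c>b. f c = g c"
    proof (intro allI impI)
      fix c assume "b < c"
      then show "f c = g c" using * out[of c] by (cases "c < n") (auto simp: underS_def)
    qed
  qed (auto simp: underS_def)
  then show ?thesis unfolding topdiff_less_def by simp
qed

lemma omega_pow_eq:
  shows bij_code_pos: "bij_betw (code_pos n) (Field (omega_pow n)) (tuples_upto n)"
    and omega_pow_wo_of: "omega_pow n = wo_of (Field (omega_pow n)) (\<lambda>c d. code_pos n c \<sqsubset> code_pos n d)"
    and pos_of: "f \<in> tuples_upto n \<Longrightarrow> pos_of n f \<in> Field (omega_pow n) \<and> code_pos n (pos_of n f) = f"
proof -
  have F: "Field (natLeq_on n) = {..<n}" by (auto simp: Field_natLeq_on)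
  have *: "\<And>x. x \<in> Field (natLeq_on n) \<Longrightarrow> id x \<in> {..<n} \<and> id (id x) = x"
    "\<And>f. f \<in> {..<n} \<Longrightarrow> id f \<in> Field (natLeq_on n) \<and> id (id f) = f"
    by (auto simp: F)
  have cp: "\<And>F. code_pos n F = (\<lambda>f. if f \<in> {..<n} then F (id f) else 0)"
    by (rule ext) (simp add: code_pos_def)
  let ?lt = "\<lambda>x y. x \<in> underS (natLeq_on n) y"
  have lt: "\<And>x y. x \<in> Field (natLeq_on n) \<Longrightarrow> y \<in> Field (natLeq_on n) \<Longrightarrow> x \<in> underS (natLeq_on n) y \<longleftrightarrow> ?lt (id x) (id y)"
    by simp
  note O = opow_natLeq[where s = "natLeq_on n" and e = id and d = id and B = "{..<n}" and lt = ?lt and N = "code_pos n",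
    OF *(1) *(2) lt cp]
  show b: "bij_betw (code_pos n) (Field (omega_pow n)) (tuples_upto n)"
    using O(1) by (simp add: tuples_upto_fin_supp_eq)
  have "topdiff_less ?lt (code_pos n c) (code_pos n d) \<longleftrightarrow> code_pos n c \<sqsubset> code_pos n d"
    if "c \<in> Field (omega_pow n)" "d \<in> Field (omega_pow n)" for c d
    using that b by (intro topdiff_natLeq_on) (auto simp: bij_betw_def)
  then have "wo_of (Field (omega_pow n)) (\<lambda>c d. topdiff_less ?lt (code_pos n c) (code_pos n d)) =
      wo_of (Field (omega_pow n)) (\<lambda>c d. code_pos n c \<sqsubset> code_pos n d)"
    unfolding wo_of_def by blast
  then show "omega_pow n = wo_of (Field (omega_pow n)) (\<lambda>c d. code_pos n c \<sqsubset> code_pos n d)"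
    using O(2) by simp
  show "f \<in> tuples_upto n \<Longrightarrow> pos_of n f \<in> Field (omega_pow n) \<and> code_pos n (pos_of n f) = f"
    using O(3)[of f] by (simp add: F tuples_upto_fin_supp_eq)
qed

lemma pos_of_code_pos: "c \<in> Field (omega_pow n) \<Longrightarrow> pos_of n (code_pos n c) = c"
  using bij_code_pos[of n] pos_of[of "code_pos n c" n] by (auto simp: bij_betw_def inj_on_def)

lemma code_pos_tuples: "c \<in> Field (omega_pow n) \<Longrightarrow> code_pos n c \<in> tuples_upto n"
  using bij_code_pos[of n] by (auto simp: bij_betw_def)

lemma strict_wo_omega_pow: "strict_wo (Field (omega_pow n)) (\<lambda>c d. code_pos n c \<sqsubset> code_pos n d)"
  by (rule strict_wo_pullback[OF strict_wo_colex_tuples[of n], of _ "code_pos n"])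
    (use bij_code_pos[of n] code_pos_tuples in \<open>auto simp: bij_betw_def\<close>)

lemma underS_omega_pow:
  "c \<in> Field (omega_pow n) \<Longrightarrow> d \<in> Field (omega_pow n) \<Longrightarrow> c \<in> underS (omega_pow n) d \<longleftrightarrow> code_pos n c \<sqsubset> code_pos n d"
  by (subst omega_pow_wo_of) (simp add: underS_wo_of[OF strict_wo_omega_pow])

lemma ordIso_omega_omega_pow:
  "(opow natLeq (omega_pow n), wo_of (fin_supp (tuples_upto n)) (topdiff_less colex)) \<in> ordIso"
proof -
  let ?s = "omega_pow n"
  define N where "N F = (\<lambda>f. if f \<in> tuples_upto n then F (pos_of n f) else (0::nat))" for F
  have 1: "\<And>x. x \<in> Field ?s \<Longrightarrow> code_pos n x \<in> tuples_upto n \<and> pos_of n (code_pos n x) = x"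
    using code_pos_tuples pos_of_code_pos by blast
  have 2: "\<And>f. f \<in> tuples_upto n \<Longrightarrow> pos_of n f \<in> Field ?s \<and> code_pos n (pos_of n f) = f"
    by (rule pos_of)
  note O = opow_natLeq[where s = ?s and e = "code_pos n" and d = "pos_of n" and B = "tuples_upto n" and lt = colex and N = N,
    OF 1 2 underS_omega_pow N_def]
  let ?W = "fin_supp (tuples_upto n)"
  have W: "Well_order (wo_of ?W (topdiff_less colex))" by (rule Well_order_wo_of[OF strict_wo_powers])
  have bij: "bij_betw N (Field (opow natLeq ?s)) ?W" by (rule O(1))
  have wo: "strict_wo (Field (opow natLeq ?s)) (\<lambda>F G. N F \<lless> N G)"
    by (rule strict_wo_pullback[OF strict_wo_powers[of n], of _ N]) (use bij in \<open>auto simp: bij_betw_def\<close>)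
  have eq: "wo_of (Field (opow natLeq ?s)) (\<lambda>F G. N F \<lless> N G) = opow natLeq ?s" by (rule O(2)[symmetric])
  have "Well_order (opow natLeq ?s)" using Well_order_wo_of[OF wo] by (simp only: eq)
  moreover have "iso (opow natLeq ?s) (wo_of ?W (topdiff_less colex)) N"
    unfolding iso_iff2
  proof (intro conjI ballI)
    show "bij_betw N (Field (opow natLeq ?s)) (Field (wo_of ?W (topdiff_less colex)))" using bij by simp
    fix F G assume FG: "F \<in> Field (opow natLeq ?s)" "G \<in> Field (opow natLeq ?s)"
    have "(F, G) \<in> opow natLeq ?s \<longleftrightarrow> F = G \<or> N F \<lless> N G"
      proof -
      have "(F, G) \<in> wo_of (Field (opow natLeq ?s)) (\<lambda>F G. N F \<lless> N G) \<longleftrightarrow> F = G \<or> N F \<lless> N G"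
        using FG by (simp add: wo_of_def)
      then show ?thesis by (simp only: eq)
    qed
    also have "F = G \<longleftrightarrow> N F = N G" using FG bij by (auto simp: bij_betw_def inj_on_def)
    finally show "(F, G) \<in> opow natLeq ?s \<longleftrightarrow> (N F, N G) \<in> wo_of ?W (topdiff_less colex)"
      using FG bij by (auto simp: wo_of_def bij_betw_def)
  qed
  ultimately show ?thesis using W by (auto simp: ordIso_def)
qed

section \<open>Languages of automata on words of length \<open>\<omega>\<^sup>n\<close>\<close>

text \<open>The new largest element of \<open>osuc\<close> corresponds to the tuple \<open>unit_at n\<close>, which is the ordinal
  \<open>\<omega>\<^sup>n\<close>.\<close>
definition code_opt :: "nat \<Rightarrow> (nat \<Rightarrow> nat) option \<Rightarrow> nat \<Rightarrow> nat" where
  "code_opt n p = (case p of Some c \<Rightarrow> code_pos n c | None \<Rightarrow> unit_at n)"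

definition opt_of :: "nat \<Rightarrow> (nat \<Rightarrow> nat) \<Rightarrow> (nat \<Rightarrow> nat) option" where
  "opt_of n f = (if f = unit_at n then None else Some (pos_of n f))"

lemma Field_osuc: "Field (osuc r) = insert None (Some ` Field r)"
  by (auto simp: osuc_def Field_def)

lemma in_osuc_cases:
  "(Some c, Some d) \<in> osuc r \<longleftrightarrow> (c, d) \<in> r" "(Some c, None) \<in> osuc r \<longleftrightarrow> c \<in> Field r"
  "(None, Some d) \<notin> osuc r" "(None, None) \<in> osuc r"
  by (auto simp: osuc_def)

lemma unit_not_tuples: "unit_at n \<notin> tuples_upto n"
  by (simp add: unit_at_def tuples_upto_def)

lemma in_wo_of: "(x, y) \<in> wo_of A lt \<longleftrightarrow> x \<in> A \<and> y \<in> A \<and> (x = y \<or> lt x y)"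
  by (simp add: wo_of_def)

lemma in_omega_pow: "(c, d) \<in> omega_pow n \<longleftrightarrow>
    c \<in> Field (omega_pow n) \<and> d \<in> Field (omega_pow n) \<and> (c = d \<or> code_pos n c \<sqsubset> code_pos n d)"
  by (rule trans[OF arg_cong[OF omega_pow_wo_of, of "\<lambda>r. (c, d) \<in> r"] in_wo_of])

lemma code_pos_ne_unit: "c \<in> Field (omega_pow n) \<Longrightarrow> code_pos n c \<noteq> unit_at n"
  using code_pos_tuples[of c n] unit_not_tuples[of n] by auto

lemma code_opt_in: "p \<in> Field (osuc (omega_pow n)) \<Longrightarrow> code_opt n p \<in> positions_le n \<and> opt_of n (code_opt n p) = p"
  by (auto simp: Field_osuc code_opt_def opt_of_def positions_le_def code_pos_tuples pos_of_code_pos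
      code_pos_ne_unit)

lemma opt_of_in: "f \<in> positions_le n \<Longrightarrow> opt_of n f \<in> Field (osuc (omega_pow n)) \<and> code_opt n (opt_of n f) = f"
  using unit_not_tuples[of n] pos_of[of f n]
  by (auto simp: Field_osuc code_opt_def opt_of_def positions_le_def)

lemma inj_code_opt: "p \<in> Field (osuc (omega_pow n)) \<Longrightarrow> q \<in> Field (osuc (omega_pow n)) \<Longrightarrow> code_opt n p = code_opt n q \<longleftrightarrow> p = q"
  using code_opt_in[of p n] code_opt_in[of q n] by metis

lemma osuc_wo_of: "osuc (omega_pow n) = wo_of (Field (osuc (omega_pow n))) (\<lambda>p q. code_opt n p \<sqsubset> code_opt n q)"
proof (intro set_eqI)
  fix z :: "(nat \<Rightarrow> nat) option \<times> (nat \<Rightarrow> nat) option"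
  obtain p q where z: "z = (p, q)" by (cases z)
  have 2: "\<not> unit_at n \<sqsubset> code_pos n c" if "c \<in> Field (omega_pow n)" for c
  proof
    assume "unit_at n \<sqsubset> code_pos n c"
    then have "unit_at n \<in> tuples_upto n" using colex_tuples_upto_down code_pos_tuples[OF that] by blast
    then show False using unit_not_tuples by blast
  qed
  show "z \<in> osuc (omega_pow n) \<longleftrightarrow> z \<in> wo_of (Field (osuc (omega_pow n))) (\<lambda>p q. code_opt n p \<sqsubset> code_opt n q)"
    unfolding z in_wo_of by (cases p; cases q)
      (auto simp: in_osuc_cases Field_osuc code_opt_def in_omega_pow less_unit_at_iff code_pos_tuples dest: 2)
qed

lemma strict_wo_osuc: "strict_wo (Field (osuc (omega_pow n))) (\<lambda>p q. code_opt n p \<sqsubset> code_opt n q)"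
proof (rule strict_wo_pullback[OF strict_wo_colex_tuples[of "Suc n"], of _ "code_opt n"])
  show "code_opt n p \<in> tuples_upto (Suc n)" if "p \<in> Field (osuc (omega_pow n))" for p
    using code_opt_in[OF that] unit_at_Suc tuples_upto_Suc by (auto simp: positions_le_def)
  show "inj_on (code_opt n) (Field (osuc (omega_pow n)))" using inj_code_opt by (auto simp: inj_on_def)
qed simp

lemma wo_rel_osuc: "wo_rel (osuc (omega_pow n))"
proof -
  have "Well_order (wo_of (Field (osuc (omega_pow n))) (\<lambda>p q. code_opt n p \<sqsubset> code_opt n q))"
    by (rule Well_order_wo_of[OF strict_wo_osuc])
  then show ?thesis unfolding wo_rel_def by (simp only: osuc_wo_of[symmetric])
qed

lemma in_osuc: "(p, q) \<in> osuc (omega_pow n) \<longleftrightarrow> p \<in> Field (osuc (omega_pow n)) \<and> q \<in> Field (osuc (omega_pow n)) \<and>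
    (p = q \<or> code_opt n p \<sqsubset> code_opt n q)"
  by (rule trans[OF arg_cong[OF osuc_wo_of, of "\<lambda>r. (p, q) \<in> r"] in_wo_of])

lemma in_underS_osuc: "p \<in> underS (osuc (omega_pow n)) q \<longleftrightarrow> p \<in> Field (osuc (omega_pow n)) \<and> q \<in> Field (osuc (omega_pow n)) \<and>
    code_opt n p \<sqsubset> code_opt n q"
  using strict_wo_irrefl[OF strict_wo_osuc[of n]] by (auto simp: underS_def in_osuc)

lemma next_pos_least:
  assumes "f \<sqsubset> g"
  shows "next_pos f = g \<or> next_pos f \<sqsubset> g"
proof -
  obtain b where b: "f b < g b" "\<And>c. b < c \<Longrightarrow> f c = g c" using assms by (auto simp: topdiff_less_def)
  show ?thesis
  proof (cases "b = 0 \<and> Suc (f 0) = g 0")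
    case True
    then have "next_pos f c = g c" for c using b(2)[of c] by (cases "c = 0") (auto simp: next_pos_def)
    then show ?thesis by blast
  next
    case False
    then have "next_pos f b < g b" using b(1) by (auto simp: next_pos_def)
    then show ?thesis unfolding topdiff_less_def using b(2) by (intro disjI2 exI[of _ b]) (auto simp: next_pos_def)
  qed
qed

lemma less_next_pos: "f \<sqsubset> next_pos f"
  unfolding topdiff_less_def by (intro exI[of _ 0]) (auto simp: next_pos_def)

lemma minim_osuc: "wo_rel.minim (osuc (omega_pow n)) (Field (osuc (omega_pow n))) = opt_of n (\<lambda>_. 0)"
proof -
  interpret wo_rel "osuc (omega_pow n)" by (rule wo_rel_osuc)
  let ?R = "osuc (omega_pow n)"
  have z: "opt_of n (\<lambda>_. 0) \<in> Field ?R" "code_opt n (opt_of n (\<lambda>_. 0)) = (\<lambda>_. 0)"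
    using opt_of_in[of "\<lambda>_. 0" n] by (auto simp: positions_le_def)
  have "opt_of n (\<lambda>_. 0) = minim (Field ?R)"
  proof (rule equals_minim)
    fix b assume b: "b \<in> Field ?R"
    then have t: "code_opt n b \<in> tuples_upto (Suc n)"
      using code_opt_in[OF b] unit_at_Suc tuples_upto_Suc by (auto simp: positions_le_def)
    then have "code_opt n b = (\<lambda>_. 0) \<or> (\<lambda>_. 0) \<sqsubset> code_opt n b" by (rule colex_zero_le)
    then show "(opt_of n (\<lambda>_. 0), b) \<in> ?R" using b z inj_code_opt[OF z(1) b] by (auto simp: in_osuc)
  qed (use z in auto)
  then show ?thesis by simp
qed

lemma suc_osuc:
  assumes f: "f \<in> tuples_upto n"
  shows "wo_rel.suc (osuc (omega_pow n)) {opt_of n f} = opt_of n (next_pos f)"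
proof -
  interpret wo_rel "osuc (omega_pow n)" by (rule wo_rel_osuc)
  let ?R = "osuc (omega_pow n)"
  have f': "opt_of n f \<in> Field ?R" "code_opt n (opt_of n f) = f" using opt_of_in[of f n] f by (auto simp: positions_le_def)
  have g: "opt_of n (next_pos f) \<in> Field ?R" "code_opt n (opt_of n (next_pos f)) = next_pos f"
    using opt_of_in[OF next_pos_positions[OF f]] by auto
  have A: "AboveS {opt_of n f} = {q\<in>Field ?R. f \<sqsubset> code_opt n q}"
    unfolding Order_Relation.AboveS_def using f' by (auto simp: in_osuc topdiff_irrefl)
  have "opt_of n (next_pos f) = minim (AboveS {opt_of n f})"
  proof (rule equals_minim)
    show "opt_of n (next_pos f) \<in> AboveS {opt_of n f}" unfolding A using g less_next_pos by simp
    fix b assume "b \<in> AboveS {opt_of n f}"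
    then have b: "b \<in> Field ?R" "f \<sqsubset> code_opt n b" unfolding A by auto
    then show "(opt_of n (next_pos f), b) \<in> ?R"
      using next_pos_least[OF b(2)] g inj_code_opt[OF g(1) b(1)] by (auto simp: in_osuc)
  qed (auto simp: A)
  then show ?thesis by (simp add: suc_def)
qed

lemma limit_osuc:
  "limit_position (osuc (omega_pow n)) p \<longleftrightarrow> p \<in> Field (osuc (omega_pow n)) \<and> code_opt n p \<noteq> (\<lambda>_. 0) \<and> code_opt n p 0 = 0"
proof (cases "p \<in> Field (osuc (omega_pow n))")
  case p: True
  let ?R = "osuc (omega_pow n)" and ?f = "code_opt n p"
  have f: "?f \<in> positions_le n" "opt_of n ?f = p" using code_opt_in[OF p] by auto
  have ft: "?f \<in> tuples_upto (Suc n)" using f(1) unit_at_Suc tuples_upto_Suc by (auto simp: positions_le_def)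
  have z: "opt_of n (\<lambda>_. 0) \<in> Field ?R" "code_opt n (opt_of n (\<lambda>_. 0)) = (\<lambda>_. 0)"
    using opt_of_in[of "\<lambda>_. 0" n] by (auto simp: positions_le_def)
  have 1: "underS ?R p \<noteq> {} \<longleftrightarrow> ?f \<noteq> (\<lambda>_. 0)"
  proof
    assume "underS ?R p \<noteq> {}"
    then show "?f \<noteq> (\<lambda>_. 0)" by (auto simp: in_underS_osuc topdiff_less_def)
  next
    assume "?f \<noteq> (\<lambda>_. 0)"
    then have "opt_of n (\<lambda>_. 0) \<in> underS ?R p" using zero_less[OF _ ft] p z by (simp add: in_underS_osuc)
    then show "underS ?R p \<noteq> {}" by blast
  qed
  have 2: "(\<forall>j\<in>underS ?R p. wo_rel.suc ?R {j} \<noteq> p) \<longleftrightarrow> ?f 0 = 0"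
  proof
    assume *: "\<forall>j\<in>underS ?R p. wo_rel.suc ?R {j} \<noteq> p"
    show "?f 0 = 0"
    proof (rule ccontr)
      assume "?f 0 \<noteq> 0"
      define g where "g = ?f(0 := ?f 0 - 1)"
      have ng: "next_pos g = ?f" using \<open>?f 0 \<noteq> 0\<close> by (auto simp: g_def next_pos_def)
      then have less: "g \<sqsubset> ?f" using less_next_pos[of g] by simp
      then have gt: "g \<in> tuples_upto n" using below_positions_le f(1) by blast
      then have "opt_of n g \<in> Field ?R" "code_opt n (opt_of n g) = g" using opt_of_in[of g n] by (auto simp: positions_le_def)
      then have "opt_of n g \<in> underS ?R p" using less p by (simp add: in_underS_osuc)
      moreover have "wo_rel.suc ?R {opt_of n g} = p" using suc_osuc[OF gt] ng f(2) by simp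
      ultimately show False using * by blast
    qed
  next
    assume 0: "?f 0 = 0"
    show "\<forall>j\<in>underS ?R p. wo_rel.suc ?R {j} \<noteq> p"
    proof
      fix j assume "j \<in> underS ?R p"
      then have j: "j \<in> Field ?R" "code_opt n j \<sqsubset> ?f" by (auto simp: in_underS_osuc)
      have jt: "code_opt n j \<in> tuples_upto n" using below_positions_le[OF j(2) f(1)] .
      have "wo_rel.suc ?R {j} = opt_of n (next_pos (code_opt n j))" using suc_osuc[OF jt] code_opt_in[OF j(1)] by simp
      then have "code_opt n (wo_rel.suc ?R {j}) = next_pos (code_opt n j)" using opt_of_in[OF next_pos_positions[OF jt]] by simp
      then show "wo_rel.suc ?R {j} \<noteq> p" using 0 by (auto simp: next_pos_def)
    qed
  qed
  show ?thesis unfolding limit_position_def using p 1 2 by blast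
qed (simp add: limit_position_def)

lemma Inf_states_osuc:
  assumes p: "p \<in> Field (osuc (omega_pow n))"
  shows "Inf_states (osuc (omega_pow n)) x p = inf_before (\<lambda>f. x (opt_of n f)) (code_opt n p)"
proof -
  let ?R = "osuc (omega_pow n)" and ?f = "code_opt n p"
  have f: "?f \<in> positions_le n" using code_opt_in[OF p] by auto
  have trans: "opt_of n g \<in> underS ?R p \<and> code_opt n (opt_of n g) = g" if "g \<sqsubset> ?f" for g
    using opt_of_in[of g n] below_positions_le[OF that f] p that by (auto simp: positions_le_def in_underS_osuc)
  show ?thesis
  proof (intro set_eqI iffI)
    fix q assume q: "q \<in> Inf_states ?R x p"
    have "\<exists>\<nu>. \<mu> \<sqsubset> \<nu> \<and> \<nu> \<sqsubset> ?f \<and> x (opt_of n \<nu>) = q" if \<mu>: "\<mu> \<sqsubset> ?f" for \<mu>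
    proof -
      obtain \<nu> where \<nu>: "\<nu> \<in> underS ?R p" "opt_of n \<mu> \<in> underS ?R \<nu>" "x \<nu> = q"
        using q trans[OF \<mu>] unfolding Inf_states_def by blast
      then show ?thesis using trans[OF \<mu>] code_opt_in[of \<nu> n] by (intro exI[of _ "code_opt n \<nu>"]) (auto simp: in_underS_osuc)
    qed
    then show "q \<in> inf_before (\<lambda>f. x (opt_of n f)) ?f" by (simp add: inf_before_def)
  next
    fix q assume q: "q \<in> inf_before (\<lambda>f. x (opt_of n f)) ?f"
    have "\<exists>\<nu>\<in>underS ?R p. \<mu> \<in> underS ?R \<nu> \<and> x \<nu> = q" if "\<mu> \<in> underS ?R p" for \<mu>
    proof -
      have \<mu>: "\<mu> \<in> Field ?R" "code_opt n \<mu> \<sqsubset> ?f" using that by (auto simp: in_underS_osuc)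
      obtain \<nu> where \<nu>: "code_opt n \<mu> \<sqsubset> \<nu>" "\<nu> \<sqsubset> ?f" "x (opt_of n \<nu>) = q"
        using q \<mu>(2) unfolding inf_before_def by blast
      then show ?thesis using trans[OF \<nu>(2)] \<mu>(1) by (intro bexI[of _ "opt_of n \<nu>"]) (auto simp: in_underS_osuc)
    qed
    then show "q \<in> Inf_states ?R x p" by (simp add: Inf_states_def)
  qed
qed

text \<open>The condition that all states of a run are states of the automaton follows from the other ones:
  every state other than the initial one is the target of a transition.\<close>
lemma is_run_iff:
  assumes A: "ordinal_automaton A"
  shows "is_run (omega_pow n) A \<sigma> x \<longleftrightarrow> x (opt_of n (\<lambda>_. 0)) = initial A \<and>
     run_seg (succ_trans A) (lim_trans A) n (\<lambda>f. \<sigma> (pos_of n f)) (\<lambda>f. x (opt_of n f))"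
proof -
  let ?R = "osuc (omega_pow n)" and ?x = "\<lambda>f. x (opt_of n f)"
  have sub: "succ_trans A \<subseteq> states A \<times> alphabet A \<times> states A" "lim_trans A \<subseteq> Pow (states A) \<times> states A" "initial A \<in> states A"
    using A by (auto simp: ordinal_automaton_def)
  have Some_eq: "opt_of n f = Some (pos_of n f)" if "f \<in> tuples_upto n" for f
    using that unit_not_tuples by (auto simp: opt_of_def)
  have 1: "(\<forall>i\<in>Field (omega_pow n). (x (Some i), \<sigma> i, x (wo_rel.suc ?R {Some i})) \<in> succ_trans A) \<longleftrightarrow>
      (\<forall>f\<in>tuples_upto n. (?x f, \<sigma> (pos_of n f), ?x (next_pos f)) \<in> succ_trans A)"
  proof (intro iffI ballI)
    fix f assume *: "\<forall>i\<in>Field (omega_pow n). (x (Some i), \<sigma> i, x (wo_rel.suc ?R {Some i})) \<in> succ_trans A"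
      and f: "f \<in> tuples_upto n"
    show "(?x f, \<sigma> (pos_of n f), ?x (next_pos f)) \<in> succ_trans A"
      using bspec[OF * conjunct1[OF pos_of[OF f]]] suc_osuc[OF f] Some_eq[OF f] by simp
  next
    fix i assume *: "\<forall>f\<in>tuples_upto n. (?x f, \<sigma> (pos_of n f), ?x (next_pos f)) \<in> succ_trans A"
      and i: "i \<in> Field (omega_pow n)"
    have f: "code_pos n i \<in> tuples_upto n" by (rule code_pos_tuples[OF i])
    show "(x (Some i), \<sigma> i, x (wo_rel.suc ?R {Some i})) \<in> succ_trans A"
      using bspec[OF * f] suc_osuc[OF f] Some_eq[OF f] pos_of_code_pos[OF i] by simp
  qed
  have 2: "(\<forall>i. limit_position ?R i \<longrightarrow> (Inf_states ?R x i, x i) \<in> lim_trans A) \<longleftrightarrow>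
      (\<forall>f\<in>positions_le n. f \<noteq> (\<lambda>_. 0) \<longrightarrow> f 0 = 0 \<longrightarrow> (inf_before ?x f, ?x f) \<in> lim_trans A)"
  proof (intro iffI ballI allI impI)
    fix f assume *: "\<forall>i. limit_position ?R i \<longrightarrow> (Inf_states ?R x i, x i) \<in> lim_trans A"
      and f: "f \<in> positions_le n" "f \<noteq> (\<lambda>_. 0)" "f 0 = 0"
    show "(inf_before ?x f, ?x f) \<in> lim_trans A"
      using spec[OF *, of "opt_of n f"] opt_of_in[OF f(1)] f by (simp add: limit_osuc Inf_states_osuc)
  next
    fix i assume *: "\<forall>f\<in>positions_le n. f \<noteq> (\<lambda>_. 0) \<longrightarrow> f 0 = 0 \<longrightarrow> (inf_before ?x f, ?x f) \<in> lim_trans A"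
      and i: "limit_position ?R i"
    then have i': "i \<in> Field ?R" "code_opt n i \<noteq> (\<lambda>_. 0)" "code_opt n i 0 = 0" by (auto simp: limit_osuc)
    have c: "code_opt n i \<in> positions_le n" "opt_of n (code_opt n i) = i" using code_opt_in[OF i'(1)] by auto
    show "(Inf_states ?R x i, x i) \<in> lim_trans A"
      using * c i' by (auto simp: Inf_states_osuc)
  qed
  have 3: "x i \<in> states A" if "x (opt_of n (\<lambda>_. 0)) = initial A"
     "run_seg (succ_trans A) (lim_trans A) n (\<lambda>f. \<sigma> (pos_of n f)) ?x" "i \<in> Field ?R" for i
  proof -
    let ?f = "code_opt n i"
    have f: "?f \<in> positions_le n" "opt_of n ?f = i" using code_opt_in[OF that(3)] by auto
    consider "?f = (\<lambda>_. 0)" | "?f \<noteq> (\<lambda>_. 0)" "?f 0 = 0" | "?f 0 \<noteq> 0" by blast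
    then have "?x ?f \<in> states A"
    proof cases
      case 1
      then show ?thesis using that(1) sub(3) by simp
    next
      case 2
      then have "(inf_before ?x ?f, ?x ?f) \<in> lim_trans A" using that(2) f(1) by (simp add: run_seg_def)
      then show ?thesis using sub(2) by blast
    next
      case 3
      define g where "g = ?f(0 := ?f 0 - 1)"
      have ng: "next_pos g = ?f" using 3 by (auto simp: g_def next_pos_def)
      have "g \<sqsubset> ?f" using less_next_pos[of g] by (simp only: ng)
      then have gt: "g \<in> tuples_upto n" using f(1) by (rule below_positions_le)
      have "(?x g, \<sigma> (pos_of n g), ?x (next_pos g)) \<in> succ_trans A" using that(2) gt unfolding run_seg_def by blast
      then show ?thesis using sub(1) unfolding ng by auto
    qed
    then show ?thesis by (simp only: f(2))
  qed
  have "is_run (omega_pow n) A \<sigma> x \<longleftrightarrow> (\<forall>i\<in>Field ?R. x i \<in> states A) \<and> x (opt_of n (\<lambda>_. 0)) = initial A \<and>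
      run_seg (succ_trans A) (lim_trans A) n (\<lambda>f. \<sigma> (pos_of n f)) ?x"
    unfolding is_run_def run_seg_def minim_osuc 1 2 by (rule refl)
  then show ?thesis using 3 by blast
qed

theorem language_omega_pow:
  assumes A: "ordinal_automaton A"
  shows "\<sigma> \<in> language (omega_pow n) A \<longleftrightarrow> \<sigma> \<in> words (omega_pow n) (alphabet A) \<and>
     (\<exists>x. run_seg (succ_trans A) (lim_trans A) n (\<lambda>f. \<sigma> (pos_of n f)) x \<and> x (\<lambda>_. 0) = initial A \<and> x (unit_at n) \<in> final A)"
proof -
  have u: "opt_of n (unit_at n) = None" by (simp add: opt_of_def)
  have "(\<exists>x. is_run (omega_pow n) A \<sigma> x \<and> x None \<in> final A) \<longleftrightarrow>
     (\<exists>x. run_seg (succ_trans A) (lim_trans A) n (\<lambda>f. \<sigma> (pos_of n f)) x \<and> x (\<lambda>_. 0) = initial A \<and> x (unit_at n) \<in> final A)"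
  proof
    assume "\<exists>x. is_run (omega_pow n) A \<sigma> x \<and> x None \<in> final A"
    then obtain x where x: "is_run (omega_pow n) A \<sigma> x" "x None \<in> final A" by blast
    then show "\<exists>x. run_seg (succ_trans A) (lim_trans A) n (\<lambda>f. \<sigma> (pos_of n f)) x \<and> x (\<lambda>_. 0) = initial A \<and> x (unit_at n) \<in> final A"
      using u unfolding is_run_iff[OF A] by (intro exI[of _ "\<lambda>f. x (opt_of n f)"]) simp
  next
    assume "\<exists>x. run_seg (succ_trans A) (lim_trans A) n (\<lambda>f. \<sigma> (pos_of n f)) x \<and> x (\<lambda>_. 0) = initial A \<and> x (unit_at n) \<in> final A"
    then obtain x where x: "run_seg (succ_trans A) (lim_trans A) n (\<lambda>f. \<sigma> (pos_of n f)) x" "x (\<lambda>_. 0) = initial A" "x (unit_at n) \<in> final A"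
      by blast
    define y where "y p = x (code_opt n p)" for p
    have y: "y (opt_of n f) = x f" if "f \<in> positions_le n" for f using opt_of_in[OF that] by (simp add: y_def)
    have "run_seg (succ_trans A) (lim_trans A) n (\<lambda>f. \<sigma> (pos_of n f)) (\<lambda>f. y (opt_of n f))"
    proof -
      have "inf_before (\<lambda>f. y (opt_of n f)) f = inf_before x f" if "f \<in> positions_le n" for f
        by (rule inf_before_cong, rule y) (use below_positions_le[OF _ that] in \<open>simp add: positions_le_def\<close>)
      moreover have "f \<in> positions_le n" if "f \<in> tuples_upto n" for f using that by (simp add: positions_le_def)
      ultimately show ?thesis using x(1) unfolding run_seg_def by (simp add: y next_pos_positions)
    qed
    moreover have "y (opt_of n (\<lambda>_. 0)) = initial A" using y[of "\<lambda>_. 0"] x(2) by (simp add: positions_le_def)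
    moreover have "y None \<in> final A" using x(3) by (simp add: y_def code_opt_def)
    ultimately show "\<exists>x. is_run (omega_pow n) A \<sigma> x \<and> x None \<in> final A"
      unfolding is_run_iff[OF A] by blast
  qed
  then show ?thesis by (simp add: language_def)
qed

section \<open>Automatic ordinals are below \<open>\<omega>^(\<omega>^n)\<close>\<close>
lemma partial_prod_pair:
  "partial_prod (\<lambda>a b. (m1 (fst a) (fst b), m2 (snd a) (snd b))) (o1, o2) s k =
     (partial_prod m1 o1 (\<lambda>i. fst (s i)) k, partial_prod m2 o2 (\<lambda>i. snd (s i)) k)"
  by (induction k) auto

lemma omega_monoid_prod:
  assumes "omega_monoid m1 o1 O1 T1" "omega_monoid m2 o2 O2 T2"
  shows "omega_monoid (\<lambda>a b. (m1 (fst a) (fst b), m2 (snd a) (snd b))) (o1, o2)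
     (\<lambda>s. (O1 (\<lambda>i. fst (s i)), O2 (\<lambda>i. snd (s i)))) (T1 \<times> T2)"
proof -
  interpret a: omega_monoid m1 o1 O1 T1 by fact
  interpret b: omega_monoid m2 o2 O2 T2 by fact
  show ?thesis
  proof
    show "(O1 (\<lambda>i. fst (s i)), O2 (\<lambda>i. snd (s i))) =
        (O1 (\<lambda>i. fst (partial_prod (\<lambda>a b. (m1 (fst a) (fst b), m2 (snd a) (snd b))) (o1, o2) (shift s (k i)) (k (Suc i) - k i))),
         O2 (\<lambda>i. snd (partial_prod (\<lambda>a b. (m1 (fst a) (fst b), m2 (snd a) (snd b))) (o1, o2) (shift s (k i)) (k (Suc i) - k i))))"
      if "strict_mono k" "k 0 = 0" for k and s :: "nat \<Rightarrow> 'a \<times> 'b"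
      using a.Om_factor[OF that, of "\<lambda>i. fst (s i)"] b.Om_factor[OF that, of "\<lambda>i. snd (s i)"]
      by (simp add: partial_prod_pair shift_def)
    show "(O1 (\<lambda>i. fst (s i)), O2 (\<lambda>i. snd (s i))) =
        (m1 (fst (s 0)) (fst (O1 (\<lambda>i. fst (s (Suc i))), O2 (\<lambda>i. snd (s (Suc i))))),
         m2 (snd (s 0)) (snd (O1 (\<lambda>i. fst (s (Suc i))), O2 (\<lambda>i. snd (s (Suc i))))))"
      for s :: "nat \<Rightarrow> 'a \<times> 'b"
      using a.Om_unfold[of "\<lambda>i. fst (s i)"] b.Om_unfold[of "\<lambda>i. snd (s i)"] by simp
    show "(O1 (\<lambda>i. fst (s i)), O2 (\<lambda>i. snd (s i))) \<in> T1 \<times> T2" if "\<And>i. s i \<in> T1 \<times> T2" for s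
    proof -
      have "fst (s i) \<in> T1" "snd (s i) \<in> T2" for i using that[of i] by auto
      then show ?thesis using a.Om_T b.Om_T by simp
    qed
  qed (auto simp: a.assoc b.assoc a.one_left b.one_left a.one_right b.one_right a.finite_T b.finite_T a.mult_T b.mult_T)
qed

lemma type_bounded_transfer:
  assumes bd: "type_bounded n X t" and \<phi>: "\<And>v. v \<in> X' \<Longrightarrow> \<phi> v \<in> X"
    and \<psi>: "\<And>y. y \<in> X \<Longrightarrow> \<psi> y \<in> X' \<and> \<phi> (\<psi> y) = y"
    and t': "\<And>v w. v \<in> X' \<Longrightarrow> w \<in> X' \<Longrightarrow> t' v w = t (\<phi> v) (\<phi> w)"
  shows "type_bounded n X' t'"
  unfolding type_bounded_def
proof (intro allI impI)
  fix F G assume wo: "strict_wo {x\<in>X'. t' x x \<in> G} (\<lambda>x y. t' x y \<in> F)"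
  have "strict_wo {x\<in>X. t x x \<in> G} (\<lambda>x y. t x y \<in> F)"
  proof (rule strict_wo_pullback[OF wo, of _ \<psi>])
    show "inj_on \<psi> {x\<in>X. t x x \<in> G}" using \<psi> by (intro inj_on_inverseI[of _ \<phi>]) auto
  qed (use \<psi> t' in auto)
  then obtain a where a: "a \<in> tuples_upto n" "pow_bounded (\<lambda>x y. t x y \<in> F) a {x\<in>X. t x x \<in> G}"
    using bd unfolding type_bounded_def by blast
  have "pow_bounded (\<lambda>x y. t' x y \<in> F) a {x\<in>X'. t' x x \<in> G}"
    by (rule pow_bounded_pullback[OF a(2), of _ \<phi>]) (use \<phi> t' in auto)
  then show "\<exists>a\<in>tuples_upto n. pow_bounded (\<lambda>x y. t' x y \<in> F) a {x\<in>X'. t' x x \<in> G}" using a(1) by blast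
qed

lemma run_type_cong:
  "(\<And>f. f \<in> tuples_upto n \<Longrightarrow> v f = w f) \<Longrightarrow> run_type \<Delta> \<gamma> n v = run_type \<Delta> \<gamma> n w"
proof (induction n arbitrary: v w)
  case (Suc n)
  have "run_type \<Delta> \<gamma> n (\<lambda>f. v (in_block n i f)) = run_type \<Delta> \<gamma> n (\<lambda>f. w (in_block n i f))" for i
    by (rule Suc.IH) (use Suc.prems in_block_tuples in blast)
  then show ?case by simp
qed simp

lemma run_type_in:
  assumes \<Delta>: "\<Delta> \<subseteq> Q \<times> S \<times> Q" and \<gamma>: "\<gamma> \<subseteq> Pow Q \<times> Q" and Q: "finite Q"
  shows "run_type \<Delta> \<gamma> n w \<in> Pow (Q \<times> Pow Q \<times> Q)"
proof (induction n arbitrary: w)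
  case 0
  show ?case using \<Delta> by auto
next
  case (Suc n)
  then show ?case using omega_monoid.Om_T[OF omega_monoid_run_types[OF Q \<gamma>]] by simp
qed

text \<open>A word has a type for the automaton of the domain, and a pair of words has one for the automaton of
  the relation; both are needed at once, so the types of pairs lie in a product of two monoids. The
  induction on \<open>n\<close> splits a word of length \<open>\<omega>^(n+1)\<close> into the sequence of its blocks.\<close>
lemma type_bounded_run_types:
  assumes \<Sigma>: "finite \<Sigma>" and Q1: "finite Q1" and \<Delta>1: "\<Delta>1 \<subseteq> Q1 \<times> S1 \<times> Q1" and \<gamma>1: "\<gamma>1 \<subseteq> Pow Q1 \<times> Q1"
    and Q2: "finite Q2" and \<Delta>2: "\<Delta>2 \<subseteq> Q2 \<times> S2 \<times> Q2" and \<gamma>2: "\<gamma>2 \<subseteq> Pow Q2 \<times> Q2"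
  shows "type_bounded n (tuples_upto n \<rightarrow>\<^sub>E \<Sigma>)
     (\<lambda>v w. (run_type \<Delta>1 \<gamma>1 n v, run_type \<Delta>2 \<gamma>2 n (\<lambda>f. [v f, w f])))"
proof (induction n)
  case 0
  show ?case
    unfolding type_bounded_def
  proof (intro allI impI)
    let ?t = "\<lambda>v w. (run_type \<Delta>1 \<gamma>1 0 v, run_type \<Delta>2 \<gamma>2 0 (\<lambda>f. [v f, w f]))"
    let ?X = "tuples_upto 0 \<rightarrow>\<^sub>E \<Sigma>"
    fix F G assume wo: "strict_wo {x\<in>?X. ?t x x \<in> G} (\<lambda>x y. ?t x y \<in> F)"
    have "tuples_upto 0 = {\<lambda>_. 0}" by (auto simp: tuples_upto_def)
    then have "finite ?X" using \<Sigma> by (simp add: finite_PiE)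
    then have "pow_bounded (\<lambda>x y. ?t x y \<in> F) (\<lambda>_. 0) {x\<in>?X. ?t x x \<in> G}"
      using strict_wo_irrefl[OF wo] by (intro pow_bounded_finite) simp_all
    then show "\<exists>a\<in>tuples_upto 0. pow_bounded (\<lambda>x y. ?t x y \<in> F) a {x\<in>?X. ?t x x \<in> G}"
      using tuples_upto_zero by blast
  qed
next
  case (Suc n)
  let ?X = "tuples_upto n \<rightarrow>\<^sub>E \<Sigma>"
  let ?t = "\<lambda>v w. (run_type \<Delta>1 \<gamma>1 n v, run_type \<Delta>2 \<gamma>2 n (\<lambda>f. [v f, w f]))"
  let ?Om = "\<lambda>s. (rt_omega \<gamma>1 (\<lambda>i. fst (s i)), rt_omega \<gamma>2 (\<lambda>i. snd (s i)))"
  note om = omega_monoid_prod[OF omega_monoid_run_types[OF Q1 \<gamma>1] omega_monoid_run_types[OF Q2 \<gamma>2]]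
  have "type_bounded (Suc n) {x. \<forall>i. x i \<in> ?X} (\<lambda>x y. ?Om (\<lambda>i. ?t (x i) (y i)))"
    by (rule type_bounded_omega_words[OF om _ Suc])
      (use run_type_in[OF \<Delta>1 \<gamma>1 Q1] run_type_in[OF \<Delta>2 \<gamma>2 Q2] in blast)
  then show ?case
  proof (rule type_bounded_transfer[where \<phi> = "\<lambda>v i. \<lambda>f\<in>tuples_upto n. v (in_block n i f)"
        and \<psi> = "\<lambda>x. \<lambda>f\<in>tuples_upto (Suc n). x (f n) (f(n := 0))"])
    show "(\<lambda>i. \<lambda>f\<in>tuples_upto n. v (in_block n i f)) \<in> {x. \<forall>i. x i \<in> ?X}"
      if "v \<in> tuples_upto (Suc n) \<rightarrow>\<^sub>E \<Sigma>" for v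
      using that in_block_tuples by (auto simp: PiE_def Pi_def)
    show "(\<lambda>f\<in>tuples_upto (Suc n). y (f n) (f(n := 0))) \<in> tuples_upto (Suc n) \<rightarrow>\<^sub>E \<Sigma> \<and>
        (\<lambda>i. \<lambda>f\<in>tuples_upto n. (\<lambda>f\<in>tuples_upto (Suc n). y (f n) (f(n := 0))) (in_block n i f)) = y"
      if y: "y \<in> {x. \<forall>i. x i \<in> ?X}" for y
    proof
      show "(\<lambda>f\<in>tuples_upto (Suc n). y (f n) (f(n := 0))) \<in> tuples_upto (Suc n) \<rightarrow>\<^sub>E \<Sigma>"
        using y in_block_split[of _ n] by (auto simp: PiE_def Pi_def)
      show "(\<lambda>i. \<lambda>f\<in>tuples_upto n. (\<lambda>f\<in>tuples_upto (Suc n). y (f n) (f(n := 0))) (in_block n i f)) = y"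
      proof (intro ext)
        fix i f
        show "(\<lambda>f\<in>tuples_upto n. (\<lambda>f\<in>tuples_upto (Suc n). y (f n) (f(n := 0))) (in_block n i f)) f = y i f"
        proof (cases "f \<in> tuples_upto n")
          case True
          then have "(in_block n i f)(n := 0) = f" by (auto simp: in_block_def tuples_upto_def)
          then show ?thesis using True in_block_tuples[OF True] in_block_top[OF True] by simp
        next
          case False
          have "y i \<in> ?X" using y by blast
          then show ?thesis using False PiE_arb[of "y i" "tuples_upto n" "\<lambda>_. \<Sigma>" f] by simp
        qed
      qed
    qed
    fix v w assume vw: "v \<in> tuples_upto (Suc n) \<rightarrow>\<^sub>E \<Sigma>" "w \<in> tuples_upto (Suc n) \<rightarrow>\<^sub>E \<Sigma>"
    have 1: "run_type \<Delta>1 \<gamma>1 n (\<lambda>f. v (in_block n i f)) = run_type \<Delta>1 \<gamma>1 n (\<lambda>f\<in>tuples_upto n. v (in_block n i f))" for i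
      by (rule run_type_cong) simp
    have 2: "run_type \<Delta>2 \<gamma>2 n (\<lambda>f. [v (in_block n i f), w (in_block n i f)]) =
        run_type \<Delta>2 \<gamma>2 n (\<lambda>f. [(\<lambda>f\<in>tuples_upto n. v (in_block n i f)) f, (\<lambda>f\<in>tuples_upto n. w (in_block n i f)) f])" for i
      by (rule run_type_cong) simp
    show "(run_type \<Delta>1 \<gamma>1 (Suc n) v, run_type \<Delta>2 \<gamma>2 (Suc n) (\<lambda>f. [v f, w f])) =
        ?Om (\<lambda>i. ?t (\<lambda>f\<in>tuples_upto n. v (in_block n i f)) (\<lambda>f\<in>tuples_upto n. w (in_block n i f)))"
      by (simp only: run_type.simps 1 2 fst_conv snd_conv)
  qed
qed

definition accepting :: "('l, 'q) automaton \<Rightarrow> 'q run_type set" where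
  "accepting A = {\<tau>. \<exists>P q. (initial A, P, q) \<in> \<tau> \<and> q \<in> final A}"

lemma language_run_type:
  assumes A: "ordinal_automaton A"
  shows "\<sigma> \<in> language (omega_pow n) A \<longleftrightarrow> \<sigma> \<in> words (omega_pow n) (alphabet A) \<and>
     run_type (succ_trans A) (lim_trans A) n (\<lambda>f. \<sigma> (pos_of n f)) \<in> accepting A"
  unfolding language_omega_pow[OF A] accepting_def mem_Collect_eq run_type_iff by blast

text \<open>The order of the presentation is determined by types of words, so it is bounded by some power
  \<open>\<omega>^a\<close> with \<open>a < \<omega>\<^sup>n\<close>, and the isomorphism carries this bound over to \<open>\<alpha>\<close>.\<close>
theorem automatic_imp_less:
  fixes \<alpha> :: "'a rel"
  assumes \<alpha>: "Well_order \<alpha>" and aut: "injectively_automatic (omega_pow n) (ordinal_structure \<alpha>)"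
  shows "(\<alpha>, opow natLeq (omega_pow n)) \<in> ordLess"
proof -
  let ?r = "omega_pow n"
  obtain A :: "(nat, nat) automaton" and Bs :: "(nat \<times> (nat list, nat) automaton) list" and h
    where A: "ordinal_automaton A" and Bs: "\<forall>(k, B) \<in> set Bs. ordinal_automaton B \<and> alphabet B = tuples k (alphabet A)"
      and iso: "relstruct_iso h (language ?r A, map (\<lambda>(k, B). (k, accepted_relation ?r (alphabet A) k B)) Bs) (ordinal_structure \<alpha>)"
    using aut unfolding injectively_automatic_def Let_def by blast
  let ?L = "language ?r A" and ?\<Sigma> = "alphabet A"
  have "map fst (map (\<lambda>(k, B). (k, accepted_relation ?r ?\<Sigma> k B)) Bs) = [2]"
    using iso by (simp add: relstruct_iso_def ordinal_structure_def)
  then obtain B where Bs_eq: "Bs = [(2, B)]" by (cases Bs) (auto split: prod.splits)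
  have B: "ordinal_automaton B" "alphabet B = tuples 2 ?\<Sigma>" using Bs by (auto simp: Bs_eq)
  let ?R = "accepted_relation ?r ?\<Sigma> 2 B"
  have bij: "bij_betw h ?L (Field \<alpha>)" using iso by (simp add: relstruct_iso_def ordinal_structure_def)
  have R: "[v, w] \<in> ?R \<longleftrightarrow> h v \<in> underS \<alpha> (h w)" if "v \<in> ?L" "w \<in> ?L" for v w
  proof -
    have "[v, w] \<in> tuples 2 ?L" using that by (simp add: tuples_def)
    then show ?thesis using iso by (auto simp: relstruct_iso_def ordinal_structure_def Bs_eq)
  qed
  define \<kappa> where "\<kappa> \<sigma> = (\<lambda>f\<in>tuples_upto n. \<sigma> (pos_of n f))" for \<sigma> :: "(nat \<Rightarrow> nat) \<Rightarrow> nat"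
  let ?t = "\<lambda>v w. (run_type (succ_trans A) (lim_trans A) n v, run_type (succ_trans B) (lim_trans B) n (\<lambda>f. [v f, w f]))"
  define t where "t v w = ?t (\<kappa> v) (\<kappa> w)" for v w
  have fin: "finite ?\<Sigma>" "finite (states A)" "finite (states B)"
    and sub: "succ_trans A \<subseteq> states A \<times> alphabet A \<times> states A" "lim_trans A \<subseteq> Pow (states A) \<times> states A"
      "succ_trans B \<subseteq> states B \<times> alphabet B \<times> states B" "lim_trans B \<subseteq> Pow (states B) \<times> states B"
    using A B(1) by (auto simp: ordinal_automaton_def)
  have bounded: "type_bounded n (words ?r ?\<Sigma>) t"
  proof (rule type_bounded_transfer[OF type_bounded_run_types[OF fin(1) fin(2) sub(1,2) fin(3) sub(3,4)],
        where \<phi> = \<kappa> and \<psi> = "\<lambda>y. \<lambda>c\<in>Field ?r. y (code_pos n c)"])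
    show "\<kappa> \<sigma> \<in> tuples_upto n \<rightarrow>\<^sub>E ?\<Sigma>" if "\<sigma> \<in> words ?r ?\<Sigma>" for \<sigma>
      using that pos_of[of _ n] by (auto simp: words_def \<kappa>_def PiE_def Pi_def)
    show "(\<lambda>c\<in>Field ?r. y (code_pos n c)) \<in> words ?r ?\<Sigma> \<and> \<kappa> (\<lambda>c\<in>Field ?r. y (code_pos n c)) = y"
      if y: "y \<in> tuples_upto n \<rightarrow>\<^sub>E ?\<Sigma>" for y
    proof
      show "(\<lambda>c\<in>Field ?r. y (code_pos n c)) \<in> words ?r ?\<Sigma>"
        using y code_pos_tuples by (auto simp: words_def PiE_def Pi_def)
      show "\<kappa> (\<lambda>c\<in>Field ?r. y (code_pos n c)) = y"
      proof
        fix f show "\<kappa> (\<lambda>c\<in>Field ?r. y (code_pos n c)) f = y f"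
          using pos_of[of f n] PiE_arb[OF y, of f] by (cases "f \<in> tuples_upto n") (simp_all add: \<kappa>_def)
      qed
    qed
  qed (simp add: t_def)
  define G where "G = {\<tau> :: nat run_type \<times> nat run_type. fst \<tau> \<in> accepting A}"
  define F where "F = {\<tau> :: nat run_type \<times> nat run_type. snd \<tau> \<in> accepting B}"
  have L: "?L = {\<sigma> \<in> words ?r ?\<Sigma>. t \<sigma> \<sigma> \<in> G}"
  proof -
    have "run_type (succ_trans A) (lim_trans A) n (\<kappa> \<sigma>) = run_type (succ_trans A) (lim_trans A) n (\<lambda>f. \<sigma> (pos_of n f))" for \<sigma>
      by (rule run_type_cong) (simp add: \<kappa>_def)
    then show ?thesis using language_run_type[OF A, of _ n] by (auto simp: t_def G_def)
  qed
  have lt: "t v w \<in> F \<longleftrightarrow> h v \<in> underS \<alpha> (h w)" if vw: "v \<in> ?L" "w \<in> ?L" for v w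
  proof -
    have words: "v \<in> words ?r ?\<Sigma>" "w \<in> words ?r ?\<Sigma>" using vw by (auto simp: language_def)
    have tw: "tuple_word ?r [v, w] \<in> words ?r (alphabet B)"
      using words by (auto simp: B(2) words_def tuple_word_def tuples_def PiE_def Pi_def)
    have "run_type (succ_trans B) (lim_trans B) n (\<lambda>f. [\<kappa> v f, \<kappa> w f]) =
        run_type (succ_trans B) (lim_trans B) n (\<lambda>f. tuple_word ?r [v, w] (pos_of n f))"
      by (rule run_type_cong) (use pos_of[of _ n] in \<open>simp add: \<kappa>_def tuple_word_def\<close>)
    then have "t v w \<in> F \<longleftrightarrow> tuple_word ?r [v, w] \<in> language ?r B"
      using language_run_type[OF B(1), of _ n] tw by (simp add: t_def F_def)
    also have "\<dots> \<longleftrightarrow> [v, w] \<in> ?R" using words by (simp add: accepted_relation_def tuples_def)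
    finally show ?thesis using R[OF vw] by simp
  qed
  have wo: "strict_wo ?L (\<lambda>v w. t v w \<in> F)"
    by (rule strict_wo_pullback[OF strict_wo_Well_order[OF \<alpha>], of _ h])
      (use bij lt in \<open>auto simp: bij_betw_def\<close>)
  have "strict_wo {\<sigma> \<in> words ?r ?\<Sigma>. t \<sigma> \<sigma> \<in> G} (\<lambda>v w. t v w \<in> F)" using wo by (simp only: L)
  from bounded[unfolded type_bounded_def, rule_format, OF this]
  have "\<exists>a\<in>tuples_upto n. pow_bounded (\<lambda>v w. t v w \<in> F) a ?L" by (simp only: L)
  then obtain a where a: "a \<in> tuples_upto n" "pow_bounded (\<lambda>v w. t v w \<in> F) a ?L" by (elim bexE)
  have inv: "inv_into ?L h i \<in> ?L" "h (inv_into ?L h i) = i" if "i \<in> Field \<alpha>" for i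
    using that bij by (auto simp: bij_betw_def inv_into_into f_inv_into_f)
  have "pow_bounded (\<lambda>x y. x \<in> underS \<alpha> y) a (Field \<alpha>)"
    by (rule pow_bounded_pullback[OF a(2), of _ "inv_into ?L h"]) (use inv lt in auto)
  then have "(\<alpha>, wo_of (fin_supp (tuples_upto n)) (topdiff_less colex)) \<in> ordLess"
    by (rule ordLess_if_pow_bounded[OF \<alpha> a(1)])
  then show ?thesis using ordLess_ordIso_trans ordIso_symmetric[OF ordIso_omega_omega_pow] by blast
qed

section \<open>Small ordinals as orders of finite sets\<close>

lemma ordLess_wo_ofE:
  assumes wo: "strict_wo A lt" and \<alpha>: "Well_order \<alpha>" and less: "(\<alpha>, wo_of A lt) \<in> ordLess"
  obtains u g where "u \<in> A" "bij_betw g (Field \<alpha>) {x\<in>A. lt x u}"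
    "\<And>i j. i \<in> Field \<alpha> \<Longrightarrow> j \<in> Field \<alpha> \<Longrightarrow> i \<in> underS \<alpha> j \<longleftrightarrow> lt (g i) (g j)"
proof -
  have W: "Well_order (wo_of A lt)" by (rule Well_order_wo_of[OF wo])
  obtain u where u: "u \<in> A" "(\<alpha>, Restr (wo_of A lt) (underS (wo_of A lt) u)) \<in> ordIso"
    using ordLess_iff_ordIso_Restr[OF W \<alpha>] less by auto
  have R: "Restr (wo_of A lt) (underS (wo_of A lt) u) = wo_of {x\<in>A. lt x u} lt"
    unfolding underS_wo_of[OF wo u(1)] by (auto simp: wo_of_def)
  obtain g where g: "iso \<alpha> (wo_of {x\<in>A. lt x u} lt) g" using u(2) unfolding R by (auto simp: ordIso_def)
  have bij: "bij_betw g (Field \<alpha>) {x\<in>A. lt x u}" using g by (simp add: iso_def)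
  have mono: "i \<in> underS \<alpha> j \<longleftrightarrow> lt (g i) (g j)" if ij: "i \<in> Field \<alpha>" "j \<in> Field \<alpha>" for i j
  proof -
    have gA: "g i \<in> {x\<in>A. lt x u}" "g j \<in> {x\<in>A. lt x u}" using bij ij by (auto simp: bij_betw_def)
    have "(i, j) \<in> \<alpha> \<longleftrightarrow> (g i, g j) \<in> wo_of {x\<in>A. lt x u} lt" using g ij unfolding iso_iff2 by blast
    then have "(i, j) \<in> \<alpha> \<longleftrightarrow> g i = g j \<or> lt (g i) (g j)" using gA by (simp add: wo_of_def)
    moreover have "g i = g j \<longleftrightarrow> i = j" using bij ij by (auto simp: bij_betw_def inj_on_def)
    ultimately show ?thesis using strict_wo_irrefl[OF wo] gA by (auto simp: underS_def)
  qed
  show ?thesis by (rule that[OF u(1) bij mono])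
qed

text \<open>The finite subsets of the tuples of length \<open>n + 1\<close> whose last coordinate is below \<open>m\<close>, given by their
  characteristic functions. The last coordinate is the track and the others are the position of a word
  of length \<open>\<omega>\<^sup>n\<close>.\<close>
definition track_functions :: "nat \<Rightarrow> nat \<Rightarrow> ((nat \<Rightarrow> nat) \<Rightarrow> nat) set" where
  "track_functions n m = {F \<in> fin_supp (tuples_upto (Suc n)). \<forall>e. F e \<le> 1 \<and> (F e \<noteq> 0 \<longrightarrow> e n < m)}"

lemma strict_wo_track_functions: "strict_wo (track_functions n m) (topdiff_less colex)"
  by (rule strict_wo_subset[OF strict_wo_powers]) (auto simp: track_functions_def)

text \<open>A coefficient \<open>w b\<close> at the exponent \<open>b\<close> becomes a set of \<open>w b\<close> tuples, which consist of a number
  below \<open>w b\<close> followed by \<open>b\<close>. In this way coefficients of any size are written with a finite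
  alphabet.\<close>
definition unary_code :: "nat \<Rightarrow> ((nat \<Rightarrow> nat) \<Rightarrow> nat) \<Rightarrow> (nat \<Rightarrow> nat) \<Rightarrow> nat" where
  "unary_code n w e = (if e \<in> tuples_upto (Suc n) \<and> e 0 < w (\<lambda>i. e (Suc i)) then 1 else 0)"

text \<open>If \<open>b\<close> is the largest difference and \<open>w b < w' b\<close>, then the largest difference of the codes is the
  largest tuple \<open>(w' b - 1, b)\<close> of the second one over \<open>b\<close>.\<close>
lemma unary_code_less:
  assumes w': "w' \<in> fin_supp (tuples_upto n)" and less: "w \<lless> w'"
  shows "unary_code n w \<lless> unary_code n w'"
proof -
  obtain b where b: "w b < w' b" "\<And>c. b \<sqsubset> c \<Longrightarrow> w c = w' c"
    using less unfolding topdiff_less_def[of colex] by blast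
  have bt: "b \<in> tuples_upto n" using b(1) fin_supp_outside[OF w'] by fastforce
  define e where "e = case_nat (w' b - 1) b"
  have e: "e \<in> tuples_upto (Suc n)" "e 0 = w' b - 1" "(\<lambda>i. e (Suc i)) = b"
    using bt by (auto simp: e_def tuples_upto_def split: nat.splits)
  have eq: "unary_code n w c = unary_code n w' c" if c: "e \<sqsubset> c" for c
  proof -
    obtain d where d: "e d < c d" "\<And>i. d < i \<Longrightarrow> e i = c i" using c by (auto simp: topdiff_less_def)
    show ?thesis
    proof (cases d)
      case 0
      then have "b i = c (Suc i)" for i using d(2)[of "Suc i"] e(3) by (simp add: fun_eq_iff)
      then have "(\<lambda>i. c (Suc i)) = b" by auto
      then show ?thesis using d(1) 0 e(2) b(1) by (auto simp: unary_code_def)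
    next
      case (Suc d')
      have "b \<sqsubset> (\<lambda>i. c (Suc i))"
        unfolding topdiff_less_def
      proof (intro exI[of _ d'] conjI allI impI)
        show "b d' < c (Suc d')" using d(1) Suc e(3) by (auto simp: fun_eq_iff)
        show "b i = c (Suc i)" if "d' < i" for i using d(2)[of "Suc i"] that Suc e(3) by (auto simp: fun_eq_iff)
      qed
      then show ?thesis using b(2) by (simp add: unary_code_def)
    qed
  qed
  have "unary_code n w e = 0" "unary_code n w' e = 1" using e b(1) by (auto simp: unary_code_def)
  then show ?thesis unfolding topdiff_less_def[of colex] using eq by (intro exI[of _ e]) auto
qed

lemma unary_code_track:
  assumes n: "n = Suc n'" and w: "w \<in> fin_supp (tuples_upto n)" and m: "\<And>b. w b \<noteq> 0 \<Longrightarrow> b n' < m"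
  shows "unary_code n w \<in> track_functions n m"
proof -
  let ?B = "\<Union>b\<in>{b. w b \<noteq> 0}. (\<lambda>k. case_nat k b) ` {..<w b}"
  have supp: "e \<in> ?B" if "unary_code n w e \<noteq> 0" for e
  proof -
    have e: "e 0 < w (\<lambda>i. e (Suc i))" using that by (auto simp: unary_code_def split: if_splits)
    have "e = case_nat (e 0) (\<lambda>i. e (Suc i))" by (auto split: nat.splits)
    then show ?thesis using e by (intro UN_I[of "\<lambda>i. e (Suc i)"] image_eqI[of _ _ "e 0"]) auto
  qed
  have "finite ?B" using fin_supp_finite[OF w] by simp
  moreover have "?B \<subseteq> tuples_upto (Suc n)"
  proof
    fix e assume "e \<in> ?B"
    then obtain b k where "w b \<noteq> 0" "e = case_nat k b" by blast
    moreover from \<open>w b \<noteq> 0\<close> have "b \<in> tuples_upto n" using fin_supp_outside[OF w, of b] by (cases "b \<in> tuples_upto n") simp_all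
    ultimately show "e \<in> tuples_upto (Suc n)" by (simp add: tuples_upto_def split: nat.splits)
  qed
  ultimately have "unary_code n w \<in> fin_supp (tuples_upto (Suc n))" by (rule fin_suppI) (rule supp)
  moreover have "e n < m" if "unary_code n w e \<noteq> 0" for e
    using m[of "\<lambda>i. e (Suc i)"] that by (auto simp: unary_code_def n split: if_splits)
  moreover have "unary_code n w e \<le> 1" for e by (simp add: unary_code_def)
  ultimately show ?thesis by (simp add: track_functions_def)
qed

text \<open>An ordinal below \<open>\<omega>^(\<omega>^n)\<close> lies below some function \<open>w0\<close> of finite support, so the last coordinates
  of all exponents involved are bounded by some \<open>m\<close>; as \<open>n \<ge> 1\<close>, they are the last
  coordinates of the codes as well. The image of the coding has gaps, but an ordinal that embeds below
  the code of \<open>w0\<close> is isomorphic to a proper initial segment of the track functions, with some other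
  bound \<open>u\<close>.\<close>
lemma segment_of_track_functions:
  assumes n: "1 \<le> n" and \<alpha>: "Well_order \<alpha>" and less: "(\<alpha>, opow natLeq (omega_pow n)) \<in> ordLess"
  obtains m u g where "u \<in> track_functions n m" "bij_betw g (Field \<alpha>) {F\<in>track_functions n m. F \<lless> u}"
    "\<And>i j. i \<in> Field \<alpha> \<Longrightarrow> j \<in> Field \<alpha> \<Longrightarrow> i \<in> underS \<alpha> j \<longleftrightarrow> g i \<lless> g j"
proof -
  let ?W = "fin_supp (tuples_upto n)"
  have "(\<alpha>, wo_of ?W (topdiff_less colex)) \<in> ordLess"
    using ordLess_ordIso_trans[OF less ordIso_omega_omega_pow] .
  then obtain w0 g0 where w0: "w0 \<in> ?W" and g0: "bij_betw g0 (Field \<alpha>) {x\<in>?W. x \<lless> w0}"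
    "\<And>i j. i \<in> Field \<alpha> \<Longrightarrow> j \<in> Field \<alpha> \<Longrightarrow> i \<in> underS \<alpha> j \<longleftrightarrow> g0 i \<lless> g0 j"
    by (rule ordLess_wo_ofE[OF strict_wo_powers \<alpha>]) blast
  obtain n' where n': "n = Suc n'" using n by (cases n) auto
  obtain m where m: "\<And>b. w0 b \<noteq> 0 \<Longrightarrow> b n' < m"
  proof -
    have "finite ((\<lambda>b. b n') ` {b. w0 b \<noteq> 0})" using fin_supp_finite[OF w0] by simp
    then obtain M where "\<forall>x\<in>(\<lambda>b. b n') ` {b. w0 b \<noteq> 0}. x \<le> M" using finite_nat_set_iff_bounded_le by blast
    then show ?thesis by (intro that[of "Suc M"]) (auto simp: less_Suc_eq_le)
  qed
  have mw: "b n' < m" if w: "w \<in> ?W" "w \<lless> w0" "w b \<noteq> 0" for w b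
  proof (rule ccontr)
    assume nm: "\<not> b n' < m"
    obtain c where c: "w c < w0 c" "\<And>d. c \<sqsubset> d \<Longrightarrow> w d = w0 d"
      using w(2) unfolding topdiff_less_def[of colex] by blast
    have ct: "c \<in> tuples_upto n" using c(1) fin_supp_outside[OF w0] by fastforce
    have bt: "b \<in> tuples_upto n" using w(3) fin_supp_outside[OF w(1)] by fastforce
    have "c n' < m" using m[of c] c(1) by simp
    then have "c \<sqsubset> b" using nm ct bt unfolding n' by (intro colex_topI[of _ n']) auto
    then have "w b = w0 b" by (rule c(2))
    then show False using w(3) m[of b] nm by simp
  qed
  let ?O = "track_functions n m" and ?c = "unary_code n"
  have c0: "?c w0 \<in> ?O" by (rule unary_code_track[OF n' w0]) (rule m)
  have woO: "strict_wo ?O (topdiff_less colex)" by (rule strict_wo_track_functions)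
  let ?S = "{F\<in>?O. F \<lless> ?c w0}"
  have woS: "strict_wo ?S (topdiff_less colex)" by (rule strict_wo_subset[OF woO]) auto
  have "(\<alpha>, wo_of ?S (topdiff_less colex)) \<in> ordLeq"
  proof (rule ordLeq_if_mono[OF \<alpha> Well_order_wo_of[OF woS], of "\<lambda>i. ?c (g0 i)"])
    have g0W: "g0 i \<in> ?W \<and> g0 i \<lless> w0" if "i \<in> Field \<alpha>" for i using g0(1) that by (auto simp: bij_betw_def)
    have inS: "?c (g0 i) \<in> ?S" if "i \<in> Field \<alpha>" for i
      using g0W[OF that] unary_code_track[OF n', of "g0 i" m] mw[of "g0 i"] unary_code_less[OF w0, of "g0 i"] by blast
    show "?c (g0 x) \<in> Field (wo_of ?S (topdiff_less colex))" if "x \<in> Field \<alpha>" for x using inS[OF that] by simp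
    show "?c (g0 x) \<in> underS (wo_of ?S (topdiff_less colex)) (?c (g0 y))" if "y \<in> Field \<alpha>" "x \<in> underS \<alpha> y" for x y
    proof -
      have x: "x \<in> Field \<alpha>" using that(2) by (auto simp: underS_def Field_def)
      have "g0 x \<lless> g0 y" using g0(2)[OF x that(1)] that(2) by simp
      then have "?c (g0 x) \<lless> ?c (g0 y)" using unary_code_less[of "g0 y" n "g0 x"] g0W[OF that(1)] by blast
      then show ?thesis using inS[OF x] by (simp add: underS_wo_of[OF woS inS[OF that(1)]])
    qed
  qed
  also have "(wo_of ?S (topdiff_less colex), wo_of ?O (topdiff_less colex)) \<in> ordLess"
  proof -
    have "Restr (wo_of ?O (topdiff_less colex)) (underS (wo_of ?O (topdiff_less colex)) (?c w0)) = wo_of ?S (topdiff_less colex)"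
      unfolding underS_wo_of[OF woO c0] by (auto simp: wo_of_def)
    moreover have "(Restr (wo_of ?O (topdiff_less colex)) (underS (wo_of ?O (topdiff_less colex)) (?c w0)), wo_of ?O (topdiff_less colex)) \<in> ordLess"
      by (rule underS_Restr_ordLess[OF Well_order_wo_of[OF woO]]) (use c0 in auto)
    ultimately show ?thesis by simp
  qed
  finally have "(\<alpha>, wo_of ?O (topdiff_less colex)) \<in> ordLess" .
  then show ?thesis
    by (rule ordLess_wo_ofE[OF woO \<alpha>]) (rule that)
qed

section \<open>Successors and limits of positions\<close>
lemma inf_before_pigeonhole:
  assumes f: "f \<in> tuples_upto n'" "f \<noteq> (\<lambda>_. 0)" and Q: "finite Q"
    and cof: "\<And>\<mu>. \<mu> \<sqsubset> f \<Longrightarrow> \<exists>\<nu>. \<mu> \<sqsubset> \<nu> \<and> \<nu> \<sqsubset> f \<and> x \<nu> \<in> Q"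
  shows "\<exists>q\<in>Q. q \<in> inf_before x f"
proof (rule ccontr)
  assume "\<not> ?thesis"
  then have "\<forall>q\<in>Q. \<exists>\<mu>. \<mu> \<sqsubset> f \<and> (\<forall>\<nu>. \<mu> \<sqsubset> \<nu> \<longrightarrow> \<nu> \<sqsubset> f \<longrightarrow> x \<nu> \<noteq> q)"
    unfolding inf_before_def by blast
  from bchoice[OF this] obtain \<mu> where \<mu>: "\<forall>q\<in>Q. \<mu> q \<sqsubset> f \<and> (\<forall>\<nu>. \<mu> q \<sqsubset> \<nu> \<longrightarrow> \<nu> \<sqsubset> f \<longrightarrow> x \<nu> \<noteq> q)" ..
  let ?M = "insert (\<lambda>_. 0) (\<mu> ` Q)"
  have M: "?M \<subseteq> tuples_upto n'" "\<And>\<nu>. \<nu> \<in> ?M \<Longrightarrow> \<nu> \<sqsubset> f"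
    using \<mu> colex_tuples_upto_down[OF _ f(1)] zero_less[OF f(2,1)] by auto
  obtain \<mu>0 where \<mu>0: "\<mu>0 \<in> ?M" "\<forall>\<nu>\<in>?M. \<nu> = \<mu>0 \<or> \<nu> \<sqsubset> \<mu>0"
    using strict_wo_finite_max[OF strict_wo_colex_tuples[of n'], of ?M] Q M(1) by auto
  obtain \<nu> where \<nu>: "\<mu>0 \<sqsubset> \<nu>" "\<nu> \<sqsubset> f" "x \<nu> \<in> Q" using cof[OF M(2)[OF \<mu>0(1)]] by blast
  have "\<mu> (x \<nu>) = \<mu>0 \<or> \<mu> (x \<nu>) \<sqsubset> \<mu>0" using \<mu>0(2) \<nu>(3) by blast
  then have "\<mu> (x \<nu>) \<sqsubset> \<nu>"
    using \<nu>(1) colex_trans[OF _ \<nu>(1), of "\<mu> (x \<nu>)" n'] M \<mu>0(1) \<nu>(3) colex_tuples_upto_down[OF \<nu>(2) f(1)] by blast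
  then show False using \<mu> \<nu> by blast
qed

lemma less_next_pos_iff:
  assumes "g \<in> tuples_upto n" "h \<in> tuples_upto n"
  shows "h \<sqsubset> next_pos g \<longleftrightarrow> h = g \<or> h \<sqsubset> g"
proof
  assume h: "h \<sqsubset> next_pos g"
  show "h = g \<or> h \<sqsubset> g"
  proof (rule ccontr)
    assume "\<not> ?thesis"
    then have "g \<sqsubset> h" using colex_total[OF assms] by blast
    then have "next_pos g = h \<or> next_pos g \<sqsubset> h" by (rule next_pos_least)
    moreover have t: "next_pos g \<in> tuples_upto (Suc n)" "h \<in> tuples_upto (Suc n)"
      using assms next_pos_positions[OF assms(1)] unit_at_Suc tuples_upto_Suc by (auto simp: positions_le_def)
    ultimately show False using h topdiff_irrefl[of "(<)" h] colex_trans[OF h _ t(2,1,2)] by blast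
  qed
next
  have t: "next_pos g \<in> tuples_upto (Suc n)" "h \<in> tuples_upto (Suc n)" "g \<in> tuples_upto (Suc n)"
    using assms next_pos_positions[OF assms(1)] unit_at_Suc tuples_upto_Suc by (auto simp: positions_le_def)
  assume "h = g \<or> h \<sqsubset> g"
  then show "h \<sqsubset> next_pos g" using less_next_pos[of g] colex_trans[OF _ less_next_pos t(2,3,1)] by blast
qed

lemma next_pos_below_limit:
  assumes "\<mu> \<sqsubset> f" "f 0 = 0"
  shows "next_pos \<mu> \<sqsubset> f"
  using next_pos_least[OF assms(1)] assms(2) by (auto simp: next_pos_def)

lemma inj_next_pos: "next_pos f = next_pos g \<longleftrightarrow> f = g"
proof
  assume *: "next_pos f = next_pos g"
  have "f i = g i" for i using fun_cong[OF *, of i] by (cases "i = 0") (auto simp: next_pos_def)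
  then show "f = g" by auto
qed simp

section \<open>Automata with numbered states\<close>

text \<open>Automata of a presentation have numbers as states. A run of the renamed automaton stays in the image
  of the old states, so it can be translated back.\<close>
lemma rename_states:
  fixes \<Delta> :: "('q \<times> 'l \<times> 'q) set"
  assumes Q: "finite Q" and \<Sigma>: "finite \<Sigma>" and \<Delta>: "\<Delta> \<subseteq> Q \<times> \<Sigma> \<times> Q" and \<gamma>: "\<gamma> \<subseteq> Pow Q \<times> Q"
    and init: "q0 \<in> Q" and fin: "Fin \<subseteq> Q"
  obtains B :: "('l, nat) automaton" where "ordinal_automaton B" "alphabet B = \<Sigma>"
    "\<And>n w. (\<exists>x. run_seg (succ_trans B) (lim_trans B) n w x \<and> x (\<lambda>_. 0) = initial B \<and> x (unit_at n) \<in> final B) \<longleftrightarrow>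
       (\<exists>x. run_seg \<Delta> \<gamma> n w x \<and> x (\<lambda>_. 0) = q0 \<and> x (unit_at n) \<in> Fin)"
proof -
  obtain c where "bij_betw c Q {0..<card Q}" using ex_bij_betw_finite_nat[OF Q] by blast
  then have c: "inj_on c Q" by (simp add: bij_betw_def)
  define B where "B = \<lparr>alphabet = \<Sigma>, states = c ` Q, initial = c q0,
     succ_trans = {(c q, a, c q') | q a q'. (q, a, q') \<in> \<Delta>}, lim_trans = {(c ` P, c q) | P q. (P, q) \<in> \<gamma>},
     final = c ` Fin\<rparr>"
  have "ordinal_automaton B"
    using assms by (auto simp: ordinal_automaton_def B_def)
  moreover have "alphabet B = \<Sigma>" by (simp add: B_def)
  moreover have "(\<exists>x. run_seg (succ_trans B) (lim_trans B) n w x \<and> x (\<lambda>_. 0) = initial B \<and> x (unit_at n) \<in> final B) \<longleftrightarrow>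
       (\<exists>x. run_seg \<Delta> \<gamma> n w x \<and> x (\<lambda>_. 0) = q0 \<and> x (unit_at n) \<in> Fin)" for n and w :: "(nat \<Rightarrow> nat) \<Rightarrow> 'l"
  proof -
    have img: "inf_before (\<lambda>f. c (x f)) f = c ` inf_before x f"
      if f: "f \<in> positions_le n" "f \<noteq> (\<lambda>_. 0)" and x: "\<And>\<nu>. \<nu> \<in> tuples_upto n \<Longrightarrow> x \<nu> \<in> Q" for x f
    proof (intro set_eqI iffI)
      fix q assume q: "q \<in> inf_before (\<lambda>f. c (x f)) f"
      have "(\<lambda>_. 0) \<sqsubset> f" using zero_less[OF f(2), of "Suc n"] f(1) unit_at_Suc tuples_upto_Suc by (auto simp: positions_le_def)
      then obtain \<nu>0 where \<nu>0: "\<nu>0 \<sqsubset> f" "c (x \<nu>0) = q" using q unfolding inf_before_def by blast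
      have "x \<nu>0 \<in> inf_before x f"
        unfolding inf_before_def mem_Collect_eq
      proof (intro allI impI)
        fix \<mu> assume "\<mu> \<sqsubset> f"
        then obtain \<nu> where \<nu>: "\<mu> \<sqsubset> \<nu>" "\<nu> \<sqsubset> f" "c (x \<nu>) = q" using q unfolding inf_before_def by blast
        have "x \<nu> = x \<nu>0"
          using inj_onD[OF c, of "x \<nu>" "x \<nu>0"] x[OF below_positions_le[OF \<nu>(2) f(1)]] x[OF below_positions_le[OF \<nu>0(1) f(1)]] \<nu>(3) \<nu>0(2)
          by simp
        then show "\<exists>\<nu>. \<mu> \<sqsubset> \<nu> \<and> \<nu> \<sqsubset> f \<and> x \<nu> = x \<nu>0" using \<nu> by blast
      qed
      then show "q \<in> c ` inf_before x f" using \<nu>0(2) by blast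
    next
      fix q assume "q \<in> c ` inf_before x f"
      then obtain p where p: "p \<in> inf_before x f" "q = c p" by blast
      show "q \<in> inf_before (\<lambda>f. c (x f)) f"
        unfolding inf_before_def mem_Collect_eq
      proof (intro allI impI)
        fix \<mu> assume "\<mu> \<sqsubset> f"
        then obtain \<nu> where "\<mu> \<sqsubset> \<nu>" "\<nu> \<sqsubset> f" "x \<nu> = p" using p(1) unfolding inf_before_def by blast
        then show "\<exists>\<nu>. \<mu> \<sqsubset> \<nu> \<and> \<nu> \<sqsubset> f \<and> c (x \<nu>) = q" using p(2) by blast
      qed
    qed
    have trans: "(c p, a, c p') \<in> succ_trans B \<longleftrightarrow> (p, a, p') \<in> \<Delta>" if "p \<in> Q" "p' \<in> Q" for p a p'
      using that \<Delta> inj_onD[OF c] by (auto simp: B_def) blast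
    have lim: "(c ` P, c p) \<in> lim_trans B \<longleftrightarrow> (P, p) \<in> \<gamma>" if "P \<subseteq> Q" "p \<in> Q" for P p
    proof
      assume "(c ` P, c p) \<in> lim_trans B"
      then obtain P' p' where P': "(P', p') \<in> \<gamma>" "c ` P = c ` P'" "c p = c p'" by (auto simp: B_def)
      then have "P' \<subseteq> Q" "p' \<in> Q" using \<gamma> by auto
      then have "P = P'" "p = p'" using P' that c by (simp_all add: inj_on_image_eq_iff inj_onD)
      then show "(P, p) \<in> \<gamma>" using P'(1) by simp
    qed (auto simp: B_def)
    have pos: "f \<in> positions_le n" if "f \<in> tuples_upto n" for f using that by (simp add: positions_le_def)
    have inQ: "inf_before x f \<subseteq> Q" if "f \<in> positions_le n" "f \<noteq> (\<lambda>_. 0)" "\<And>\<nu>. \<nu> \<in> tuples_upto n \<Longrightarrow> x \<nu> \<in> Q" for x f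
    proof
      fix q assume q: "q \<in> inf_before x f"
      have "(\<lambda>_. 0) \<sqsubset> f" using zero_less[OF that(2), of "Suc n"] that(1) unit_at_Suc tuples_upto_Suc by (auto simp: positions_le_def)
      then obtain \<nu> where "\<nu> \<sqsubset> f" "x \<nu> = q" using q unfolding inf_before_def by blast
      then show "q \<in> Q" using that(3) below_positions_le[OF _ that(1)] by blast
    qed
    have same: "run_seg (succ_trans B) (lim_trans B) n w (\<lambda>f. c (x f)) \<longleftrightarrow> run_seg \<Delta> \<gamma> n w x"
      if x: "\<And>\<nu>. \<nu> \<in> positions_le n \<Longrightarrow> x \<nu> \<in> Q" for x
    proof -
      have "(c (x f), w f, c (x (next_pos f))) \<in> succ_trans B \<longleftrightarrow> (x f, w f, x (next_pos f)) \<in> \<Delta>" if "f \<in> tuples_upto n" for f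
        using trans x pos[OF that] next_pos_positions[OF that] by blast
      moreover have "(inf_before (\<lambda>f. c (x f)) f, c (x f)) \<in> lim_trans B \<longleftrightarrow> (inf_before x f, x f) \<in> \<gamma>"
        if "f \<in> positions_le n" "f \<noteq> (\<lambda>_. 0)" for f
        using img[OF that] lim[OF inQ[OF that] x[OF that(1)]] x pos by simp
      ultimately show ?thesis unfolding run_seg_def by (intro arg_cong2[where f = "(\<and>)"] ball_cong) auto
    qed
    have states: "x f \<in> Z" if "run_seg D g n w x" "x (\<lambda>_. 0) \<in> Z" "D \<subseteq> Z \<times> \<Sigma> \<times> Z" "g \<subseteq> Pow Z \<times> Z" "f \<in> positions_le n"
      for x :: "(nat \<Rightarrow> nat) \<Rightarrow> 'z" and D g Z f
    proof -
      consider "f = (\<lambda>_. 0)" | "f \<noteq> (\<lambda>_. 0)" "f 0 = 0" | "f 0 \<noteq> 0" by blast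
      then show ?thesis
      proof cases
        case 2
        then have "(inf_before x f, x f) \<in> g" using that by (simp add: run_seg_def)
        then show ?thesis using that(4) by blast
      next
        case 3
        define h where "h = f(0 := f 0 - 1)"
        have nh: "next_pos h = f" using 3 by (auto simp: h_def next_pos_def)
        have "h \<sqsubset> f" using less_next_pos[of h] by (simp only: nh)
        then have "h \<in> tuples_upto n" using that(5) by (rule below_positions_le)
        then have "(x h, w h, x (next_pos h)) \<in> D" using that(1) unfolding run_seg_def by blast
        then show ?thesis using that(3) unfolding nh by blast
      qed (use that in simp)
    qed
    show ?thesis
    proof
      assume "\<exists>x. run_seg \<Delta> \<gamma> n w x \<and> x (\<lambda>_. 0) = q0 \<and> x (unit_at n) \<in> Fin"
      then obtain x where x: "run_seg \<Delta> \<gamma> n w x" "x (\<lambda>_. 0) = q0" "x (unit_at n) \<in> Fin" by blast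
      have "x f \<in> Q" if "f \<in> positions_le n" for f using states[OF x(1) _ \<Delta> \<gamma> that] x(2) init by simp
      then show "\<exists>x. run_seg (succ_trans B) (lim_trans B) n w x \<and> x (\<lambda>_. 0) = initial B \<and> x (unit_at n) \<in> final B"
        using same[of x] x by (intro exI[of _ "\<lambda>f. c (x f)"]) (simp add: B_def)
    next
      assume "\<exists>x. run_seg (succ_trans B) (lim_trans B) n w x \<and> x (\<lambda>_. 0) = initial B \<and> x (unit_at n) \<in> final B"
      then obtain y where y: "run_seg (succ_trans B) (lim_trans B) n w y" "y (\<lambda>_. 0) = initial B" "y (unit_at n) \<in> final B" by blast
      have sub: "succ_trans B \<subseteq> c ` Q \<times> \<Sigma> \<times> c ` Q" "lim_trans B \<subseteq> Pow (c ` Q) \<times> c ` Q"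
        using \<Delta> \<gamma> by (auto simp: B_def)
      have yQ: "y f \<in> c ` Q" if "f \<in> positions_le n" for f
        using states[OF y(1) _ sub that] y(2) init by (simp add: B_def)
      define x where "x f = inv_into Q c (y f)" for f
      have x: "x f \<in> Q" "c (x f) = y f" if "f \<in> positions_le n" for f
        using yQ[OF that] by (auto simp: x_def inv_into_into f_inv_into_f)
      have "inf_before (\<lambda>f. c (x f)) f = inf_before y f" if "f \<in> positions_le n" for f
        by (rule inf_before_cong) (use x(2) pos below_positions_le[OF _ that] in blast)
      then have "run_seg (succ_trans B) (lim_trans B) n w (\<lambda>f. c (x f))"
        using y(1) unfolding run_seg_def by (simp add: x(2) pos next_pos_positions)
      then have "run_seg \<Delta> \<gamma> n w x" using same[of x] x(1) by simp
      moreover have "x (\<lambda>_. 0) = q0"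
      proof -
        have "c (x (\<lambda>_. 0)) = c q0" using x(2)[of "\<lambda>_. 0"] y(2) pos[of "\<lambda>_. 0"] by (simp add: B_def)
        then show ?thesis using inj_onD[OF c] x(1)[of "\<lambda>_. 0"] init pos[of "\<lambda>_. 0"] by simp
      qed
      moreover have "x (unit_at n) \<in> Fin"
      proof -
        have u: "unit_at n \<in> positions_le n" by (simp add: positions_le_def)
        obtain q where q: "q \<in> Fin" "c (x (unit_at n)) = c q" using x(2)[OF u] y(3) by (auto simp: B_def)
        then show ?thesis using inj_onD[OF c] x(1)[OF u] fin by (metis subsetD)
      qed
      ultimately show "\<exists>x. run_seg \<Delta> \<gamma> n w x \<and> x (\<lambda>_. 0) = q0 \<and> x (unit_at n) \<in> Fin" by blast
    qed
  qed
  ultimately show ?thesis by (rule that)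
qed

section \<open>Recognising limit positions by truncated coordinates\<close>

text \<open>The automaton knows its position only up to truncating each coordinate at \<open>N\<close>; this is its
  label. Before a limit position with first nonzero coordinate \<open>j + 1\<close>, the coordinate \<open>j\<close> grows beyond
  any bound, coordinate \<open>j + 1\<close> is smaller by one, and the lower coordinates pass through all values, zero
  included. So the set \<open>S\<close> of the labels that occur cofinally determines \<open>j\<close> and the label \<open>l\<close> of the
  limit.\<close>
definition limit_label :: "nat \<Rightarrow> (nat \<Rightarrow> nat) set \<Rightarrow> (nat \<Rightarrow> nat) \<Rightarrow> bool" where
  "limit_label N S l \<longleftrightarrow> (\<exists>j. (\<forall>i\<le>j. l i = 0) \<and> (\<exists>s\<in>S. \<forall>i<j. s i = 0) \<and>
     (\<forall>s\<in>S. s j = N \<and> l (Suc j) = min (Suc (s (Suc j))) N \<and> (\<forall>i>Suc j. s i = l i)))"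

text \<open>All labels in \<open>S\<close> are \<open>N > 0\<close> at \<open>j\<close>, and one of them vanishes below \<open>j\<close>; two different values of \<open>j\<close>
  contradict each other.\<close>
lemma limit_label_unique:
  assumes N: "0 < N" and l: "limit_label N S l" and l': "limit_label N S l'"
  shows "l = l'"
proof -
  obtain j where j: "\<forall>i\<le>j. l i = 0" "\<exists>s\<in>S. \<forall>i<j. s i = 0"
    "\<forall>s\<in>S. s j = N \<and> l (Suc j) = min (Suc (s (Suc j))) N \<and> (\<forall>i>Suc j. s i = l i)"
    using l unfolding limit_label_def by blast
  obtain j' where j': "\<forall>i\<le>j'. l' i = 0" "\<exists>s\<in>S. \<forall>i<j'. s i = 0"
    "\<forall>s\<in>S. s j' = N \<and> l' (Suc j') = min (Suc (s (Suc j'))) N \<and> (\<forall>i>Suc j'. s i = l' i)"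
    using l' unfolding limit_label_def by blast
  have "\<not> j < j'" using j(3) j'(2) N by (metis less_numeral_extra(3))
  moreover have "\<not> j' < j" using j'(3) j(2) N by (metis less_numeral_extra(3))
  ultimately have eq: "j' = j" by simp
  obtain s where s: "s \<in> S" using j(2) by blast
  show ?thesis
  proof
    fix i
    consider "i \<le> j" | "i = Suc j" | "Suc j < i" by linarith
    then show "l i = l' i"
      using j(1,3) j'(1,3) s unfolding eq by cases auto
  qed
qed

definition label :: "nat \<Rightarrow> (nat \<Rightarrow> nat) \<Rightarrow> nat \<Rightarrow> nat" where
  "label N f = (\<lambda>i. min (f i) N)"

text \<open>Let \<open>f\<close> be a limit position with first nonzero coordinate \<open>j + 1\<close>. The positions with coordinate
  \<open>j + 1\<close> decreased by one, coordinate \<open>j\<close> equal to \<open>M\<close> and zeros below are cofinal in it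
  (\<open>above_below_limit\<close>), and all positions from one of them up to \<open>f\<close> have the given form.\<close>
lemma below_limit:
  assumes j: "\<And>i. i \<le> j \<Longrightarrow> f i = 0" and fj: "f (Suc j) = Suc q"
    and \<mu>: "f(Suc j := q, j := M) \<sqsubset> \<nu>" and \<nu>: "\<nu> \<sqsubset> f"
  shows "M \<le> \<nu> j" "\<nu> (Suc j) = q" "\<And>i. Suc j < i \<Longrightarrow> \<nu> i = f i"
proof -
  obtain b where b: "\<nu> b < f b" "\<And>c. b < c \<Longrightarrow> \<nu> c = f c" using \<nu> by (auto simp: topdiff_less_def)
  obtain d where d: "(f(Suc j := q, j := M)) d < \<nu> d" "\<And>c. d < c \<Longrightarrow> (f(Suc j := q, j := M)) c = \<nu> c"
    using \<mu> by (auto simp: topdiff_less_def)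
  have bj: "Suc j \<le> b" using b(1) j[of b] by (cases "b \<le> j") auto
  have b_eq: "b = Suc j"
  proof (rule ccontr)
    assume "b \<noteq> Suc j"
    then have gt: "Suc j < b" using bj by simp
    then have "(f(Suc j := q, j := M)) b = f b" by simp
    moreover have "d = b \<or> d < b \<or> b < d" by linarith
    ultimately show False using b d gt by (metis fun_upd_other less_asym less_irrefl not_less_eq order_less_trans Suc_lessD)
  qed
  show 3: "\<nu> i = f i" if "Suc j < i" for i using b(2) that b_eq by simp
  have dj: "d \<le> j"
  proof (rule ccontr)
    assume "\<not> d \<le> j"
    then consider "d = Suc j" | "Suc j < d" by linarith
    then show False
    proof cases
      case 1
      then show ?thesis using d(1) b(1) b_eq fj by simp
    next
      case 2
      then show ?thesis using d(1) 3[OF 2] by simp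
    qed
  qed
  show "\<nu> (Suc j) = q" using d(2)[of "Suc j"] dj by simp
  show "M \<le> \<nu> j"
  proof (cases "d = j")
    case True
    then show ?thesis using d(1) by simp
  next
    case False
    then show ?thesis using d(2)[of j] dj by simp
  qed
qed

lemma above_below_limit:
  assumes j: "\<And>i. i \<le> j \<Longrightarrow> f i = 0" and fj: "f (Suc j) = Suc q" and \<mu>: "\<mu> \<sqsubset> f"
  shows "\<exists>M\<ge>N. \<mu> \<sqsubset> f(Suc j := q, j := M) \<and> f(Suc j := q, j := M) \<sqsubset> f"
proof -
  obtain b where b: "\<mu> b < f b" "\<And>c. b < c \<Longrightarrow> \<mu> c = f c" using \<mu> by (auto simp: topdiff_less_def)
  have bj: "Suc j \<le> b" using b(1) j[of b] by (cases "b \<le> j") auto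
  define M where "M = max N (Suc (\<mu> j))"
  have "f(Suc j := q, j := M) \<sqsubset> f"
    unfolding topdiff_less_def using fj by (intro exI[of _ "Suc j"]) auto
  moreover have "\<mu> \<sqsubset> f(Suc j := q, j := M)"
  proof (cases "b = Suc j \<and> \<mu> b = q")
    case True
    then show ?thesis
      unfolding topdiff_less_def using b(2)
      by (intro exI[of _ j]) (auto simp: M_def less_Suc_eq_le Suc_le_eq)
  next
    case False
    then show ?thesis
      unfolding topdiff_less_def using b bj fj by (intro exI[of _ b]) auto
  qed
  ultimately show ?thesis by (intro exI[of _ M]) (simp add: M_def)
qed

section \<open>An automaton for increasing chains of words\<close>

text \<open>A letter holds the letters of \<open>k\<close> words, and each of these is a subset of the \<open>m\<close> tracks, encoded by a
  number. The automaton checks that the words have finitely many nonzero letters and that they increase,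
  where the word \<open>k\<close>, after the last one, is the fixed function \<open>u\<close>. It does not read \<open>u\<close>; as \<open>u\<close> vanishes
  when a coordinate of the position is at least \<open>N\<close>, its value can be computed from the label.

  A state consists of the label of the position, a flag that tells whether the letter just read was
  nonzero, and, for each \<open>r < k\<close> and each track \<open>i\<close>, the result of comparing the words \<open>r\<close> and \<open>r + 1\<close>
  on track \<open>i\<close> at the last position so far where they differ: 0 for no difference, 1 if word \<open>r + 1\<close>
  has the element, 2 if word \<open>r\<close> has it. Limit transitions require that flags and changes of
  the comparisons do not occur cofinally. Since the track is the most significant coordinate, words
  increase iff the largest track with a difference has result 1.\<close>
locale chain_automaton =
  fixes n m k N :: nat and u :: "(nat \<Rightarrow> nat) \<Rightarrow> nat" and letters :: "'l \<Rightarrow> nat list" and \<Sigma> :: "'l set"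
  assumes finite_\<Sigma>: "finite \<Sigma>" and N: "0 < N" and u: "u \<in> track_functions n m"
    and bound: "u e \<noteq> 0 \<Longrightarrow> i < n \<Longrightarrow> e i < N"
    and letter: "a \<in> \<Sigma> \<Longrightarrow> r < k \<Longrightarrow> set_decode (letters a ! r) \<subseteq> {..<m}"
begin

definition track :: "'l \<Rightarrow> (nat \<Rightarrow> nat) \<Rightarrow> nat \<Rightarrow> nat set" where
  "track a l r = (if r < k then set_decode (letters a ! r) else {i. u (l(n := i)) \<noteq> 0})"

definition labels :: "(nat \<Rightarrow> nat) set" where
  "labels = {l. \<forall>i. (i \<in> {..n} \<longrightarrow> l i \<in> {..N}) \<and> (i \<notin> {..n} \<longrightarrow> l i = 0)}"

definition comparisons :: "(nat \<times> nat \<Rightarrow> nat) set" where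
  "comparisons = {c. \<forall>p. (p \<in> {..<k} \<times> {..<m} \<longrightarrow> c p \<in> {..2}) \<and> (p \<notin> {..<k} \<times> {..<m} \<longrightarrow> c p = 0)}"

definition compare_next :: "(nat \<times> nat \<Rightarrow> nat) \<Rightarrow> (nat \<Rightarrow> nat set) \<Rightarrow> nat \<times> nat \<Rightarrow> nat" where
  "compare_next c D = (\<lambda>(r, i). if r < k \<and> i < m then
     (if i \<in> D r \<and> i \<notin> D (Suc r) then 2 else if i \<in> D (Suc r) \<and> i \<notin> D r then 1 else c (r, i)) else 0)"

definition state_set :: "((nat \<Rightarrow> nat) \<times> bool \<times> (nat \<times> nat \<Rightarrow> nat)) set" where
  "state_set = labels \<times> UNIV \<times> comparisons"

definition step :: "(nat \<Rightarrow> nat) \<times> bool \<times> (nat \<times> nat \<Rightarrow> nat) \<Rightarrow> 'l \<Rightarrow> (nat \<Rightarrow> nat) \<times> bool \<times> (nat \<times> nat \<Rightarrow> nat)" where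
  "step q a = ((fst q)(0 := min (Suc (fst q 0)) N), \<exists>r<k. track a (fst q) r \<noteq> {}, compare_next (snd (snd q)) (track a (fst q)))"

definition transitions where
  "transitions = {(q, a, step q a) | q a. q \<in> state_set \<and> a \<in> \<Sigma>}"

definition limits where
  "limits = {(S, q). S \<subseteq> state_set \<and> S \<noteq> {} \<and> q \<in> state_set \<and> \<not> fst (snd q) \<and>
     (\<forall>s\<in>S. \<not> fst (snd s) \<and> snd (snd s) = snd (snd q)) \<and> limit_label N (fst ` S) (fst q)}"

definition accepting_states where
  "accepting_states = {q \<in> state_set. \<forall>r<k. \<exists>i<m. snd (snd q) (r, i) = 1 \<and> (\<forall>j. i < j \<longrightarrow> j < m \<longrightarrow> snd (snd q) (r, j) = 0)}"

definition start :: "(nat \<Rightarrow> nat) \<times> bool \<times> (nat \<times> nat \<Rightarrow> nat)" where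
  "start = (\<lambda>_. 0, False, \<lambda>_. 0)"

lemma finite_state_set: "finite state_set"
proof -
  have "finite labels" unfolding labels_def by (rule finite_set_of_finite_funs) auto
  moreover have "finite comparisons" unfolding comparisons_def by (rule finite_set_of_finite_funs) auto
  ultimately show ?thesis by (simp add: state_set_def)
qed

lemma step_state: "q \<in> state_set \<Longrightarrow> step q a \<in> state_set"
  by (auto simp: state_set_def step_def labels_def comparisons_def compare_next_def)

lemma start_state: "start \<in> state_set"
  by (simp add: start_def state_set_def labels_def comparisons_def)

lemma transitions_sub: "transitions \<subseteq> state_set \<times> \<Sigma> \<times> state_set"
  by (auto simp: transitions_def step_state)

lemma in_transitions: "q \<in> state_set \<Longrightarrow> a \<in> \<Sigma> \<Longrightarrow> (q, a, step q a) \<in> transitions"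
  unfolding transitions_def by blast

lemma limits_sub: "limits \<subseteq> Pow state_set \<times> state_set"
  by (auto simp: limits_def)

lemma limits_unique: "(S, q) \<in> limits \<Longrightarrow> (S, q') \<in> limits \<Longrightarrow> q = q'"
proof -
  assume q: "(S, q) \<in> limits" and q': "(S, q') \<in> limits"
  obtain s where s: "s \<in> S" using q by (auto simp: limits_def)
  have "fst q = fst q'" using limit_label_unique[OF N, of "fst ` S" "fst q" "fst q'"] q q' by (auto simp: limits_def)
  moreover have "snd (snd s) = snd (snd q)" "snd (snd s) = snd (snd q')" using q q' s by (auto simp: limits_def)
  moreover have "\<not> fst (snd q)" "\<not> fst (snd q')" using q q' by (auto simp: limits_def)
  ultimately show "q = q'" by (simp add: prod_eq_iff)
qed

end

section \<open>The run on a word\<close>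

text \<open>The state \<open>st f\<close> of the only possible run is described directly by the word: \<open>D f r\<close> is the set of
  tracks that word \<open>r\<close> has at position \<open>f\<close>, and \<open>last_diff r i f\<close> is the last position before \<open>f\<close> where
  the words \<open>r\<close> and \<open>r + 1\<close> differ on track \<open>i\<close>.\<close>
locale chain_word = chain_automaton +
  fixes w :: "(nat \<Rightarrow> nat) \<Rightarrow> 'a"
  assumes w: "f \<in> tuples_upto n \<Longrightarrow> w f \<in> \<Sigma>"
begin

definition D :: "(nat \<Rightarrow> nat) \<Rightarrow> nat \<Rightarrow> nat set" where
  "D f r = track (w f) f r"

definition nonzero :: "(nat \<Rightarrow> nat) set" where
  "nonzero = {g \<in> tuples_upto n. \<exists>r<k. D g r \<noteq> {}}"

definition differ :: "nat \<Rightarrow> nat \<Rightarrow> (nat \<Rightarrow> nat) set" where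
  "differ r i = {g \<in> tuples_upto n. (i \<in> D g r) \<noteq> (i \<in> D g (Suc r))}"

definition last_diff :: "nat \<Rightarrow> nat \<Rightarrow> (nat \<Rightarrow> nat) \<Rightarrow> (nat \<Rightarrow> nat) \<Rightarrow> bool" where
  "last_diff r i f g \<longleftrightarrow> g \<in> differ r i \<and> g \<sqsubset> f \<and> (\<forall>h\<in>differ r i. g \<sqsubset> h \<longrightarrow> \<not> h \<sqsubset> f)"

definition comparison :: "(nat \<Rightarrow> nat) \<Rightarrow> nat \<times> nat \<Rightarrow> nat" where
  "comparison f = (\<lambda>(r, i). if r < k \<and> i < m then
     (if \<exists>g. last_diff r i f g \<and> i \<in> D g r then 2 else if \<exists>g. last_diff r i f g \<and> i \<in> D g (Suc r) then 1 else 0) else 0)"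

definition flag :: "(nat \<Rightarrow> nat) \<Rightarrow> bool" where
  "flag f \<longleftrightarrow> (\<exists>g\<in>nonzero. next_pos g = f)"

definition st where "st f = (label N f, flag f, comparison f)"

text \<open>The function \<open>u\<close> vanishes on all tracks of a position with a coordinate of at least \<open>N\<close> and on those of
  its label; any other position equals its label.\<close>
lemma track_label: "f \<in> tuples_upto n \<Longrightarrow> track a (label N f) r = track a f r"
proof (cases "\<forall>i<n. f i < N")
  case True
  assume f: "f \<in> tuples_upto n"
  have "label N f i = f i" for i
    using True f by (cases "i < n") (auto simp: label_def tuples_upto_def)
  then have "label N f = f" by auto
  then show ?thesis by simp
next
  case False
  then obtain i0 where i0: "i0 < n" "N \<le> f i0" by auto
  have "u (f(n := i)) = 0" for i using bound[of "f(n := i)" i0] i0 by (cases "u (f(n := i)) = 0") auto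
  moreover have "u ((label N f)(n := i)) = 0" for i
    using bound[of "(label N f)(n := i)" i0] i0 by (cases "u ((label N f)(n := i)) = 0") (auto simp: label_def)
  ultimately show ?thesis by (simp add: track_def)
qed

lemma D_bound: "f \<in> tuples_upto n \<Longrightarrow> D f r \<subseteq> {..<m}"
proof (cases "r < k")
  case True
  then show "D f r \<subseteq> {..<m}" if "f \<in> tuples_upto n" using letter[OF w[OF that] True] by (simp add: D_def track_def)
next
  case False
  have "i < m" if "u (f(n := i)) \<noteq> 0" for i
  proof -
    have "(f(n := i)) n < m" using u that unfolding track_functions_def by blast
    then show ?thesis by simp
  qed
  then show "D f r \<subseteq> {..<m}" using False by (auto simp: D_def track_def)
qed

lemma pos_tuples: "f \<in> positions_le n \<Longrightarrow> f \<in> tuples_upto (Suc n)"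
  using unit_at_Suc tuples_upto_Suc by (auto simp: positions_le_def)

lemma st_state: "f \<in> positions_le n \<Longrightarrow> st f \<in> state_set"
  using pos_tuples[of f] by (auto simp: st_def state_set_def labels_def comparisons_def comparison_def label_def tuples_upto_def Suc_le_eq)

lemma st_start: "st (\<lambda>_. 0) = start"
proof -
  have "\<not> flag (\<lambda>_. 0)" by (auto simp: flag_def next_pos_def fun_eq_iff intro!: exI[of _ 0])
  moreover have "\<not> last_diff r i (\<lambda>_. 0) g" for r i g by (auto simp: last_diff_def topdiff_less_def)
  ultimately show ?thesis by (auto simp: st_def start_def label_def comparison_def)
qed

lemma last_diff_next:
  assumes f: "f \<in> tuples_upto n"
  shows "last_diff r i (next_pos f) g \<longleftrightarrow> (if f \<in> differ r i then g = f else last_diff r i f g)"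
proof -
  have less: "h \<sqsubset> next_pos f \<longleftrightarrow> h = f \<or> h \<sqsubset> f" if "h \<in> differ r i" for h
    using less_next_pos_iff[OF f, of h] that by (simp add: differ_def)
  have irr: "\<not> h \<sqsubset> h" for h :: "nat \<Rightarrow> nat" by (rule topdiff_irrefl)
  have asym: "\<not> (g \<sqsubset> h \<and> h \<sqsubset> g)" if "g \<in> differ r i" "h \<in> differ r i" for g h
    using colex_trans[of g h g n] that irr[of g] by (auto simp: differ_def)
  show ?thesis
  proof (cases "f \<in> differ r i")
    case True
    have "last_diff r i (next_pos f) g \<longleftrightarrow> g = f"
    proof
      assume "last_diff r i (next_pos f) g"
      then have g: "g \<in> differ r i" "g = f \<or> g \<sqsubset> f" "\<not> g \<sqsubset> f \<or> \<not> f \<sqsubset> next_pos f"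
        using less True unfolding last_diff_def by blast+
      then show "g = f" using less_next_pos[of f] by blast
    next
      assume g: "g = f"
      show "last_diff r i (next_pos f) g"
        unfolding last_diff_def g
      proof (intro conjI ballI impI)
        show "\<not> h \<sqsubset> next_pos f" if "h \<in> differ r i" "f \<sqsubset> h" for h
          using less[OF that(1)] that asym[OF True that(1)] irr[of f] by blast
      qed (use True less_next_pos in auto)
    qed
    then show ?thesis using True by simp
  next
    case False
    then have "h \<sqsubset> next_pos f \<longleftrightarrow> h \<sqsubset> f" if "h \<in> differ r i" for h using less[OF that] that by blast
    then have "last_diff r i (next_pos f) g \<longleftrightarrow> last_diff r i f g" unfolding last_diff_def by blast
    then show ?thesis using False by simp
  qed
qed

lemma st_next:
  assumes f: "f \<in> tuples_upto n"
  shows "st (next_pos f) = step (st f) (w f)"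
proof -
  have "label N (next_pos f) = (label N f)(0 := min (Suc (label N f 0)) N)"
  proof
    fix i show "label N (next_pos f) i = ((label N f)(0 := min (Suc (label N f 0)) N)) i"
      by (cases "i = 0") (auto simp: label_def next_pos_def)
  qed
  moreover have "flag (next_pos f) \<longleftrightarrow> (\<exists>r<k. track (w f) (label N f) r \<noteq> {})"
    using f by (simp add: flag_def inj_next_pos nonzero_def track_label D_def)
  moreover have "comparison (next_pos f) = compare_next (comparison f) (track (w f) (label N f))"
  proof
    fix p :: "nat \<times> nat"
    obtain r i where p: "p = (r, i)" by (cases p)
    have T: "track (w f) (label N f) r = D f r" for r using f by (simp add: track_label D_def)
    have d: "f \<in> differ r i \<longleftrightarrow> (i \<in> D f r) \<noteq> (i \<in> D f (Suc r))" using f by (simp add: differ_def)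
    show "comparison (next_pos f) p = compare_next (comparison f) (track (w f) (label N f)) p"
    proof (cases "r < k \<and> i < m")
      case rm: True
      show ?thesis
      proof (cases "f \<in> differ r i")
        case True
        then have "last_diff r i (next_pos f) g \<longleftrightarrow> g = f" for g using last_diff_next[OF f] by simp
        then show ?thesis using True d rm by (simp add: p comparison_def compare_next_def T)
      next
        case False
        then have "last_diff r i (next_pos f) g \<longleftrightarrow> last_diff r i f g" for g using last_diff_next[OF f] by simp
        then show ?thesis using False d rm by (simp add: p comparison_def compare_next_def T)
      qed
    next
      case False
      then show ?thesis by (auto simp: p comparison_def compare_next_def)
    qed
  qed
  ultimately show ?thesis by (simp add: st_def step_def)
qed

definition relevant :: "(nat \<Rightarrow> nat) set" where
  "relevant = {g \<in> tuples_upto n. \<exists>r\<le>k. D g r \<noteq> {}}"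

lemma finite_relevant:
  assumes "finite nonzero"
  shows "finite relevant"
proof -
  have "relevant \<subseteq> nonzero \<union> (\<lambda>e. e(n := 0)) ` {e. u e \<noteq> 0}"
  proof
    fix g assume g: "g \<in> relevant"
    show "g \<in> nonzero \<union> (\<lambda>e. e(n := 0)) ` {e. u e \<noteq> 0}"
    proof (cases "g \<in> nonzero")
      case False
      then have "D g k \<noteq> {}" using g by (auto simp: relevant_def nonzero_def le_less)
      then obtain i where i: "u (g(n := i)) \<noteq> 0" by (auto simp: D_def track_def)
      have "(g(n := i))(n := 0) = g" using g by (auto simp: relevant_def tuples_upto_def)
      then show ?thesis using i by (intro UnI2 image_eqI[of _ _ "g(n := i)"]) auto
    qed simp
  qed
  moreover have "finite {e. u e \<noteq> 0}" using u fin_supp_finite by (auto simp: track_functions_def)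
  ultimately show ?thesis using assms by (meson finite_UnI finite_imageI finite_subset)
qed

lemma differ_relevant: "r < k \<Longrightarrow> differ r i \<subseteq> relevant"
  by (auto simp: differ_def relevant_def intro: exI[of _ r] exI[of _ "Suc r"])

text \<open>After the successor of the last relevant position below the limit \<open>f\<close>, no flag is set and no
  comparison changes.\<close>
lemma eventually_constant:
  assumes fin: "finite nonzero" and f: "f \<in> positions_le n" "f \<noteq> (\<lambda>_. 0)" "f 0 = 0"
  obtains \<mu> where "\<mu> \<sqsubset> f" "\<And>\<nu>. \<mu> \<sqsubset> \<nu> \<Longrightarrow> \<nu> \<sqsubset> f \<Longrightarrow> \<not> flag \<nu> \<and> comparison \<nu> = comparison f"
proof -
  have ft: "f \<in> tuples_upto (Suc n)" by (rule pos_tuples[OF f(1)])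
  let ?K = "insert (\<lambda>_. 0) {h\<in>relevant. h \<sqsubset> f}"
  have K: "?K \<subseteq> tuples_upto n" "\<And>h. h \<in> ?K \<Longrightarrow> h \<sqsubset> f"
    using zero_less[OF f(2) ft] by (auto simp: relevant_def)
  obtain \<kappa> where \<kappa>: "\<kappa> \<in> ?K" "\<forall>h\<in>?K. h = \<kappa> \<or> h \<sqsubset> \<kappa>"
    using strict_wo_finite_max[OF strict_wo_colex_tuples[of n], of ?K] finite_relevant[OF fin] K(1) by auto
  have \<kappa>f: "\<kappa> \<sqsubset> f" using K(2)[OF \<kappa>(1)] .
  have \<mu>: "next_pos \<kappa> \<sqsubset> f" by (rule next_pos_below_limit[OF \<kappa>f f(3)])
  show ?thesis
  proof (rule that[OF \<mu>])
    fix \<nu> assume \<nu>: "next_pos \<kappa> \<sqsubset> \<nu>" "\<nu> \<sqsubset> f"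
    have \<nu>t: "\<nu> \<in> tuples_upto (Suc n)" using tuples_upto_Suc[OF below_positions_le[OF \<nu>(2) f(1)]] .
    have \<kappa>t: "\<kappa> \<in> tuples_upto (Suc n)" "next_pos \<kappa> \<in> tuples_upto (Suc n)"
      using tuples_upto_Suc below_positions_le[OF \<kappa>f f(1)] below_positions_le[OF \<mu> f(1)] by auto
    have \<kappa>\<nu>: "\<kappa> \<sqsubset> \<nu>" by (rule colex_trans[OF less_next_pos \<nu>(1) \<kappa>t \<nu>t])
    have below: "h \<sqsubset> \<nu> \<longleftrightarrow> h \<sqsubset> f" if h: "h \<in> relevant" for h
    proof
      have ht: "h \<in> tuples_upto (Suc n)" using h tuples_upto_Suc by (auto simp: relevant_def)
      show "h \<sqsubset> f" if "h \<sqsubset> \<nu>" by (rule colex_trans[OF that \<nu>(2) ht \<nu>t ft])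
      show "h \<sqsubset> \<nu>" if "h \<sqsubset> f"
      proof -
        have "h = \<kappa> \<or> h \<sqsubset> \<kappa>" using \<kappa>(2) h that by simp
        then show ?thesis using \<kappa>\<nu> colex_trans[OF _ \<kappa>\<nu> ht \<kappa>t(1) \<nu>t] by blast
      qed
    qed
    have "\<not> flag \<nu>"
    proof
      assume "flag \<nu>"
      then obtain g where g: "g \<in> nonzero" "next_pos g = \<nu>" by (auto simp: flag_def)
      have gr: "g \<in> relevant" using g(1) by (auto simp: nonzero_def relevant_def)
      have "g \<sqsubset> \<nu>" using less_next_pos[of g] by (simp only: g(2))
      then have "g = \<kappa> \<or> g \<sqsubset> \<kappa>" using below[OF gr] \<kappa>(2) gr by simp
      then show False
      proof
        assume "g = \<kappa>"
        then show False using g(2) \<nu>(1) topdiff_irrefl by metis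
      next
        assume "g \<sqsubset> \<kappa>"
        then have "\<nu> = \<kappa> \<or> \<nu> \<sqsubset> \<kappa>" using next_pos_least[of g \<kappa>] by (simp only: g(2))
        then show False
          using \<kappa>\<nu> topdiff_irrefl[of "(<)" \<kappa>] colex_trans[OF \<kappa>\<nu> _ \<kappa>t(1) \<nu>t \<kappa>t(1)] by blast
      qed
    qed
    moreover have "comparison \<nu> = comparison f"
    proof -
      have "last_diff r i \<nu> g \<longleftrightarrow> last_diff r i f g" if "r < k" for r i g
      proof -
        have "h \<sqsubset> \<nu> \<longleftrightarrow> h \<sqsubset> f" if "h \<in> differ r i" for h
          using below[of h] differ_relevant[OF \<open>r < k\<close>, of i] that by blast
        then show ?thesis unfolding last_diff_def by auto
      qed
      then show ?thesis unfolding comparison_def by (intro ext) (auto split: prod.splits)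
    qed
    ultimately show "\<not> flag \<nu> \<and> comparison \<nu> = comparison f" ..
  qed
qed

text \<open>Flag and comparisons are eventually constant, so only the label varies before the limit. The positions
  with a large coordinate \<open>j\<close> and zeros below it show the state \<open>s0\<close> cofinally, which is
  the witness that distinguishes \<open>j\<close> from smaller indices.\<close>
lemma st_limit:
  assumes fin: "finite nonzero" and f: "f \<in> positions_le n" "f \<noteq> (\<lambda>_. 0)" "f 0 = 0"
  shows "(inf_before st f, st f) \<in> limits"
proof -
  have ft: "f \<in> tuples_upto (Suc n)" by (rule pos_tuples[OF f(1)])
  obtain \<mu>0 where \<mu>0: "\<mu>0 \<sqsubset> f" and const: "\<And>\<nu>. \<mu>0 \<sqsubset> \<nu> \<Longrightarrow> \<nu> \<sqsubset> f \<Longrightarrow> \<not> flag \<nu> \<and> comparison \<nu> = comparison f"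
    using eventually_constant[OF fin f] by blast
  obtain j q where j: "\<And>i. i \<le> j \<Longrightarrow> f i = 0" and fj: "f (Suc j) = Suc q"
  proof -
    have ex: "\<exists>i. f i \<noteq> 0" using f(2) by auto
    define i where "i = (LEAST i. f i \<noteq> 0)"
    have "f i \<noteq> 0" "\<And>l. l < i \<Longrightarrow> f l = 0"
      unfolding i_def using LeastI_ex[OF ex] not_less_Least by auto
    moreover then have "i \<noteq> 0" using f(3) by metis
    ultimately show ?thesis by (intro that[of "i - 1" "f i - 1"]) auto
  qed
  let ?a = "\<lambda>M. f(Suc j := q, j := M)"
  let ?S = "inf_before st f"
  have S_ex: "\<exists>\<nu>. \<mu> \<sqsubset> \<nu> \<and> \<nu> \<sqsubset> f \<and> st \<nu> = s" if "s \<in> ?S" "\<mu> \<sqsubset> f" for s \<mu>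
    using that by (simp add: inf_before_def)
  have less_a: "?a N \<sqsubset> f" unfolding topdiff_less_def using fj by (intro exI[of _ "Suc j"]) auto
  have S_state: "s \<in> state_set \<and> \<not> fst (snd s) \<and> snd (snd s) = comparison f" if s: "s \<in> ?S" for s
  proof -
    obtain \<nu> where \<nu>: "\<mu>0 \<sqsubset> \<nu>" "\<nu> \<sqsubset> f" "st \<nu> = s" using S_ex[OF s \<mu>0] by blast
    have "\<nu> \<in> positions_le n" using below_positions_le[OF \<nu>(2) f(1)] by (simp add: positions_le_def)
    then have "st \<nu> \<in> state_set" by (rule st_state)
    then show ?thesis using const[OF \<nu>(1,2)] unfolding \<nu>(3)[symmetric] by (simp add: st_def)
  qed
  define s0 where "s0 = (label N (?a N), False, comparison f)"
  have s0: "s0 \<in> ?S"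
    unfolding inf_before_def mem_Collect_eq
  proof (intro allI impI)
    fix \<mu> assume \<mu>: "\<mu> \<sqsubset> f"
    have t: "\<mu> \<in> tuples_upto (Suc n)" "\<mu>0 \<in> tuples_upto (Suc n)"
      using colex_tuples_upto_down[OF _ ft] \<mu> \<mu>0 by auto
    have "\<exists>\<mu>'. \<mu>' \<sqsubset> f \<and> (\<mu> = \<mu>' \<or> \<mu> \<sqsubset> \<mu>') \<and> (\<mu>0 = \<mu>' \<or> \<mu>0 \<sqsubset> \<mu>')"
    proof (cases "\<mu> \<sqsubset> \<mu>0")
      case True
      then show ?thesis using \<mu>0 by (intro exI[of _ \<mu>0]) simp
    next
      case False
      then show ?thesis using \<mu> colex_total[OF t] by (intro exI[of _ \<mu>]) auto
    qed
    then obtain \<mu>' where \<mu>': "\<mu>' \<sqsubset> f" "\<mu> = \<mu>' \<or> \<mu> \<sqsubset> \<mu>'" "\<mu>0 = \<mu>' \<or> \<mu>0 \<sqsubset> \<mu>'"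
      by (elim exE conjE)
    have t': "\<mu>' \<in> tuples_upto (Suc n)" using colex_tuples_upto_down[OF \<mu>'(1) ft] .
    obtain M where M: "N \<le> M" "\<mu>' \<sqsubset> ?a M" "?a M \<sqsubset> f" using above_below_limit[OF j fj \<mu>'(1), of N] by blast
    have at: "?a M \<in> tuples_upto (Suc n)" using colex_tuples_upto_down[OF M(3) ft] .
    have 1: "\<mu> \<sqsubset> ?a M" using \<mu>'(2) M(2) colex_trans[OF _ M(2) t(1) t' at] by blast
    have 2: "\<mu>0 \<sqsubset> ?a M" using \<mu>'(3) M(2) colex_trans[OF _ M(2) t(2) t' at] by blast
    have "label N (?a M) = label N (?a N)" using M(1) by (auto simp: label_def)
    then have "st (?a M) = s0" using const[OF 2 M(3)] by (simp add: st_def s0_def)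
    then show "\<exists>\<nu>. \<mu> \<sqsubset> \<nu> \<and> \<nu> \<sqsubset> f \<and> st \<nu> = s0" using 1 M(3) by blast
  qed
  have "limit_label N (fst ` ?S) (label N f)"
    unfolding limit_label_def
  proof (intro exI[of _ j] conjI)
    show "\<forall>i\<le>j. label N f i = 0" using j by (simp add: label_def)
    show "\<exists>s\<in>fst ` ?S. \<forall>i<j. s i = 0"
    proof (rule bexI[of _ "fst s0"])
      show "\<forall>i<j. fst s0 i = 0" using j by (auto simp: s0_def label_def)
      show "fst s0 \<in> fst ` ?S" using s0 by (rule imageI)
    qed
    show "\<forall>s\<in>fst ` ?S. s j = N \<and> label N f (Suc j) = min (Suc (s (Suc j))) N \<and> (\<forall>i>Suc j. s i = label N f i)"
    proof
      fix s assume "s \<in> fst ` ?S"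
      then obtain s' where s': "s' \<in> ?S" "s = fst s'" by blast
      obtain \<nu> where \<nu>: "?a N \<sqsubset> \<nu>" "\<nu> \<sqsubset> f" "st \<nu> = s'" using S_ex[OF s'(1) less_a] by blast
      have s: "s = label N \<nu>" using s'(2) \<nu>(3) by (auto simp: st_def)
      have b: "N \<le> \<nu> j" "\<nu> (Suc j) = q" "\<And>i. Suc j < i \<Longrightarrow> \<nu> i = f i"
        using below_limit[OF j fj \<nu>(1,2)] by blast+
      then show "s j = N \<and> label N f (Suc j) = min (Suc (s (Suc j))) N \<and> (\<forall>i>Suc j. s i = label N f i)"
        using fj by (auto simp: s label_def)
    qed
  qed
  moreover have "\<not> flag f" using f(3) by (auto simp: flag_def next_pos_def)
  moreover have "?S \<subseteq> state_set" using S_state by blast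
  moreover have "?S \<noteq> {}" using s0 by blast
  ultimately show ?thesis
    unfolding limits_def using S_state st_state[OF f(1)] by (auto simp: st_def)
qed

lemma st_run: "finite nonzero \<Longrightarrow> run_seg transitions limits n w st"
  unfolding run_seg_def
proof (intro conjI ballI impI)
  show "(st f, w f, st (next_pos f)) \<in> transitions" if "f \<in> tuples_upto n" for f
    unfolding st_next[OF that] by (rule in_transitions) (use that w st_state in \<open>simp_all add: positions_le_def\<close>)
qed (rule st_limit)

text \<open>Successor transitions are functional, and so are limit transitions, since the set of states that
  occur cofinally determines the label and the comparisons.\<close>
lemma run_unique:
  assumes fin: "finite nonzero" and x: "run_seg transitions limits n w x" "x (\<lambda>_. 0) = start" and f: "f \<in> positions_le n"
  shows "x f = st f"
proof -
  have wo: "strict_wo (positions_le n) colex"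
    by (rule strict_wo_subset[OF strict_wo_colex_tuples[of "Suc n"]]) (use pos_tuples in blast)
  from wo f show ?thesis
  proof (induction f rule: strict_wo_induct)
    case (less f)
    have IH: "x \<nu> = st \<nu>" if "\<nu> \<sqsubset> f" for \<nu>
      using less.IH[OF _ that] below_positions_le[OF that less.hyps] by (simp add: positions_le_def)
    consider "f = (\<lambda>_. 0)" | "f \<noteq> (\<lambda>_. 0)" "f 0 = 0" | "f 0 \<noteq> 0" by blast
    then show ?case
    proof cases
      case 1
      then show ?thesis using x(2) st_start by simp
    next
      case 2
      have "(inf_before x f, x f) \<in> limits" using x(1) less.hyps 2 by (simp add: run_seg_def)
      moreover have "inf_before x f = inf_before st f" by (rule inf_before_cong[OF IH])
      ultimately show ?thesis using st_limit[OF fin less.hyps 2] limits_unique by simp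
    next
      case 3
      define h where "h = f(0 := f 0 - 1)"
      have nh: "next_pos h = f" using 3 by (auto simp: h_def next_pos_def)
      have hf: "h \<sqsubset> f" using less_next_pos[of h] by (simp only: nh)
      then have h: "h \<in> tuples_upto n" using less.hyps by (rule below_positions_le)
      then have "(x h, w h, x (next_pos h)) \<in> transitions" using x(1) unfolding run_seg_def by blast
      then have "x f = step (x h) (w h)" unfolding nh by (auto simp: transitions_def)
      then show ?thesis using st_next[OF h] IH[OF hf] nh by simp
    qed
  qed
qed

text \<open>If infinitely many letters were nonzero, consider the least position with infinitely many of them
  before it. It is a limit, and flags occur cofinally before it; finitely many states carry a flag, so
  one of them occurs cofinally, which no limit transition admits.\<close>
lemma run_finite:
  assumes x: "run_seg transitions limits n w x"
  shows "finite nonzero"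
proof (rule ccontr)
  assume inf: "infinite nonzero"
  have wo: "strict_wo (positions_le n) colex"
    by (rule strict_wo_subset[OF strict_wo_colex_tuples[of "Suc n"]]) (use pos_tuples in blast)
  let ?P = "{f\<in>positions_le n. infinite {g\<in>nonzero. g \<sqsubset> f}}"
  have "{g\<in>nonzero. g \<sqsubset> unit_at n} = nonzero" by (auto simp: nonzero_def less_unit_at_iff)
  then have "unit_at n \<in> ?P" using inf by (simp add: positions_le_def)
  then have "\<exists>f\<in>?P. \<forall>y\<in>?P. \<not> y \<sqsubset> f" by (intro strict_wo_min[OF wo]) auto
  then obtain f where f: "f \<in> ?P" "\<forall>y\<in>?P. \<not> y \<sqsubset> f" by blast
  have fp: "f \<in> positions_le n" and fi: "infinite {g\<in>nonzero. g \<sqsubset> f}" using f(1) by auto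
  have fin: "finite {g\<in>nonzero. g \<sqsubset> \<mu>}" if "\<mu> \<sqsubset> f" for \<mu>
  proof -
    have "\<mu> \<in> positions_le n" using below_positions_le[OF that fp] by (simp add: positions_le_def)
    then show ?thesis using f(2) that by blast
  qed
  have f0: "f \<noteq> (\<lambda>_. 0)"
  proof
    assume "f = (\<lambda>_. 0)"
    then have "{g\<in>nonzero. g \<sqsubset> f} = {}" by (auto simp: topdiff_less_def)
    then show False using fi by (metis finite.emptyI)
  qed
  have lim: "f 0 = 0"
  proof (rule ccontr)
    assume "f 0 \<noteq> 0"
    define h where "h = f(0 := f 0 - 1)"
    have nh: "next_pos h = f" using \<open>f 0 \<noteq> 0\<close> by (auto simp: h_def next_pos_def)
    have hf: "h \<sqsubset> f" using less_next_pos[of h] by (simp only: nh)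
    then have h: "h \<in> tuples_upto n" using fp by (rule below_positions_le)
    have "{g\<in>nonzero. g \<sqsubset> f} \<subseteq> insert h {g\<in>nonzero. g \<sqsubset> h}"
      using less_next_pos_iff[OF h] unfolding nh by (auto simp: nonzero_def)
    then show False using fi fin[OF hf] by (meson finite_insert finite_subset)
  qed
  have "\<exists>q\<in>{q\<in>state_set. fst (snd q)}. q \<in> inf_before x f"
  proof (rule inf_before_pigeonhole[OF pos_tuples[OF fp] f0])
    show "finite {q\<in>state_set. fst (snd q)}" using finite_state_set by simp
    fix \<mu> assume \<mu>: "\<mu> \<sqsubset> f"
    have n\<mu>: "next_pos \<mu> \<sqsubset> f" by (rule next_pos_below_limit[OF \<mu> lim])
    have "\<not> {g\<in>nonzero. g \<sqsubset> f} \<subseteq> {g\<in>nonzero. g \<sqsubset> next_pos \<mu>}" using fin[OF n\<mu>] fi finite_subset by blast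
    then obtain g where g: "g \<in> nonzero" "g \<sqsubset> f" "\<not> g \<sqsubset> next_pos \<mu>" by blast
    have gt: "g \<in> tuples_upto n" using g(1) by (simp add: nonzero_def)
    have \<mu>t: "\<mu> \<in> tuples_upto n" by (rule below_positions_le[OF \<mu> fp])
    have "\<mu> \<sqsubset> g" using g(3) less_next_pos_iff[OF \<mu>t gt] colex_total[OF gt \<mu>t] by blast
    have t: "\<mu> \<in> tuples_upto (Suc n)" "g \<in> tuples_upto (Suc n)" "next_pos g \<in> tuples_upto (Suc n)"
      using tuples_upto_Suc \<mu>t gt pos_tuples[OF next_pos_positions[OF gt]] by auto
    have 1: "\<mu> \<sqsubset> next_pos g" by (rule colex_trans[OF \<open>\<mu> \<sqsubset> g\<close> less_next_pos t])
    have 2: "next_pos g \<sqsubset> f" by (rule next_pos_below_limit[OF g(2) lim])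
    have tr: "(x g, w g, x (next_pos g)) \<in> transitions" using x gt unfolding run_seg_def by blast
    then have sx: "x g \<in> state_set" "x (next_pos g) = step (x g) (w g)" by (auto simp: transitions_def)
    have "\<exists>r<k. track (w g) (fst (x g)) r \<noteq> {}"
    proof -
      obtain r where "r < k" "D g r \<noteq> {}" using g(1) by (auto simp: nonzero_def)
      then show ?thesis by (intro exI[of _ r]) (simp add: D_def track_def)
    qed
    then have "fst (snd (step (x g) (w g)))" by (simp add: step_def)
    then have "x (next_pos g) \<in> {q\<in>state_set. fst (snd q)}"
      using sx(2) step_state[OF sx(1)] by simp
    then show "\<exists>\<nu>. \<mu> \<sqsubset> \<nu> \<and> \<nu> \<sqsubset> f \<and> x \<nu> \<in> {q\<in>state_set. fst (snd q)}" using 1 2 by blast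
  qed
  moreover have "(inf_before x f, x f) \<in> limits" using x fp f0 lim by (simp add: run_seg_def)
  ultimately show False by (auto simp: limits_def)
qed

text \<open>The set of position-track pairs of word \<open>r\<close>, as a characteristic function on tuples.\<close>
definition word_fun :: "nat \<Rightarrow> (nat \<Rightarrow> nat) \<Rightarrow> nat" where
  "word_fun r e = (if e \<in> tuples_upto (Suc n) \<and> e n \<in> D (e(n := 0)) r then 1 else 0)"

lemma word_fun_last: "word_fun k = u"
proof
  fix e
  have "u e \<le> 1" "e \<notin> tuples_upto (Suc n) \<Longrightarrow> u e = 0"
    using u by (auto simp: track_functions_def fin_supp_def)
  then show "word_fun k e = u e" by (auto simp: word_fun_def D_def track_def le_Suc_eq)
qed

lemma last_diff_exists:
  assumes fin: "finite nonzero" and r: "r < k" and ne: "differ r i \<noteq> {}"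
  shows "\<exists>g. last_diff r i (unit_at n) g"
proof -
  have "finite (differ r i)" using finite_subset[OF differ_relevant[OF r] finite_relevant[OF fin]] .
  moreover have sub: "differ r i \<subseteq> tuples_upto n" by (auto simp: differ_def)
  ultimately obtain g where g: "g \<in> differ r i" "\<forall>h\<in>differ r i. h = g \<or> h \<sqsubset> g"
    using strict_wo_finite_max[OF strict_wo_colex_tuples _ ne] by blast
  have "\<not> g \<sqsubset> h" if "h \<in> differ r i" for h
  proof
    assume gh: "g \<sqsubset> h"
    have "h = g \<or> h \<sqsubset> g" using g(2) that by blast
    then show False using gh topdiff_irrefl[of "(<)" g] colex_trans[OF gh, of g n] sub g(1) that by blast
  qed
  then show ?thesis unfolding last_diff_def using g(1) sub by (auto simp: less_unit_at_iff)
qed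

lemma last_diff_unique: "last_diff r i f g \<Longrightarrow> last_diff r i f h \<Longrightarrow> g = h"
  using colex_total[of g n h] by (auto simp: last_diff_def differ_def)

lemma comparison_zero:
  assumes "finite nonzero" "r < k" "i < m"
  shows "comparison (unit_at n) (r, i) = 0 \<longleftrightarrow> differ r i = {}"
proof
  assume c: "comparison (unit_at n) (r, i) = 0"
  show "differ r i = {}"
  proof (rule ccontr)
    assume "differ r i \<noteq> {}"
    then obtain g where g: "last_diff r i (unit_at n) g" using last_diff_exists assms by blast
    then have "i \<in> D g r \<or> i \<in> D g (Suc r)" by (auto simp: last_diff_def differ_def)
    then show False using c g assms by (auto simp: comparison_def split: if_splits)
  qed
qed (auto simp: comparison_def last_diff_def)

lemma comparison_one:
  assumes "r < k" "i < m"
  shows "comparison (unit_at n) (r, i) = 1 \<longleftrightarrow> (\<exists>g. last_diff r i (unit_at n) g \<and> i \<in> D g (Suc r) \<and> i \<notin> D g r)"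
proof
  assume c: "comparison (unit_at n) (r, i) = 1"
  then obtain g where g: "last_diff r i (unit_at n) g" "i \<in> D g (Suc r)"
    using assms by (auto simp: comparison_def split: if_splits)
  then have "i \<notin> D g r" by (auto simp: last_diff_def differ_def)
  then show "\<exists>g. last_diff r i (unit_at n) g \<and> i \<in> D g (Suc r) \<and> i \<notin> D g r" using g by blast
next
  assume "\<exists>g. last_diff r i (unit_at n) g \<and> i \<in> D g (Suc r) \<and> i \<notin> D g r"
  then obtain g where g: "last_diff r i (unit_at n) g" "i \<in> D g (Suc r)" "i \<notin> D g r" by blast
  have "\<not> (\<exists>g'. last_diff r i (unit_at n) g' \<and> i \<in> D g' r)" using last_diff_unique[OF g(1)] g(3) by blast
  then show "comparison (unit_at n) (r, i) = 1" using g assms by (auto simp: comparison_def)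
qed

text \<open>The largest difference of the two functions is on the largest track with a difference, and
  there at the last position where the words differ.\<close>
lemma word_fun_less:
  assumes fin: "finite nonzero" and r: "r < k"
  shows "word_fun r \<lless> word_fun (Suc r) \<longleftrightarrow>
     (\<exists>i<m. comparison (unit_at n) (r, i) = 1 \<and> (\<forall>j. i < j \<longrightarrow> j < m \<longrightarrow> comparison (unit_at n) (r, j) = 0))"
proof
  have blk: "in_block n i g = g(n := i)" if "g \<in> tuples_upto n" for i g
    using that by (auto simp: in_block_def tuples_upto_def)
  have blk0: "(g(n := i))(n := 0) = g" if "g \<in> tuples_upto n" for i g
    using that by (auto simp: tuples_upto_def)
  have wf: "word_fun r (g(n := i)) = (if i \<in> D g r then 1 else 0)" if "g \<in> tuples_upto n" for g i r
    using blk0[OF that, of i] in_block_tuples[OF that, of i] blk[OF that, of i] by (simp add: word_fun_def)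
  {
    assume "word_fun r \<lless> word_fun (Suc r)"
    then obtain b where b: "word_fun r b < word_fun (Suc r) b" and eq: "\<And>c. b \<sqsubset> c \<Longrightarrow> word_fun r c = word_fun (Suc r) c"
      unfolding topdiff_less_def[of colex] by blast
    define g i where "g = b(n := 0)" and "i = b n"
    have bt: "b \<in> tuples_upto (Suc n)" using b by (auto simp: word_fun_def split: if_splits)
    then have g: "g \<in> tuples_upto n" "g(n := i) = b" using in_block_split[OF bt] by (auto simp: g_def i_def)
    have gi: "i \<in> D g (Suc r)" "i \<notin> D g r" using b unfolding g(2)[symmetric] wf[OF g(1)] by (auto split: if_splits)
    have i: "i < m" using D_bound[OF g(1)] gi(1) by blast
    have same: "h \<notin> differ r j" if "b \<sqsubset> h(n := j)" for h j
      using eq[OF that] wf[of h] by (auto simp: differ_def split: if_splits)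
    have "last_diff r i (unit_at n) g"
      unfolding last_diff_def
    proof (intro conjI ballI impI)
      show "g \<in> differ r i" using g gi by (simp add: differ_def)
      show "g \<sqsubset> unit_at n" using g(1) by (simp add: less_unit_at_iff)
      fix h assume h: "h \<in> differ r i" "g \<sqsubset> h"
      have ht: "h \<in> tuples_upto n" using h(1) by (simp add: differ_def)
      have "in_block n i g \<sqsubset> in_block n i h" using h(2) by simp
      then have "b \<sqsubset> h(n := i)" using blk[OF g(1)] blk[OF ht] g(2) by simp
      then show "\<not> h \<sqsubset> unit_at n" using same h(1) by blast
    qed
    then have "comparison (unit_at n) (r, i) = 1" using comparison_one[OF r i] gi by blast
    moreover have "comparison (unit_at n) (r, j) = 0" if j: "i < j" "j < m" for j
    proof -
      have "differ r j = {}"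
      proof (rule ccontr)
        assume "differ r j \<noteq> {}"
        then obtain h where h: "h \<in> differ r j" by blast
        then have "h \<in> tuples_upto n" by (simp add: differ_def)
        then have "h(n := j) \<in> tuples_upto (Suc n)" using in_block_tuples[of h n j] blk[of h j] by simp
        then have "b \<sqsubset> h(n := j)" using bt j(1) by (intro colex_topI[of _ n]) (auto simp: i_def)
        then show False using same h by blast
      qed
      then show ?thesis using comparison_zero[OF fin r j(2)] by blast
    qed
    ultimately show "\<exists>i<m. comparison (unit_at n) (r, i) = 1 \<and> (\<forall>j. i < j \<longrightarrow> j < m \<longrightarrow> comparison (unit_at n) (r, j) = 0)"
      using i by blast
  next
    assume "\<exists>i<m. comparison (unit_at n) (r, i) = 1 \<and> (\<forall>j. i < j \<longrightarrow> j < m \<longrightarrow> comparison (unit_at n) (r, j) = 0)"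
    then obtain i where i: "i < m" "comparison (unit_at n) (r, i) = 1" "\<forall>j. i < j \<longrightarrow> j < m \<longrightarrow> comparison (unit_at n) (r, j) = 0"
      by blast
    obtain g where g: "last_diff r i (unit_at n) g" "i \<in> D g (Suc r)" "i \<notin> D g r"
      using comparison_one[OF r i(1)] i(2) by blast
    have gt: "g \<in> tuples_upto n" using g(1) by (simp add: last_diff_def differ_def)
    have bt: "g(n := i) \<in> tuples_upto (Suc n)" using in_block_tuples[OF gt, of i] blk[OF gt] by simp
    have "word_fun r c = word_fun (Suc r) c" if c: "g(n := i) \<sqsubset> c" for c
    proof (cases "c \<in> tuples_upto (Suc n)")
      case ct: True
      define h where "h = c(n := 0)"
      have h: "h \<in> tuples_upto n" "h(n := c n) = c" using in_block_split[OF ct] by (auto simp: h_def)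
      have le: "i \<le> c n" using colex_top_le[OF c ct] by simp
      have "(c n \<in> D h r) = (c n \<in> D h (Suc r))"
      proof (cases "c n = i")
        case True
        have "in_block n i g \<sqsubset> in_block n i h" using c h(2) True blk[OF gt] blk[OF h(1)] by simp
        then have "g \<sqsubset> h" by simp
        then have "h \<notin> differ r i" using g(1) h(1) less_unit_at_iff by (auto simp: last_diff_def)
        then show ?thesis using h(1) True by (simp add: differ_def)
      next
        case False
        show ?thesis
        proof (cases "c n < m")
          case True
          then have "differ r (c n) = {}" using comparison_zero[OF fin r True] i(3) le False by simp
          then show ?thesis using h(1) by (auto simp: differ_def)
        next
          case False
          then show ?thesis using D_bound[OF h(1)] by blast
        qed
      qed
      then show ?thesis using wf[OF h(1), of _ "c n"] h(2) by simp
    qed (simp add: word_fun_def)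
    moreover have "word_fun r (g(n := i)) < word_fun (Suc r) (g(n := i))" using wf[OF gt] g by simp
    ultimately show "word_fun r \<lless> word_fun (Suc r)" unfolding topdiff_less_def[of colex] by blast
  }
qed

lemma accepted_iff:
  "(\<exists>x. run_seg transitions limits n w x \<and> x (\<lambda>_. 0) = start \<and> x (unit_at n) \<in> accepting_states) \<longleftrightarrow>
     finite nonzero \<and> (\<forall>r<k. word_fun r \<lless> word_fun (Suc r))"
proof -
  have top: "unit_at n \<in> positions_le n" by (simp add: positions_le_def)
  have acc: "st (unit_at n) \<in> accepting_states \<longleftrightarrow> (\<forall>r<k. word_fun r \<lless> word_fun (Suc r))" if "finite nonzero"
    using st_state[OF top] word_fun_less[OF that] by (simp add: accepting_states_def st_def)
  show ?thesis
  proof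
    assume "\<exists>x. run_seg transitions limits n w x \<and> x (\<lambda>_. 0) = start \<and> x (unit_at n) \<in> accepting_states"
    then obtain x where x: "run_seg transitions limits n w x" "x (\<lambda>_. 0) = start" "x (unit_at n) \<in> accepting_states" by blast
    have fin: "finite nonzero" by (rule run_finite[OF x(1)])
    then show "finite nonzero \<and> (\<forall>r<k. word_fun r \<lless> word_fun (Suc r))"
      using run_unique[OF fin x(1,2) top] x(3) acc by simp
  next
    assume "finite nonzero \<and> (\<forall>r<k. word_fun r \<lless> word_fun (Suc r))"
    then show "\<exists>x. run_seg transitions limits n w x \<and> x (\<lambda>_. 0) = start \<and> x (unit_at n) \<in> accepting_states"
      using st_run st_start acc by (intro exI[of _ st]) simp
  qed
qed

end

section \<open>Words as finite sets of tuples\<close>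

definition fun_of_word :: "nat \<Rightarrow> ((nat \<Rightarrow> nat) \<Rightarrow> nat) \<Rightarrow> (nat \<Rightarrow> nat) \<Rightarrow> nat" where
  "fun_of_word n \<sigma> e = (if e \<in> tuples_upto (Suc n) \<and> e n \<in> set_decode (\<sigma> (pos_of n (e(n := 0)))) then 1 else 0)"

definition word_of_fun :: "nat \<Rightarrow> ((nat \<Rightarrow> nat) \<Rightarrow> nat) \<Rightarrow> (nat \<Rightarrow> nat) \<Rightarrow> nat" where
  "word_of_fun n F = (\<lambda>c\<in>Field (omega_pow n). set_encode {i. F ((code_pos n c)(n := i)) \<noteq> 0})"

definition track_letters :: "nat \<Rightarrow> nat set" where
  "track_letters m = set_encode ` Pow {..<m}"

definition finite_words :: "nat \<Rightarrow> nat \<Rightarrow> ((nat \<Rightarrow> nat) \<Rightarrow> nat) set" where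
  "finite_words n m = {\<sigma> \<in> words (omega_pow n) (track_letters m).
     finite {f \<in> tuples_upto n. \<sigma> (pos_of n f) \<noteq> 0}}"

lemma finite_track_letters: "finite (track_letters m)"
  by (simp add: track_letters_def)

lemma set_decode_track_letters: "a \<in> track_letters m \<Longrightarrow> set_decode a \<subseteq> {..<m}"
proof -
  assume "a \<in> track_letters m"
  then obtain S where S: "S \<subseteq> {..<m}" "a = set_encode S" by (auto simp: track_letters_def)
  then have "finite S" using finite_subset by blast
  then show "set_decode a \<subseteq> {..<m}" using S by simp
qed

lemma set_decode_empty_iff: "set_decode a = {} \<longleftrightarrow> a = 0"
  by (metis set_decode_inverse set_decode_zero set_encode_empty)

lemma fun_of_word_track:
  assumes "\<sigma> \<in> finite_words n m"
  shows "fun_of_word n \<sigma> \<in> track_functions n m"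
proof -
  have \<sigma>: "\<sigma> (pos_of n f) \<in> track_letters m" if "f \<in> tuples_upto n" for f
    using assms pos_of[OF that] by (auto simp: finite_words_def words_def)
  let ?K = "{f \<in> tuples_upto n. \<sigma> (pos_of n f) \<noteq> 0}"
  let ?B = "(\<lambda>(f, i). f(n := i)) ` (?K \<times> {..<m})"
  have supp: "e \<in> ?B \<and> e n < m" if "fun_of_word n \<sigma> e \<noteq> 0" for e
  proof -
    have e: "e \<in> tuples_upto (Suc n)" "e n \<in> set_decode (\<sigma> (pos_of n (e(n := 0))))"
      using that by (auto simp: fun_of_word_def split: if_splits)
    have t: "e(n := 0) \<in> tuples_upto n" using in_block_split[OF e(1)] by blast
    have "\<sigma> (pos_of n (e(n := 0))) \<noteq> 0" using e(2) by (metis empty_iff set_decode_zero)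
    moreover have "e n < m" using e(2) set_decode_track_letters[OF \<sigma>[OF t]] by blast
    ultimately have "(e(n := 0), e n) \<in> ?K \<times> {..<m}" using t by blast
    then have "(\<lambda>(f, i). f(n := i)) (e(n := 0), e n) \<in> ?B" by (rule imageI)
    then show ?thesis using \<open>e n < m\<close> by simp
  qed
  have "finite ?B" using assms by (auto simp: finite_words_def)
  moreover have "?B \<subseteq> tuples_upto (Suc n)" by (auto simp: tuples_upto_def)
  ultimately have "fun_of_word n \<sigma> \<in> fin_supp (tuples_upto (Suc n))"
    by (rule fin_suppI) (use supp in blast)
  then show ?thesis using supp by (auto simp: track_functions_def) (auto simp: fun_of_word_def)
qed

lemma word_of_fun_inverse:
  assumes F: "F \<in> track_functions n m"
  shows "word_of_fun n F \<in> finite_words n m" "fun_of_word n (word_of_fun n F) = F"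
proof -
  have Fm: "{i. F (f(n := i)) \<noteq> 0} \<subseteq> {..<m}" for f
  proof
    fix i assume "i \<in> {i. F (f(n := i)) \<noteq> 0}"
    then have "(f(n := i)) n < m" using F unfolding track_functions_def by blast
    then show "i \<in> {..<m}" by simp
  qed
  have dec: "set_decode (word_of_fun n F (pos_of n f)) = {i. F (f(n := i)) \<noteq> 0}" if "f \<in> tuples_upto n" for f
    using pos_of[OF that] finite_subset[OF Fm[of f]] by (simp add: word_of_fun_def)
  have "word_of_fun n F \<in> words (omega_pow n) (track_letters m)"
    unfolding words_def word_of_fun_def restrict_PiE_iff track_letters_def
    by (intro ballI imageI PowI Fm)
  moreover have "finite {f \<in> tuples_upto n. word_of_fun n F (pos_of n f) \<noteq> 0}"
  proof (rule finite_subset)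
    show "{f \<in> tuples_upto n. word_of_fun n F (pos_of n f) \<noteq> 0} \<subseteq> (\<lambda>e. e(n := 0)) ` {e. F e \<noteq> 0}"
    proof
      fix f assume "f \<in> {f \<in> tuples_upto n. word_of_fun n F (pos_of n f) \<noteq> 0}"
      then have f: "f \<in> tuples_upto n" "word_of_fun n F (pos_of n f) \<noteq> 0" by auto
      then have "{i. F (f(n := i)) \<noteq> 0} \<noteq> {}" unfolding dec[OF f(1), symmetric] by (simp add: set_decode_empty_iff)
      then obtain i where i: "F (f(n := i)) \<noteq> 0" by auto
      have "(f(n := i))(n := 0) = f" using f(1) by (auto simp: tuples_upto_def)
      then show "f \<in> (\<lambda>e. e(n := 0)) ` {e. F e \<noteq> 0}" using i by (intro image_eqI[of _ _ "f(n := i)"]) auto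
    qed
    show "finite ((\<lambda>e. e(n := 0)) ` {e. F e \<noteq> 0})" using F fin_supp_finite by (auto simp: track_functions_def)
  qed
  ultimately show "word_of_fun n F \<in> finite_words n m" by (simp add: finite_words_def)
  show "fun_of_word n (word_of_fun n F) = F"
  proof
    fix e
    have F1: "F e \<le> 1" "e \<notin> tuples_upto (Suc n) \<Longrightarrow> F e = 0" using F by (auto simp: track_functions_def fin_supp_def)
    show "fun_of_word n (word_of_fun n F) e = F e"
    proof (cases "e \<in> tuples_upto (Suc n)")
      case True
      have "e n \<in> set_decode (word_of_fun n F (pos_of n (e(n := 0)))) \<longleftrightarrow> F e \<noteq> 0"
        using dec[of "e(n := 0)"] in_block_split[OF True] by simp
      then show ?thesis using True F1(1) by (auto simp: fun_of_word_def le_Suc_eq)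
    qed (use F1 in \<open>simp add: fun_of_word_def\<close>)
  qed
qed

lemma fun_of_word_inj:
  assumes "\<sigma> \<in> finite_words n m" "\<tau> \<in> finite_words n m" "fun_of_word n \<sigma> = fun_of_word n \<tau>"
  shows "\<sigma> = \<tau>"
proof (rule PiE_ext)
  show "\<sigma> \<in> Field (omega_pow n) \<rightarrow>\<^sub>E track_letters m" "\<tau> \<in> Field (omega_pow n) \<rightarrow>\<^sub>E track_letters m"
    using assms by (auto simp: finite_words_def words_def)
  fix c assume c: "c \<in> Field (omega_pow n)"
  let ?f = "code_pos n c"
  have f: "?f \<in> tuples_upto n" "pos_of n ?f = c" using code_pos_tuples[OF c] pos_of_code_pos[OF c] by auto
  have "i \<in> set_decode (\<sigma> c) \<longleftrightarrow> i \<in> set_decode (\<tau> c)" for i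
  proof -
    have 1: "?f(n := i) \<in> tuples_upto (Suc n)" using f(1) by (auto simp: tuples_upto_def)
    have 2: "(?f(n := i))(n := 0) = ?f" using f(1) by (auto simp: tuples_upto_def)
    have "fun_of_word n \<sigma> (?f(n := i)) = fun_of_word n \<tau> (?f(n := i))" using assms(3) by simp
    moreover have "fun_of_word n \<rho> (?f(n := i)) = (if i \<in> set_decode (\<rho> c) then 1 else 0)" for \<rho>
      unfolding fun_of_word_def 2 f(2) using 1 by simp
    ultimately show ?thesis by (simp split: if_splits)
  qed
  then have "set_decode (\<sigma> c) = set_decode (\<tau> c)" by blast
  then show "\<sigma> c = \<tau> c" by (metis set_decode_inverse)
qed

section \<open>Ordinals below \<open>\<omega>^(\<omega>^n)\<close> are automatic\<close>

text \<open>The number \<open>N\<close> exceeds all coordinates of positions in the finite support of \<open>u\<close>.\<close>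

lemma chain_language:
  fixes letters :: "'l \<Rightarrow> nat list" and \<Sigma> :: "'l set"
  assumes \<Sigma>: "finite \<Sigma>" and u: "u \<in> track_functions n m"
    and letter: "\<And>a r. a \<in> \<Sigma> \<Longrightarrow> r < k \<Longrightarrow> letters a ! r \<in> track_letters m"
  obtains B :: "('l, nat) automaton" where "ordinal_automaton B" "alphabet B = \<Sigma>"
    "\<And>\<sigma>. \<sigma> \<in> words (omega_pow n) \<Sigma> \<Longrightarrow> \<sigma> \<in> language (omega_pow n) B \<longleftrightarrow>
       (\<forall>r<k. finite {f \<in> tuples_upto n. letters (\<sigma> (pos_of n f)) ! r \<noteq> 0}) \<and>
       (\<forall>r<k. fun_of_word n (\<lambda>c. letters (\<sigma> c) ! r) \<lless>
          (if Suc r < k then fun_of_word n (\<lambda>c. letters (\<sigma> c) ! Suc r) else u))"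
proof -
  obtain N where N: "0 < N" "\<And>e i. u e \<noteq> 0 \<Longrightarrow> i < n \<Longrightarrow> e i < N"
  proof -
    have "finite ((\<lambda>(e, i). e i) ` ({e. u e \<noteq> 0} \<times> {..<n}))"
      using u fin_supp_finite by (auto simp: track_functions_def)
    then obtain M where M: "\<forall>x\<in>(\<lambda>(e, i). e i) ` ({e. u e \<noteq> 0} \<times> {..<n}). x \<le> M"
      using finite_nat_set_iff_bounded_le by blast
    have "e i < Suc M" if "u e \<noteq> 0" "i < n" for e i
      using bspec[OF M, of "e i"] that by (force simp: less_Suc_eq_le)
    then show ?thesis by (intro that[of "Suc M"]) auto
  qed
  interpret chain_automaton n m k N u letters \<Sigma>
    using \<Sigma> N u letter set_decode_track_letters by unfold_locales blast+
  have accepting_sub: "accepting_states \<subseteq> state_set" by (auto simp: accepting_states_def)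
  obtain B :: "('l, nat) automaton" where B: "ordinal_automaton B" "alphabet B = \<Sigma>"
    "\<And>n w. (\<exists>x. run_seg (succ_trans B) (lim_trans B) n w x \<and> x (\<lambda>_. 0) = initial B \<and> x (unit_at n) \<in> final B) \<longleftrightarrow>
       (\<exists>x. run_seg transitions limits n w x \<and> x (\<lambda>_. 0) = start \<and> x (unit_at n) \<in> accepting_states)"
    by (rule rename_states[OF finite_state_set finite_\<Sigma> transitions_sub limits_sub start_state accepting_sub])
      (rule that)
  have "\<sigma> \<in> language (omega_pow n) B \<longleftrightarrow>
       (\<forall>r<k. finite {f \<in> tuples_upto n. letters (\<sigma> (pos_of n f)) ! r \<noteq> 0}) \<and>
       (\<forall>r<k. fun_of_word n (\<lambda>c. letters (\<sigma> c) ! r) \<lless>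
          (if Suc r < k then fun_of_word n (\<lambda>c. letters (\<sigma> c) ! Suc r) else u))"
    if \<sigma>: "\<sigma> \<in> words (omega_pow n) \<Sigma>" for \<sigma>
  proof -
    interpret chain_word n m k N u letters \<Sigma> "\<lambda>f. \<sigma> (pos_of n f)"
      by unfold_locales (use \<sigma> pos_of in \<open>auto simp: words_def\<close>)
    have D_r: "D f r = set_decode (letters (\<sigma> (pos_of n f)) ! r)" if r: "r < k" for f r
      using r by (simp add: D_def track_def)
    have "nonzero = (\<Union>r\<in>{..<k}. {f \<in> tuples_upto n. letters (\<sigma> (pos_of n f)) ! r \<noteq> 0})"
      by (auto simp: nonzero_def D_r set_decode_empty_iff)
    then have fin: "finite nonzero \<longleftrightarrow> (\<forall>r<k. finite {f \<in> tuples_upto n. letters (\<sigma> (pos_of n f)) ! r \<noteq> 0})"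
      by auto
    have wf: "word_fun r = fun_of_word n (\<lambda>c. letters (\<sigma> c) ! r)" if r: "r < k" for r
      by (rule ext) (simp add: word_fun_def fun_of_word_def D_r[OF r])
    have wf': "word_fun (Suc r) = (if Suc r < k then fun_of_word n (\<lambda>c. letters (\<sigma> c) ! Suc r) else u)" if r: "r < k" for r
    proof (cases "Suc r < k")
      case False
      then have "Suc r = k" using r by simp
      then show ?thesis using word_fun_last by simp
    qed (simp add: wf)
    show ?thesis
      unfolding language_omega_pow[OF B(1)] B(3) accepted_iff fin using \<sigma> B(2) wf wf' by simp
  qed
  then show ?thesis using that B(1,2) by blast
qed

text \<open>The domain consists of the words whose function lies below \<open>u\<close>, which are the chains of length one.
  For the relation it suffices to ask that \<open>v < w < u\<close>, because then \<open>v\<close> is in the domain as well, so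
  it is given by the chains of length two.\<close>
theorem less_imp_automatic:
  fixes \<alpha> :: "'a rel"
  assumes n: "1 \<le> n" and \<alpha>: "Well_order \<alpha>" and less: "(\<alpha>, opow natLeq (omega_pow n)) \<in> ordLess"
  shows "injectively_automatic (omega_pow n) (ordinal_structure \<alpha>)"
proof -
  let ?r = "omega_pow n"
  obtain m u g where u: "u \<in> track_functions n m" and g: "bij_betw g (Field \<alpha>) {F\<in>track_functions n m. F \<lless> u}"
    and mono: "\<And>i j. i \<in> Field \<alpha> \<Longrightarrow> j \<in> Field \<alpha> \<Longrightarrow> i \<in> underS \<alpha> j \<longleftrightarrow> g i \<lless> g j"
    by (rule segment_of_track_functions[OF n \<alpha> less]) (rule that)
  let ?\<Sigma> = "track_letters m" and ?F = "fun_of_word n"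
  obtain A :: "(nat, nat) automaton" where A: "ordinal_automaton A" "alphabet A = ?\<Sigma>"
    and LA: "\<And>\<sigma>. \<sigma> \<in> words ?r ?\<Sigma> \<Longrightarrow> \<sigma> \<in> language ?r A \<longleftrightarrow>
       (\<forall>r<1. finite {f \<in> tuples_upto n. [\<sigma> (pos_of n f)] ! r \<noteq> 0}) \<and>
       (\<forall>r<1. ?F (\<lambda>c. [\<sigma> c] ! r) \<lless> (if Suc r < 1 then ?F (\<lambda>c. [\<sigma> c] ! Suc r) else u))"
    by (rule chain_language[OF finite_track_letters u, where k = 1 and letters = "\<lambda>a. [a]"]) (simp, rule that)
  obtain B :: "(nat list, nat) automaton" where B: "ordinal_automaton B" "alphabet B = tuples 2 ?\<Sigma>"
    and LB: "\<And>\<sigma>. \<sigma> \<in> words ?r (tuples 2 ?\<Sigma>) \<Longrightarrow> \<sigma> \<in> language ?r B \<longleftrightarrow>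
       (\<forall>r<2. finite {f \<in> tuples_upto n. \<sigma> (pos_of n f) ! r \<noteq> 0}) \<and>
       (\<forall>r<2. ?F (\<lambda>c. \<sigma> c ! r) \<lless> (if Suc r < 2 then ?F (\<lambda>c. \<sigma> c ! Suc r) else u))"
  proof (rule chain_language[OF _ u, where \<Sigma> = "tuples 2 ?\<Sigma>" and k = 2 and letters = "\<lambda>a. a"])
    show "finite (tuples 2 ?\<Sigma>)"
      unfolding tuples_def using finite_lists_length_eq[OF finite_track_letters[of m], of 2] by (simp add: conj_commute)
    show "a ! r \<in> track_letters m" if "a \<in> tuples 2 ?\<Sigma>" "r < 2" for a r
      using that by (auto simp: tuples_def)
  qed (rule that)
  have L: "language ?r A = {\<sigma> \<in> finite_words n m. ?F \<sigma> \<lless> u}"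
  proof (intro set_eqI)
    fix \<sigma> show "\<sigma> \<in> language ?r A \<longleftrightarrow> \<sigma> \<in> {\<sigma> \<in> finite_words n m. ?F \<sigma> \<lless> u}"
      using LA[of \<sigma>] A(2) by (cases "\<sigma> \<in> words ?r ?\<Sigma>") (auto simp: finite_words_def language_def)
  qed
  let ?R = "accepted_relation ?r ?\<Sigma> 2 B"
  have R: "[v, w] \<in> ?R \<longleftrightarrow> v \<in> finite_words n m \<and> w \<in> finite_words n m \<and> ?F v \<lless> ?F w \<and> ?F w \<lless> u" for v w
  proof (cases "v \<in> words ?r ?\<Sigma> \<and> w \<in> words ?r ?\<Sigma>")
    case True
    have tw: "tuple_word ?r [v, w] \<in> words ?r (tuples 2 ?\<Sigma>)"
      using True by (auto simp: words_def tuple_word_def tuples_def PiE_def Pi_def)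
    have at: "tuple_word ?r [v, w] (pos_of n f) = [v (pos_of n f), w (pos_of n f)]" if "f \<in> tuples_upto n" for f
      using pos_of[OF that] by (simp add: tuple_word_def)
    have fin: "{f \<in> tuples_upto n. tuple_word ?r [v, w] (pos_of n f) ! r \<noteq> 0} =
        {f \<in> tuples_upto n. [v (pos_of n f), w (pos_of n f)] ! r \<noteq> 0}" for r using at by auto
    have F: "?F (\<lambda>c. tuple_word ?r [v, w] c ! r) = ?F (\<lambda>c. [v c, w c] ! r)" for r
    proof
      fix e show "?F (\<lambda>c. tuple_word ?r [v, w] c ! r) e = ?F (\<lambda>c. [v c, w c] ! r) e"
        using at[of "e(n := 0)"] in_block_split[of e n] by (auto simp: fun_of_word_def)
    qed
    have two: "(\<forall>r<2. P r) \<longleftrightarrow> P 0 \<and> P (Suc 0)" for P :: "nat \<Rightarrow> bool"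
      by (auto simp: numeral_2_eq_2 less_Suc_eq)
    have "tuple_word ?r [v, w] \<in> language ?r B \<longleftrightarrow>
        (finite {f \<in> tuples_upto n. v (pos_of n f) \<noteq> 0} \<and> finite {f \<in> tuples_upto n. w (pos_of n f) \<noteq> 0}) \<and>
        ?F v \<lless> ?F w \<and> ?F w \<lless> u"
      unfolding LB[OF tw] fin F two by simp
    then show ?thesis using True by (simp add: accepted_relation_def tuples_def finite_words_def conj_assoc)
  next
    case False
    have "\<not> (v \<in> words ?r ?\<Sigma> \<and> w \<in> words ?r ?\<Sigma>)" by (rule False)
    moreover have "v \<in> words ?r ?\<Sigma> \<and> w \<in> words ?r ?\<Sigma>" if "[v, w] \<in> ?R"
      using that by (simp add: accepted_relation_def tuples_def)
    moreover have "v \<in> words ?r ?\<Sigma>" if "v \<in> finite_words n m" for v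
      using that by (simp add: finite_words_def)
    ultimately show ?thesis by meson
  qed
  define h where "h \<sigma> = inv_into (Field \<alpha>) g (?F \<sigma>)" for \<sigma>
  have gh: "g (h \<sigma>) = ?F \<sigma>" and hF: "h \<sigma> \<in> Field \<alpha>" if \<sigma>: "\<sigma> \<in> language ?r A" for \<sigma>
  proof -
    have "?F \<sigma> \<in> g ` Field \<alpha>" using \<sigma> fun_of_word_track[of \<sigma> n m] g by (simp add: L bij_betw_def)
    then show "g (h \<sigma>) = ?F \<sigma>" "h \<sigma> \<in> Field \<alpha>" by (simp_all add: h_def f_inv_into_f inv_into_into)
  qed
  have bij: "bij_betw h (language ?r A) (Field \<alpha>)"
  proof (rule bij_betw_imageI)
    show "inj_on h (language ?r A)"
    proof (rule inj_onI)
      fix \<sigma> \<tau> assume s: "\<sigma> \<in> language ?r A" "\<tau> \<in> language ?r A" "h \<sigma> = h \<tau>"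
      have "?F \<sigma> = g (h \<tau>)" using gh[OF s(1)] s(3) by simp
      then have eq: "?F \<sigma> = ?F \<tau>" using gh[OF s(2)] by simp
      show "\<sigma> = \<tau>" by (rule fun_of_word_inj[of _ n m, OF _ _ eq]) (use s(1,2) in \<open>simp_all add: L\<close>)
    qed
    show "h ` language ?r A = Field \<alpha>"
    proof (intro equalityI subsetI)
      fix i assume i: "i \<in> Field \<alpha>"
      have gi: "g i \<in> track_functions n m" "g i \<lless> u" using g i by (auto simp: bij_betw_def)
      let ?w = "word_of_fun n (g i)"
      have w: "?w \<in> language ?r A" using word_of_fun_inverse[OF gi(1)] gi(2) by (simp add: L)
      have "g (h ?w) = g i" using gh[OF w] word_of_fun_inverse[OF gi(1)] by simp
      then have "h ?w = i" using g hF[OF w] i by (auto simp: bij_betw_def inj_on_def)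
      then show "i \<in> h ` language ?r A" using imageI[OF w, of h] by simp
    qed (auto intro: hF)
  qed
  have R_iso: "[v, w] \<in> ?R \<longleftrightarrow> h v \<in> underS \<alpha> (h w)" if vw: "v \<in> language ?r A" "w \<in> language ?r A" for v w
    using R[of v w] mono[OF hF[OF vw(1)] hF[OF vw(2)]] gh vw by (auto simp: L)
  have R_sub: "?R \<subseteq> tuples 2 (language ?r A)"
  proof
    fix xs assume xs: "xs \<in> ?R"
    then have "length xs = 2" by (simp add: accepted_relation_def tuples_def)
    then obtain v w where vw: "xs = [v, w]" by (auto simp: numeral_2_eq_2 length_Suc_conv)
    have r: "v \<in> finite_words n m" "w \<in> finite_words n m" "?F v \<lless> ?F w" "?F w \<lless> u" using R[of v w] xs by (auto simp: vw)
    have "?F v \<lless> u"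
      by (rule strict_wo_trans[OF strict_wo_track_functions[of n m], of "?F v" "?F w" u, OF r(3,4)])
        (simp_all add: fun_of_word_track[OF r(1)] fun_of_word_track[OF r(2)] u)
    then show "xs \<in> tuples 2 (language ?r A)" using r by (simp add: vw tuples_def L)
  qed
  let ?Bs = "[(2, B)] :: (nat \<times> (nat list, nat) automaton) list"
  let ?W = "(language ?r A, map (\<lambda>(k, B). (k, accepted_relation ?r (alphabet A) k B)) ?Bs)"
  have "is_relstruct ?W" using R_sub by (simp add: is_relstruct_def A(2))
  moreover have "relstruct_iso h ?W (ordinal_structure \<alpha>)"
  proof -
    have "xs \<in> ?R \<longleftrightarrow> map h xs \<in> {[i, j] | i j. i \<in> underS \<alpha> j}" if "xs \<in> tuples 2 (language ?r A)" for xs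
    proof -
      have "length xs = 2" using that by (simp add: tuples_def)
      then obtain v w where vw: "xs = [v, w]" by (auto simp: numeral_2_eq_2 length_Suc_conv)
      then show ?thesis using R_iso[of v w] that by (simp add: tuples_def)
    qed
    then show ?thesis using bij by (simp add: relstruct_iso_def ordinal_structure_def A(2))
  qed
  moreover have "\<forall>(k, B) \<in> set ?Bs. ordinal_automaton B \<and> alphabet B = tuples k (alphabet A)"
    using B by (simp add: A(2))
  ultimately show ?thesis
    unfolding injectively_automatic_def Let_def using A(1) by blast
qed

theorem theorem4p5:
  fixes n :: nat and \<alpha> :: "'a rel"
  assumes "n \<ge> 1" and "Well_order \<alpha>"
  shows "injectively_automatic (omega_pow n) (ordinal_structure \<alpha>) \<longleftrightarrow>
           (\<alpha>, opow natLeq (omega_pow n)) \<in> ordLess"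
  using automatic_imp_less[OF assms(2)] less_imp_automatic[OF assms] by blast

end
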